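(* Let $\alpha,\gamma,\rho,a\in\mathbb{C}$ with $\operatorname{Re}(\alpha)>0$ and $a\ne0$, put $N=[\operatorname{Re}(\alpha)]+1$, and let $\mu$ be a real number, such that $\mu>0$ and $\operatorname{Re}(\rho)+N>\max\{N,\operatorname{Re}(-\alpha-\gamma)\}$. Then the right-sided Caputo-type Erdélyi–Kober fractional derivative ${}^{c}\mathcal{D}_{\gamma,\alpha}^{-}={}^{c}\mathcal{D}_{-}^{\alpha,0,\gamma}$ satisfies, for every $x>0$, $$\left({}^{c}\mathcal{D}_{\gamma,\alpha}^{-}\left(t^{-\rho}I^{m,n}_{p,q}\left[at^{-\mu}\,\middle|\begin{matrix}(a_i,A_i,\alpha_i)_{1,p}\\(b_j,B_j,\beta_j)_{1,q}\end{matrix}\right]\right)\right)(x)=x^{-\rho}\,I^{m,n+1}_{p+1,q+1}\left[ax^{-\mu}\,\middle|\begin{matrix}(1-\alpha-\gamma-\rho-N,\mu,1),\ (a_i,A_i,\alpha_i)_{1,p}\\(b_j,B_j,\beta_j)_{1,q},\ (1-\gamma-\rho-N,\mu,1)\end{matrix}\right].$$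
   Context: **$I$-function.** Let $m,n,p,q$ be integers with $0\le m\le q$, $0\le n\le p$; let $a_i\in\mathbb{C}$, $A_i,\alpha_i>0$ $(1\le i\le p)$ and $b_j\in\mathbb{C}$, $B_j,\beta_j>0$ $(1\le j\le q)$. For $z\neq0$ (with a chosen value of $\arg z$; $z^{-s}=e^{-s(\log|z|+i\arg z)}$), $$I^{m,n}_{p,q}\left[z\,\middle|\begin{matrix}(a_i,A_i,\alpha_i)_{1,p}\\(b_j,B_j,\beta_j)_{1,q}\end{matrix}\right]=\frac{1}{2\pi i}\int_{C}\chi(s)z^{-s}\,ds,\qquad \chi(s)=\frac{\prod_{j=1}^{m}\Gamma^{\beta_j}(b_j+B_js)\prod_{i=1}^{n}\Gamma^{\alpha_i}(1-a_i-A_is)}{\prod_{j=m+1}^{q}\Gamma^{\beta_j}(1-b_j-B_js)\prod_{i=n+1}^{p}\Gamma^{\alpha_i}(a_i+A_is)}.$$ Here $(a_i,A_i,\alpha_i)_{1,p}$ is the ordered list of triples for $i=1,\dots,p$ (the first $n$ upper triples and the first $m$ lower triples enter the numerator), $\Gamma^{\kappa}(w)=(\Gamma(w))^{\kappa}$, with the branch of non-integer powers fixed along $C$ and the same for the same triple in all $I$-functions considered; empty products equal $1$. The singularities of $\Gamma^{\beta_j}(b_j+B_js)$, $j\le m$, lie to the left of $C$ and those of $\Gamma^{\alpha_i}(1-a_i-A_is)$, $i\le n$, to the right. **Standing assumptions.** The contour $C$ is the imaginary axis $\operatorname{Re}(s)=0$, traversed upwards, and for each $I$-function occurring the following conditions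 for absolute convergence hold: with (computed from the parameters of that $I$-function) $\mu^*=\sum_{j=1}^q\beta_jB_j-\sum_{i=1}^p\alpha_iA_i$, $\Omega=\sum_{i=1}^p(\frac12-\operatorname{Re}(a_i))\alpha_i-\sum_{j=1}^q(\frac12-\operatorname{Re}(b_j))\beta_j$, $\Delta=\sum_{j=1}^m\beta_jB_j-\sum_{j=m+1}^q\beta_jB_j+\sum_{i=1}^n\alpha_iA_i-\sum_{i=n+1}^p\alpha_iA_i$, either $\Delta>0$ and $|\arg z|<\frac{\pi}{2}\Delta$, or $\Delta\ge0$, $|\arg z|=\frac{\pi}{2}\Delta$ and one of: $\mu^*=0$ and $\Omega<-1$; or $\mu^*\ne0$ and $\Omega+\sigma\mu^*<-1$ where $\sigma=\operatorname{Re}(s)$ on $C$ (so $\sigma=0$). For $t>0$, $\arg(at^{\pm\mu})=\arg a$. **Operators.** For $\operatorname{Re}(\alpha)>0$, $x>0$, the right-sided Saigo fractional integral is $$\left(\mathcal{I}_{-}^{\alpha,\beta,\gamma}f\right)(x)=\frac{1}{\Gamma(\alpha)}\int_x^{\infty}(t-x)^{\alpha-1}t^{-\alpha-\beta}{}_{2}F_1\left(\alpha+\beta,-\gamma;\alpha;1-\tfrac{x}{t}\right)f(t)\,dt,$$ the right-sided generalized Caputo fractional derivative, applied to functions $f$ that are $N$ times differentiable on $(0,\infty)$, is $$\left({}^{c}\mathcal{D}_{-}^{\alpha,\beta,\gamma}f\right)(x)=(-1)^{N}\left(\mathcal{I}_{-}^{-\alpha+N,-\beta-N,\alpha+\gamma}f^{(N)}\right)(x),\qquad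 N=[\operatorname{Re}(\alpha)]+1,$$ with $[\cdot]$ the integer part and $f^{(N)}$ the $N$-th derivative, and ${}^{c}\mathcal{D}_{\gamma,\alpha}^{-}:={}^{c}\mathcal{D}_{-}^{\alpha,0,\gamma}$. *)

theory Defs
  imports "HOL-Analysis.Analysis"
begin

text \<open>
  A parameter triple (c, D, k) stands for (a_i, A_i, alpha_i) or (b_j, B_j, beta_j). Parameter lists
  are in the order of the paper, so list position i - 1 holds the triple with index i, and
  p and q are the lengths of the upper and lower lists.
\<close>

type_synonym triple = "complex \<times> real \<times> real"

text \<open>
  Branches of the non-integer powers are given by a family L of logarithms of the gamma factors:
  L (c, D, k) is a continuous logarithm of Gamma (c + D s) along the contour Re s = 0.
  A factor depends on its triple only, so equal triples get equal branches in all I-functions.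
  Points of the contour where c + D s is a pole are left out; by the separation condition this
  can happen for denominator factors only.
\<close>

definition is_gamma_branch :: "(triple \<Rightarrow> complex \<Rightarrow> complex) \<Rightarrow> bool" where
  "is_gamma_branch L \<longleftrightarrow>
     (\<forall>c D \<kappa>. let S = {s. Re s = 0 \<and> c + of_real D * s \<notin> \<int>\<^sub>\<le>\<^sub>0} in
        continuous_on S (L (c, D, \<kappa>)) \<and>
        (\<forall>s\<in>S. exp (L (c, D, \<kappa>) s) = Gamma (c + of_real D * s)))"

text \<open>
  At a pole of Gamma the value is 0, and so is its reciprocal in HOL. For a denominator factor this
  is the correct value of 1 / Gamma^k.
\<close>

definition Gamma_pow :: "(triple \<Rightarrow> complex \<Rightarrow> complex) \<Rightarrow> triple \<Rightarrow> complex \<Rightarrow> complex" where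
  "Gamma_pow L = (\<lambda>(c, D, \<kappa>) s.
     if c + of_real D * s \<in> \<int>\<^sub>\<le>\<^sub>0 then 0 else exp (of_real \<kappa> * L (c, D, \<kappa>) s))"

definition I_chi ::
  "(triple \<Rightarrow> complex \<Rightarrow> complex) \<Rightarrow> nat \<Rightarrow> nat \<Rightarrow> triple list \<Rightarrow> triple list \<Rightarrow> complex \<Rightarrow> complex" where
  "I_chi L m n us ls s =
     ((\<Prod>(b, B, \<beta>)\<leftarrow>take m ls. Gamma_pow L (b, B, \<beta>) s) *
      (\<Prod>(a, A, \<alpha>)\<leftarrow>take n us. Gamma_pow L (1 - a, - A, \<alpha>) s)) /
     ((\<Prod>(b, B, \<beta>)\<leftarrow>drop m ls. Gamma_pow L (1 - b, - B, \<beta>) s) *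
      (\<Prod>(a, A, \<alpha>)\<leftarrow>drop n us. Gamma_pow L (a, A, \<alpha>) s))"

text \<open>
  The I-function at z with chosen argument \<open>\<theta>\<close>; the contour is s = i y for real y, with ds = i dy.
\<close>

definition I_fun ::
  "(triple \<Rightarrow> complex \<Rightarrow> complex) \<Rightarrow> nat \<Rightarrow> nat \<Rightarrow> triple list \<Rightarrow> triple list \<Rightarrow>
   complex \<Rightarrow> real \<Rightarrow> complex" where
  "I_fun L m n us ls z \<theta> =
     1 / (2 * of_real pi * \<i>) *
     (\<integral>y. (let s = \<i> * of_real y in
            I_chi L m n us ls s * exp (- s * (of_real (ln (norm z)) + \<i> * of_real \<theta>)) * \<i>)
       \<partial>lborel)"

definition I_params :: "nat \<Rightarrow> nat \<Rightarrow> triple list \<Rightarrow> triple list \<Rightarrow> bool" where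
  "I_params m n us ls \<longleftrightarrow>
     m \<le> length ls \<and> n \<le> length us \<and>
     (\<forall>(a, A, \<alpha>)\<in>set us. A > 0 \<and> \<alpha> > 0) \<and>
     (\<forall>(b, B, \<beta>)\<in>set ls. B > 0 \<and> \<beta> > 0)"

definition I_separated :: "nat \<Rightarrow> nat \<Rightarrow> triple list \<Rightarrow> triple list \<Rightarrow> bool" where
  "I_separated m n us ls \<longleftrightarrow>
     (\<forall>(b, B, \<beta>)\<in>set (take m ls). \<forall>s. b + of_real B * s \<in> \<int>\<^sub>\<le>\<^sub>0 \<longrightarrow> Re s < 0) \<and>
     (\<forall>(a, A, \<alpha>)\<in>set (take n us). \<forall>s. 1 - a - of_real A * s \<in> \<int>\<^sub>\<le>\<^sub>0 \<longrightarrow> Re s > 0)"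

definition I_mu :: "triple list \<Rightarrow> triple list \<Rightarrow> real" where
  "I_mu us ls = (\<Sum>(b, B, \<beta>)\<leftarrow>ls. \<beta> * B) - (\<Sum>(a, A, \<alpha>)\<leftarrow>us. \<alpha> * A)"

definition I_Omega :: "triple list \<Rightarrow> triple list \<Rightarrow> real" where
  "I_Omega us ls =
     (\<Sum>(a, A, \<alpha>)\<leftarrow>us. (1/2 - Re a) * \<alpha>) - (\<Sum>(b, B, \<beta>)\<leftarrow>ls. (1/2 - Re b) * \<beta>)"

definition I_Delta :: "nat \<Rightarrow> nat \<Rightarrow> triple list \<Rightarrow> triple list \<Rightarrow> real" where
  "I_Delta m n us ls =
     (\<Sum>(b, B, \<beta>)\<leftarrow>take m ls. \<beta> * B) - (\<Sum>(b, B, \<beta>)\<leftarrow>drop m ls. \<beta> * B) +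
     (\<Sum>(a, A, \<alpha>)\<leftarrow>take n us. \<alpha> * A) - (\<Sum>(a, A, \<alpha>)\<leftarrow>drop n us. \<alpha> * A)"

definition I_abs_conv :: "nat \<Rightarrow> nat \<Rightarrow> triple list \<Rightarrow> triple list \<Rightarrow> real \<Rightarrow> bool" where
  "I_abs_conv m n us ls \<theta> \<longleftrightarrow>
     (let \<mu> = I_mu us ls; \<Omega> = I_Omega us ls; \<Delta> = I_Delta m n us ls; \<sigma> = 0 in
        (\<Delta> > 0 \<and> \<bar>\<theta>\<bar> < pi / 2 * \<Delta>) \<or>
        (\<Delta> \<ge> 0 \<and> \<bar>\<theta>\<bar> = pi / 2 * \<Delta> \<and>
           ((\<mu> = 0 \<and> \<Omega> < -1) \<or> (\<mu> \<noteq> 0 \<and> \<Omega> + \<sigma> * \<mu> < -1))))"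

definition F21 :: "complex \<Rightarrow> complex \<Rightarrow> complex \<Rightarrow> complex \<Rightarrow> complex" where
  "F21 a b c z = eval_fps (fps_hypergeo [a, b] [c] 1) z"

definition saigo_integrand ::
  "complex \<Rightarrow> complex \<Rightarrow> complex \<Rightarrow> (real \<Rightarrow> complex) \<Rightarrow> real \<Rightarrow> real \<Rightarrow> complex" where
  "saigo_integrand \<alpha> \<beta> \<gamma> f x t =
     of_real (t - x) powr (\<alpha> - 1) * of_real t powr (- \<alpha> - \<beta>) *
     F21 (\<alpha> + \<beta>) (- \<gamma>) \<alpha> (of_real (1 - x / t)) * f t"

text \<open>
  The integral is the Henstock-Kurzweil integral, which extends both the Lebesgue integral and the
  improper Riemann integral. Convergence at infinity may be conditional.
\<close>

definition saigo_right ::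
  "complex \<Rightarrow> complex \<Rightarrow> complex \<Rightarrow> (real \<Rightarrow> complex) \<Rightarrow> real \<Rightarrow> complex" where
  "saigo_right \<alpha> \<beta> \<gamma> f x =
     1 / Gamma \<alpha> * integral {x<..} (saigo_integrand \<alpha> \<beta> \<gamma> f x)"

definition nth_deriv :: "nat \<Rightarrow> (real \<Rightarrow> complex) \<Rightarrow> real \<Rightarrow> complex" where
  "nth_deriv k f = ((\<lambda>g t. vector_derivative g (at t)) ^^ k) f"

definition times_differentiable_pos :: "nat \<Rightarrow> (real \<Rightarrow> complex) \<Rightarrow> bool" where
  "times_differentiable_pos N f \<longleftrightarrow> (\<forall>k<N. \<forall>t>0. nth_deriv k f differentiable (at t))"

definition caputo_order :: "complex \<Rightarrow> nat" where
  "caputo_order \<alpha> = nat \<lfloor>Re \<alpha>\<rfloor> + 1"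

definition caputo_right ::
  "complex \<Rightarrow> complex \<Rightarrow> complex \<Rightarrow> (real \<Rightarrow> complex) \<Rightarrow> real \<Rightarrow> complex" where
  "caputo_right \<alpha> \<beta> \<gamma> f x =
     (let N = caputo_order \<alpha> in
        (-1) ^ N * saigo_right (- \<alpha> + of_nat N) (- \<beta> - of_nat N) (\<alpha> + \<gamma>) (nth_deriv N f) x)"

text \<open>
  As HOL functions are total, that \<open>caputo_right\<close> is well defined at x is a separate
  statement: f is in the domain of the operator and the integral converges.
\<close>

definition caputo_right_defined ::
  "complex \<Rightarrow> complex \<Rightarrow> complex \<Rightarrow> (real \<Rightarrow> complex) \<Rightarrow> real \<Rightarrow> bool" where
  "caputo_right_defined \<alpha> \<beta> \<gamma> f x \<longleftrightarrow>
     (let N = caputo_order \<alpha> in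
        times_differentiable_pos N f \<and>
        saigo_integrand (- \<alpha> + of_nat N) (- \<beta> - of_nat N) (\<alpha> + \<gamma>) (nth_deriv N f) x
          integrable_on {x<..})"

text \<open>The Caputo-type Erdelyi-Kober derivative, with the order of arguments of the paper.\<close>

definition caputo_EK :: "complex \<Rightarrow> complex \<Rightarrow> (real \<Rightarrow> complex) \<Rightarrow> real \<Rightarrow> complex" where
  "caputo_EK \<gamma> \<alpha> = caputo_right \<alpha> 0 \<gamma>"

definition caputo_EK_defined :: "complex \<Rightarrow> complex \<Rightarrow> (real \<Rightarrow> complex) \<Rightarrow> real \<Rightarrow> bool" where
  "caputo_EK_defined \<gamma> \<alpha> = caputo_right_defined \<alpha> 0 \<gamma>"

end

theory Submission
  imports Defs
begin

text \<open>
  On the contour \<open>s = \<i> y\<close> the function \<open>f\<close> is a superposition of powers,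
  \<open>f t = \<integral> W y * t powr (- d y) dy\<close> with \<open>d y = \<rho> - \<i> \<mu> y\<close>, where the weight \<open>W\<close> carries
  \<open>\<chi> s * a powr (- s)\<close>. The operator is linear, so the formula has two parts: its value on a single
  power, and the interchange of the operator with the integral over \<open>y\<close>.

  Single powers. Put \<open>c = N - \<alpha>\<close>. The \<open>N\<close>-th derivative of \<open>t powr (- d)\<close> is
  \<open>(-1)^N * pochhammer d N * t powr (- d - N)\<close>, and the substitution \<open>u = 1 - x / t\<close> turns the Saigo
  integral into the Euler integral of \<open>u powr (c - 1) * (1 - u) powr (d - 1) * 2F1(a, b; c; u)\<close>, with
  \<open>a = - \<alpha>\<close> and \<open>b = - \<alpha> - \<gamma>\<close>. This integral is a quotient of Gamma values (\<open>euler_integral\<close>): the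
  hypergeometric differential equation gives a first-order recurrence in \<open>d\<close>, and Laplace asymptotics
  as \<open>d\<close> tends to infinity fix the solution. What remains after cancellation is the new factor
  \<open>Gamma (N + d + \<alpha> + \<gamma>) / Gamma (N + d + \<gamma>)\<close>.

  Interchange. On the contour \<open>\<chi>\<close> is bounded by \<open>(1 + \<bar>y\<bar>) powr \<Omega> * exp (- \<pi> \<Delta> \<bar>y\<bar> / 2)\<close>
  (\<open>vertical_bound_I_chi\<close>), which rests on the sharp order of the Gamma function on vertical lines. If
  \<open>\<bar>\<theta>\<bar> < \<pi> \<Delta> / 2\<close>, then \<open>W\<close> decays exponentially and everything converges absolutely. If equality
  holds, only \<open>\<Omega> + Re \<alpha> < -1\<close> is known, from the convergence condition of the new I-function. Then
  \<open>W\<close> has integrable moments of order \<open>\<kappa>\<close> for some \<open>\<kappa> > Re \<alpha>\<close>, but perhaps not of order \<open>N\<close>. So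
  \<open>f\<close> has \<open>N - 1\<close> derivatives under the integral sign, while the \<open>N\<close>-th one is only known to exist;
  it may be unbounded near \<open>x\<close>, where the kernel is singular too, and not Lebesgue integrable.

  Both cases are treated at once by the Henstock-Kurzweil integral: it suffices to write down a
  primitive \<open>P\<close> of kernel times \<open>N\<close>-th derivative. The candidate integrates \<open>W\<close> against the
  incomplete Euler integrals. Its integrand gains almost a factor \<open>\<bar>y\<bar> powr (- Re c)\<close> from oscillation
  (\<open>incomplete_euler_bound\<close>), so that \<open>N - Re c = Re \<alpha>\<close> moments are nearly enough, and any
  \<open>\<kappa> > Re \<alpha>\<close> suffices. Its derivative cannot be taken under the integral sign, but
  that of \<open>P\<close> minus kernel times \<open>(N - 1)\<close>-st derivative can, and the product rule does the rest
  (\<open>has_integral_kernel\<close>).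
\<close>

section \<open>Calculus for integrals\<close>

lemma has_vector_derivative_iff_quotient:
  fixes f :: "real \<Rightarrow> 'b::real_normed_vector"
  shows "(f has_vector_derivative D) (at t0) \<longleftrightarrow>
    ((\<lambda>t. (f t - f t0) /\<^sub>R (t - t0)) \<longlongrightarrow> D) (at t0)"
proof -
  have "norm ((f t - f t0) /\<^sub>R (t - t0) - D) = norm (f t - f t0 - (t - t0) *\<^sub>R D) / norm (t - t0)"
    if "t \<noteq> t0" for t
  proof -
    have "(f t - f t0) /\<^sub>R (t - t0) - D = (f t - f t0 - (t - t0) *\<^sub>R D) /\<^sub>R (t - t0)"
      using that by (simp add: scaleR_diff_right)
    then show ?thesis by (simp add: divide_inverse mult.commute)
  qed
  then have "eventually (\<lambda>t. norm ((f t - f t0) /\<^sub>R (t - t0) - D) =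
      norm (f t - f t0 - (t - t0) *\<^sub>R D) / norm (t - t0)) (at t0)"
    by (auto simp: eventually_at_filter)
  then show ?thesis
    unfolding has_vector_derivative_def has_derivative_iff_norm
    by (subst (2) Lim_null, subst (2) tendsto_norm_zero_iff[symmetric])
       (auto intro: bounded_linear_scaleR_left dest: filterlim_cong[OF refl refl])
qed

text \<open>
  The bound on \<open>f'\<close> makes every \<open>f y\<close> Lipschitz with constant \<open>B y\<close>, so the difference quotients
  converge dominatedly.
\<close>

lemma has_vector_derivative_lebesgue_integral:
  fixes f f' :: "'a \<Rightarrow> real \<Rightarrow> complex"
  assumes t0: "l < t0" "t0 < u"
    and int: "\<And>t. l < t \<Longrightarrow> t < u \<Longrightarrow> integrable M (\<lambda>y. f y t)"
    and deriv: "\<And>y t. l < t \<Longrightarrow> t < u \<Longrightarrow> (f y has_vector_derivative f' y t) (at t)"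
    and meas: "(\<lambda>y. f' y t0) \<in> borel_measurable M"
    and B: "integrable M B"
    and bound: "\<And>y t. l < t \<Longrightarrow> t < u \<Longrightarrow> norm (f' y t) \<le> B y"
  shows "((\<lambda>t. \<integral>y. f y t \<partial>M) has_vector_derivative (\<integral>y. f' y t0 \<partial>M)) (at t0)"
proof -
  define q where "q t y = (f y t - f y t0) /\<^sub>R (t - t0)" for t y
  have lip: "norm (f y t - f y t0) \<le> B y * norm (t - t0)" if "l < t" "t < u" for y t
  proof (rule differentiable_bound[where S = "{l<..<u}" and f' = "\<lambda>t h. h *\<^sub>R f' y t"])
    fix s assume s: "s \<in> {l<..<u}"
    then show "(f y has_derivative (\<lambda>h. h *\<^sub>R f' y s)) (at s within {l<..<u})"
      using deriv[of s y] has_derivative_at_withinI unfolding has_vector_derivative_def by auto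
    show "onorm (\<lambda>h. h *\<^sub>R f' y s) \<le> B y"
      using s bound[of s y] by (intro onorm_le) (auto simp: mult.commute[of "\<bar>_\<bar>"] intro: mult_right_mono)
  qed (use that t0 in auto)
  have "((\<lambda>t. \<integral>y. q t y \<partial>M) \<longlongrightarrow> (\<integral>y. f' y t0 \<partial>M)) (at t0)"
  proof (subst tendsto_at_iff_sequentially, intro allI impI)
    fix X :: "nat \<Rightarrow> real"
    assume X0: "\<forall>i. X i \<in> UNIV - {t0}" and X: "X \<longlonglongrightarrow> t0"
    have "eventually (\<lambda>i. X i \<in> {l<..<u}) sequentially"
      using X t0 by (intro topological_tendstoD) auto
    then obtain k where k: "\<And>i. i \<ge> k \<Longrightarrow> l < X i \<and> X i < u"
      by (auto simp: eventually_sequentially)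
    have "(\<lambda>i. \<integral>y. q (X (i + k)) y \<partial>M) \<longlonglongrightarrow> (\<integral>y. f' y t0 \<partial>M)"
    proof (rule integral_dominated_convergence[where w = B])
      show "(\<lambda>y. q (X (i + k)) y) \<in> borel_measurable M" for i
        using int[of "X (i + k)"] int[OF t0] k[of "i + k"] unfolding q_def
        by (intro borel_measurable_scaleR borel_measurable_diff) auto
      show "AE y in M. (\<lambda>i. q (X (i + k)) y) \<longlonglongrightarrow> f' y t0"
      proof (rule AE_I2)
        fix y
        have "((\<lambda>t. q t y) \<longlongrightarrow> f' y t0) (at t0)"
          using deriv[OF t0, of y] unfolding q_def by (simp add: has_vector_derivative_iff_quotient)
        then have "(\<lambda>i. q (X i) y) \<longlonglongrightarrow> f' y t0"
          using X X0 unfolding tendsto_at_iff_sequentially comp_def by auto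
        then show "(\<lambda>i. q (X (i + k)) y) \<longlonglongrightarrow> f' y t0" by (rule LIMSEQ_ignore_initial_segment)
      qed
      show "AE y in M. norm (q (X (i + k)) y) \<le> B y" for i
      proof (rule AE_I2)
        fix y
        have "X (i + k) - t0 \<noteq> 0" using X0 by auto
        then show "norm (q (X (i + k)) y) \<le> B y"
          using lip[of "X (i + k)" y] k[of "i + k"]
          by (simp only: q_def norm_scaleR norm_inverse) (simp add: field_simps)
      qed
    qed (use B meas in auto)
    then show "((\<lambda>t. \<integral>y. q t y \<partial>M) \<circ> X) \<longlonglongrightarrow> (\<integral>y. f' y t0 \<partial>M)"
      unfolding comp_def by (rule LIMSEQ_offset)
  qed
  moreover have "eventually (\<lambda>t. (\<integral>y. q t y \<partial>M) = ((\<integral>y. f y t \<partial>M) - (\<integral>y. f y t0 \<partial>M)) /\<^sub>R (t - t0)) (at t0)"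
  proof -
    have "eventually (\<lambda>t. t \<in> {l<..<u}) (at t0)"
      using t0 by (intro eventually_at_in_open') auto
    then show ?thesis
    proof eventually_elim
      case (elim t)
      then show ?case using int[OF t0] int[of t] unfolding q_def by simp
    qed
  qed
  ultimately have "((\<lambda>t. ((\<integral>y. f y t \<partial>M) - (\<integral>y. f y t0 \<partial>M)) /\<^sub>R (t - t0)) \<longlongrightarrow> (\<integral>y. f' y t0 \<partial>M)) (at t0)"
    by (rule Lim_transform_eventually)
  then show ?thesis by (simp add: has_vector_derivative_iff_quotient)
qed

text \<open>
  Here \<open>g\<close> may be any derivative, even one that oscillates too wildly for the Lebesgue integral.
  Continuing \<open>P\<close> by 0 to the left of \<open>x\<close> gives a primitive that is continuous up to the end point.
\<close>

lemma has_integral_greaterThan_FTC: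
  fixes P g :: "real \<Rightarrow> complex"
  assumes deriv: "\<And>t. t > x \<Longrightarrow> (P has_vector_derivative g t) (at t)"
    and lim0: "(P \<longlongrightarrow> 0) (at_right x)"
    and lim: "(P \<longlongrightarrow> l) at_top"
  shows "(g has_integral l) {x<..}"
proof -
  define P0 where "P0 t = (if t \<le> x then 0 else P t)" for t
  have deriv0: "(P0 has_vector_derivative g t) (at t)" if "t > x" for t
    by (rule has_vector_derivative_transform_within_open[OF deriv[OF that], of "{x<..}"])
       (use that in \<open>auto simp: P0_def\<close>)
  have cont: "continuous_on {x..T} P0" for T
  proof (rule continuous_at_imp_continuous_on, rule ballI)
    fix t assume "t \<in> {x..T}"
    show "isCont P0 t"
    proof (cases "t = x")
      case False
      then show ?thesis using deriv0[of t] \<open>t \<in> _\<close> by (intro has_vector_derivative_continuous) auto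
    next
      case True
      have "(P0 \<longlongrightarrow> 0) (at_right x)"
        using lim0 by (rule Lim_transform_eventually) (auto simp: eventually_at_filter P0_def)
      moreover have "(P0 \<longlongrightarrow> 0) (at_left x)"
        by (rule tendsto_eventually) (auto simp: eventually_at_filter P0_def)
      ultimately show ?thesis
        using True unfolding isCont_def filterlim_at_split by (simp add: P0_def)
    qed
  qed
  have int: "((\<lambda>s. if s \<in> {x<..} then g s else 0) has_integral (if x \<le> T then P0 T else 0)) (cbox A T)"
    if "A \<le> x" for A T
  proof (cases "x \<le> T")
    case True
    have "(g has_integral P0 T - P0 x) {x..T}"
      using True cont deriv0 by (intro fundamental_theorem_of_calculus_interior) auto
    then have "(g has_integral P0 T) {x..T}" by (simp add: P0_def)
    then have "((\<lambda>s. if s \<in> {x<..} then g s else 0) has_integral P0 T) {x..T}"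
      by (rule has_integral_spike_finite[where S = "{x}", rotated 2]) auto
    then have "((\<lambda>s. if s \<in> {x..T} then (if s \<in> {x<..} then g s else 0) else 0) has_integral P0 T) {A..T}"
      using True that by (subst has_integral_restrict) auto
    then show ?thesis using True
      by (auto elim!: has_integral_eq[rotated])
  next
    case False
    show ?thesis using False
      by (auto intro!: has_integral_is_0)
  qed
  show ?thesis
  proof (subst has_integral_alt', intro conjI allI impI)
    fix A T :: real
    have "(\<lambda>s. if s \<in> {x<..} then g s else 0) integrable_on cbox (min A x) T"
      using int[of "min A x" T] by auto
    then show "(\<lambda>s. if s \<in> {x<..} then g s else 0) integrable_on cbox A T"
      by (rule integrable_on_subcbox) auto
  next
    fix e :: real assume e: "e > 0"
    obtain R where R: "\<And>T. T \<ge> R \<Longrightarrow> norm (P T - l) < e"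
      using lim e unfolding tendsto_iff eventually_at_top_linorder dist_norm by blast
    show "\<exists>B>0. \<forall>a b. ball 0 B \<subseteq> cbox a b \<longrightarrow>
        norm (integral (cbox a b) (\<lambda>s. if s \<in> {x<..} then g s else 0) - l) < e"
    proof (intro exI[of _ "max 1 (max (\<bar>R\<bar> + 1) (\<bar>x\<bar> + 1))"] conjI allI impI)
      fix a b :: real
      let ?B = "max 1 (max (\<bar>R\<bar> + 1) (\<bar>x\<bar> + 1))"
      assume sub: "ball 0 ?B \<subseteq> cbox a b"
      have "{- ?B <..< ?B} \<subseteq> {a..b}"
        using sub by (auto simp: subset_iff dist_real_def abs_less_iff)
      then have "a \<le> - ?B" "?B \<le> b"
        by (subst (asm) greaterThanLessThan_subseteq_atLeastAtMost_iff; simp)+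
      then have "a \<le> x" "x < b" "R \<le> b" by auto
      then have "integral (cbox a b) (\<lambda>s. if s \<in> {x<..} then g s else 0) = P b"
        using int[of a b] by (intro integral_unique) (simp add: P0_def)
      then show "norm (integral (cbox a b) (\<lambda>s. if s \<in> {x<..} then g s else 0) - l) < e"
        using R[OF \<open>R \<le> b\<close>] by simp
    qed auto
  qed
qed

lemma set_lebesgue_integral_FTC_open:
  fixes P p :: "real \<Rightarrow> complex"
  assumes "a < b"
    and "\<And>u. a < u \<Longrightarrow> u < b \<Longrightarrow> (P has_vector_derivative p u) (at u)"
    and "continuous_on {a<..<b} p"
    and "set_integrable lborel {a<..<b} p"
    and "(P \<longlongrightarrow> A) (at_right a)" "(P \<longlongrightarrow> B) (at_left b)"
  shows "(LBINT u:{a<..<b}. p u) = B - A"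
proof -
  have "(LBINT u=ereal a..ereal b. p u) = B - A"
  proof (rule interval_integral_FTC_integrable)
    show "((P \<circ> real_of_ereal) \<longlongrightarrow> A) (at_right (ereal a))"
      "((P \<circ> real_of_ereal) \<longlongrightarrow> B) (at_left (ereal b))"
      using assms by (simp_all add: ereal_tendsto_simps)
    show "isCont p u" if "ereal a < ereal u" "ereal u < ereal b" for u
      using assms(3) that by (auto simp: continuous_on_eq_continuous_at)
  qed (use assms in \<open>auto simp: einterval_eq\<close>)
  then show ?thesis using assms(1) by (simp add: interval_lebesgue_integral_def einterval_eq)
qed

lemma norm_of_real_powr: "u \<ge> 0 \<Longrightarrow> norm (complex_of_real u powr z) = u powr Re z"
  by (simp add: norm_powr_real_powr)

lemma has_vector_derivative_of_real_powr:
  assumes "u > 0"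
  shows "((\<lambda>u. complex_of_real u powr z) has_vector_derivative z * of_real u powr (z - 1)) (at u)"
  using assms by (intro has_vector_derivative_real_field) (auto intro!: derivative_eq_intros simp: powr_diff)

lemma has_vector_derivative_one_minus_powr:
  assumes "u < 1"
  shows "((\<lambda>u. complex_of_real (1 - u) powr z) has_vector_derivative - (z * of_real (1 - u) powr (z - 1))) (at u)"
proof -
  have "((\<lambda>u. complex_of_real u powr z) \<circ> (\<lambda>u. 1 - u) has_vector_derivative (-1) *\<^sub>R (z * of_real (1 - u) powr (z - 1))) (at u)"
    using assms by (intro vector_diff_chain_at has_vector_derivative_of_real_powr)
      (auto intro!: derivative_eq_intros simp flip: has_real_derivative_iff_has_vector_derivative)
  then show ?thesis by (simp add: comp_def)
qed

lemma set_integral_norm_le: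
  fixes f :: "real \<Rightarrow> complex" and w :: "real \<Rightarrow> real"
  assumes "set_integrable lborel S f" "set_integrable lborel T w" "S \<subseteq> T" "M \<ge> 0"
    and "\<And>u. u \<in> T \<Longrightarrow> w u \<ge> 0" "\<And>u. u \<in> S \<Longrightarrow> norm (f u) \<le> M * w u"
  shows "norm (LBINT u:S. f u) \<le> M * (LBINT u:T. w u)"
proof -
  have "norm (LBINT u:S. f u) \<le> (LBINT u:T. M * w u)"
    unfolding set_lebesgue_integral_def
  proof (rule Bochner_Integration.integral_norm_bound_integral)
    show "integrable lborel (\<lambda>u. indicator T u *\<^sub>R (M * w u))"
      using set_integrable_mult_right[OF assms(2), of M] by (simp add: set_integrable_def)
  qed (use assms in \<open>auto simp: set_integrable_def indicator_def\<close>)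
  then show ?thesis by simp
qed

section \<open>The Gauss hypergeometric function on the unit interval\<close>

text \<open>
  The parameter \<open>\<eta>\<close> is an exponent for the growth of the series at 1: it is at least the exact
  exponent \<open>Re (a + b - c)\<close>, and positive, so that the logarithmic and the bounded case are covered by
  the same power \<open>(1 - u) powr (- \<eta>)\<close>.
\<close>

locale gauss_hypergeometric =
  fixes a b c :: complex and \<eta> :: real
  assumes c_pos: "Re c > 0" and \<eta>_pos: "\<eta> > 0" and \<eta>_ge: "Re (a + b - c) \<le> \<eta>"
begin

definition series :: "complex fps" where "series = fps_hypergeo [a, b] [c] 1"

definition F :: "real \<Rightarrow> complex" where "F u = eval_fps series (of_real u)"
definition F' :: "real \<Rightarrow> complex" where "F' u = eval_fps (fps_deriv series) (of_real u)"
definition F'' :: "real \<Rightarrow> complex" where "F'' u = eval_fps (fps_deriv (fps_deriv series)) (of_real u)"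

lemma F_eq_F21: "F u = F21 a b c (of_real u)"
  by (simp add: F_def series_def F21_def)

lemma c_nonpole: "c \<notin> \<int>\<^sub>\<le>\<^sub>0"
  using c_pos by (auto elim!: nonpos_Ints_cases)

lemma coeff: "fps_nth series n = pochhammer a n * pochhammer b n / (pochhammer c n * fact n)"
  by (simp add: series_def)

lemma coeff_Suc:
  "of_nat (Suc n) * (c + of_nat n) * fps_nth series (Suc n) =
     (a + of_nat n) * (b + of_nat n) * fps_nth series n"
proof -
  have "c + of_nat n \<noteq> 0" using c_pos by (auto simp: complex_eq_iff)
  moreover have "pochhammer c n \<noteq> 0"
    using c_nonpole by (auto simp: pochhammer_eq_0_iff)
  ultimately show ?thesis
    by (simp add: coeff pochhammer_Suc divide_simps del: of_nat_Suc)
qed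

text \<open>
  Both sides behave like powers of \<open>n\<close>, by the limit formula for the reciprocal Gamma function. The
  right-hand side consists of the coefficients of \<open>(1 - u) powr (- \<eta>)\<close>, so the estimate transfers to
  the function and its derivative by summation.
\<close>

lemma coeff_bound:
  obtains K where "K > 0" "\<And>n. norm (fps_nth series n) \<le> K * (pochhammer \<eta> n / fact n)"
proof -
  define r where "r z n = norm (rGamma_series z n)" for z :: complex and n
  \<comment> \<open>the exponent of \<open>n\<close> in the quotient of the two sides; it is not positive\<close>
  define p where "p = Re (a + b - c) - \<eta>"
  have p: "p \<le> 0" using \<eta>_ge by (simp add: p_def)
  have "\<eta> \<notin> \<int>\<^sub>\<le>\<^sub>0" using \<eta>_pos by (auto elim!: nonpos_Ints_cases)
  then have "(\<lambda>n. r a n * r b n / (r c n * rGamma_series \<eta> n)) \<longlonglongrightarrow>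
      norm (rGamma a) * norm (rGamma b) / (norm (rGamma c) * rGamma \<eta>)"
    unfolding r_def using c_nonpole by (intro tendsto_intros) (auto simp: rGamma_eq_zero_iff)
  then have "Bseq (\<lambda>n. r a n * r b n / (r c n * rGamma_series \<eta> n))"
    by (intro convergent_imp_Bseq convergentI)
  then obtain K where K: "K > 0" "\<And>n. norm (r a n * r b n / (r c n * rGamma_series \<eta> n)) \<le> K"
    unfolding Bseq_def by blast
  have r_eq: "r z n = norm (pochhammer z (n + 1)) / (fact n * real n powr Re z)" if "n > 0" for z n
    using that by (simp add: r_def rGamma_series_def norm_mult norm_divide powr_def)
  have bound: "norm (fps_nth series (Suc n)) \<le> K * (pochhammer \<eta> (Suc n) / fact (Suc n))" if n: "n > 0" for n
  proof -
    have pos: "pochhammer \<eta> (Suc n) > 0" using \<eta>_pos by (rule pochhammer_pos)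
    have alg: "(A / (f * x1)) * (B / (f * x2)) / ((C / (f * x3)) * (E / (f * x4))) =
        A * B / (C * g) * (g / E) / (x1 * x2 / (x3 * x4))"
      if "f \<noteq> 0" "g \<noteq> 0" "x1 \<noteq> 0" "x2 \<noteq> 0" "x3 \<noteq> 0" "x4 \<noteq> 0" "C \<noteq> 0" "E \<noteq> 0"
      for A B C E f g x1 x2 x3 x4 :: real
      using that by (simp add: divide_simps)
    have \<eta>_eq: "rGamma_series \<eta> n = pochhammer \<eta> (n + 1) / (fact n * real n powr \<eta>)"
      using n by (simp add: rGamma_series_def powr_def mult.commute)
    have C0: "pochhammer c (n + 1) \<noteq> 0"
      using c_nonpole by (auto simp: pochhammer_eq_0_iff)
    have E0: "pochhammer \<eta> (n + 1) > 0" using \<eta>_pos by (rule pochhammer_pos)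
    have "norm (fps_nth series (n + 1)) * (fact (n + 1) / pochhammer \<eta> (n + 1)) / real n powr p =
        r a n * r b n / (r c n * rGamma_series \<eta> n)"
      using n C0 E0 unfolding r_eq[OF n] \<eta>_eq
      by (subst alg[where g = "fact (n + 1)"])
         (simp_all add: coeff norm_mult norm_divide p_def powr_add powr_diff del: pochhammer_Suc fact_Suc)
    also have "\<dots> \<le> K" using K(2)[of n] by (simp only: real_norm_def abs_le_iff)
    also have "K \<le> K / real n powr p"
    proof -
      have "real n powr p \<le> 1" using n p powr_mono[of p 0 "real n"] by simp
      then show ?thesis using n K(1) by (simp add: pos_le_divide_eq)
    qed
    finally have "norm (fps_nth series (n + 1)) * (fact (n + 1) / pochhammer \<eta> (n + 1)) \<le> K"
      using n by (simp only: divide_le_cancel) simp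
    then have "norm (fps_nth series (n + 1)) * (fact (n + 1) / pochhammer \<eta> (n + 1)) * (pochhammer \<eta> (n + 1) / fact (n + 1))
        \<le> K * (pochhammer \<eta> (n + 1) / fact (n + 1))"
      using E0 by (intro mult_right_mono) auto
    also have "norm (fps_nth series (n + 1)) * (fact (n + 1) / pochhammer \<eta> (n + 1)) * (pochhammer \<eta> (n + 1) / fact (n + 1))
        = norm (fps_nth series (n + 1))"
      using E0 by (simp del: pochhammer_Suc fact_Suc)
    finally show ?thesis by simp
  qed
  \<comment> \<open>the limit formula says nothing about the coefficients of index 0 and 1\<close>
  define K' where "K' = K + 1 + norm (a * b / c) / \<eta>"
  have "norm (fps_nth series n) \<le> K' * (pochhammer \<eta> n / fact n)" for n
  proof -
    have "n = 0 \<or> n = 1 \<or> (\<exists>m>0. n = Suc m)" by (cases n) auto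
    then consider "n = 0" | "n = 1" | m where "m > 0" "n = Suc m" by auto
    then show ?thesis
    proof cases
      case 1
      then show ?thesis using K(1) \<eta>_pos by (simp add: coeff K'_def)
    next
      case 2
      have "norm (fps_nth series n) = norm (a * b / c) / \<eta> * \<eta>"
        using 2 \<eta>_pos by (simp add: coeff)
      also have "\<dots> \<le> K' * \<eta>"
        using K(1) \<eta>_pos by (intro mult_right_mono) (auto simp: K'_def)
      finally show ?thesis using 2 by simp
    next
      case 3
      have "K * (pochhammer \<eta> n / fact n) \<le> K' * (pochhammer \<eta> n / fact n)"
        using \<eta>_pos by (intro mult_right_mono) (auto simp: K'_def pochhammer_nonneg)
      then show ?thesis using bound[OF 3(1)] 3(2) by simp
    qed
  qed
  moreover have "K' > 0" using K(1) \<eta>_pos by (simp add: K'_def add_pos_nonneg)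
  ultimately show thesis using that by blast
qed

lemma binomial_sums:
  assumes "0 \<le> u" "u < (1::real)"
  shows "(\<lambda>n. pochhammer t n / fact n * u ^ n) sums (1 - u) powr (- t)"
proof -
  have "(\<lambda>n. ((- t) gchoose n) * (- u) ^ n) sums (1 + - u) powr (- t)"
    using assms by (intro gen_binomial_real) auto
  moreover have "((- t) gchoose n) * (- u) ^ n = pochhammer t n / fact n * u ^ n" for n
  proof -
    have "(-1) ^ n * (-1) ^ n = (1 :: real)" by (simp flip: power_mult_distrib)
    then show ?thesis using power_minus[of u n] by (simp add: gbinomial_pochhammer)
  qed
  ultimately show ?thesis by simp
qed

lemma conv_radius_ge: "fps_conv_radius series \<ge> 1"
proof -
  obtain K where K: "K > 0" "\<And>n. norm (fps_nth series n) \<le> K * (pochhammer \<eta> n / fact n)"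
    using coeff_bound by blast
  show ?thesis unfolding fps_conv_radius_def
  proof (rule conv_radius_geI_ex)
    fix r :: real assume r: "0 < r" "ereal r < 1"
    have "summable (\<lambda>n. fps_nth series n * of_real r ^ n)"
    proof (rule summable_comparison_test')
      show "summable (\<lambda>n. K * (pochhammer \<eta> n / fact n * r ^ n))"
        using binomial_sums[of r \<eta>] r by (intro summable_mult) (auto simp: sums_iff)
      show "norm (fps_nth series n * of_real r ^ n) \<le> K * (pochhammer \<eta> n / fact n * r ^ n)" for n
        using mult_right_mono[OF K(2)[of n], of "r ^ n"] r by (simp add: norm_mult norm_power mult_ac)
    qed
    then show "\<exists>z. norm z = r \<and> summable (\<lambda>n. fps_nth series n * z ^ n)"
      using r by (intro exI[of _ "of_real r"]) auto
  qed
qed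

lemma in_disc:
  assumes "0 \<le> u" "u < (1::real)"
  shows "ereal (norm (complex_of_real u)) < fps_conv_radius series"
    "ereal (norm (complex_of_real u)) < fps_conv_radius (fps_deriv series)"
    "ereal (norm (complex_of_real u)) < fps_conv_radius (fps_deriv (fps_deriv series))"
proof -
  have u: "ereal (norm (complex_of_real u)) < 1" using assms by simp
  have 1: "1 \<le> fps_conv_radius (fps_deriv series)"
    using conv_radius_ge fps_conv_radius_deriv by (rule order_trans)
  have 2: "1 \<le> fps_conv_radius (fps_deriv (fps_deriv series))"
    using 1 fps_conv_radius_deriv by (rule order_trans)
  show "ereal (norm (complex_of_real u)) < fps_conv_radius series"
    using u conv_radius_ge by (rule less_le_trans)
  show "ereal (norm (complex_of_real u)) < fps_conv_radius (fps_deriv series)"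
    using u 1 by (rule less_le_trans)
  show "ereal (norm (complex_of_real u)) < fps_conv_radius (fps_deriv (fps_deriv series))"
    using u 2 by (rule less_le_trans)
qed

lemma F_bounds:
  obtains K where "K > 0"
    "\<And>u. 0 \<le> u \<Longrightarrow> u < 1 \<Longrightarrow> norm (F u) \<le> K * (1 - u) powr (- \<eta>)"
    "\<And>u. 0 \<le> u \<Longrightarrow> u < 1 \<Longrightarrow> norm (F' u) \<le> K * (1 - u) powr (- \<eta> - 1)"
proof -
  obtain K where K: "K > 0" "\<And>n. norm (fps_nth series n) \<le> K * (pochhammer \<eta> n / fact n)"
    using coeff_bound by blast
  have b0: "norm (F u) \<le> K * (1 - u) powr (- \<eta>)" if u: "0 \<le> u" "u < 1" for u
  proof -
    have s: "(\<lambda>n. K * (pochhammer \<eta> n / fact n * u ^ n)) sums (K * (1 - u) powr (- \<eta>))"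
      by (intro sums_mult binomial_sums u)
    have "norm (\<Sum>n. fps_nth series n * of_real u ^ n) \<le> (\<Sum>n. K * (pochhammer \<eta> n / fact n * u ^ n))"
    proof (rule norm_suminf_le)
      show "norm (fps_nth series n * of_real u ^ n) \<le> K * (pochhammer \<eta> n / fact n * u ^ n)" for n
        using mult_right_mono[OF K(2)[of n], of "u ^ n"] u by (simp add: norm_mult norm_power mult_ac)
    qed (use s sums_iff in auto)
    then show ?thesis using s by (simp add: F_def eval_fps_def sums_iff)
  qed
  have b1: "norm (F' u) \<le> K * \<eta> * (1 - u) powr (- \<eta> - 1)" if u: "0 \<le> u" "u < 1" for u
  proof -
    have s: "(\<lambda>n. K * \<eta> * (pochhammer (\<eta> + 1) n / fact n * u ^ n)) sums (K * \<eta> * (1 - u) powr (- (\<eta> + 1)))"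
      by (intro sums_mult binomial_sums u)
    have "norm (\<Sum>n. fps_nth (fps_deriv series) n * of_real u ^ n) \<le>
        (\<Sum>n. K * \<eta> * (pochhammer (\<eta> + 1) n / fact n * u ^ n))"
    proof (rule norm_suminf_le)
      fix n
      have "norm (fps_nth (fps_deriv series) n) = real (Suc n) * norm (fps_nth series (Suc n))"
        by (simp add: norm_mult del: of_nat_Suc)
      also have "\<dots> \<le> real (Suc n) * (K * (pochhammer \<eta> (Suc n) / fact (Suc n)))"
        by (intro mult_left_mono K) auto
      also have "\<dots> = K * \<eta> * (pochhammer (\<eta> + 1) n / fact n)"
        by (simp add: pochhammer_rec divide_simps del: of_nat_Suc)
      finally have le: "norm (fps_nth (fps_deriv series) n) \<le> K * \<eta> * (pochhammer (\<eta> + 1) n / fact n)" .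
      have "norm (fps_nth (fps_deriv series) n * of_real u ^ n) = norm (fps_nth (fps_deriv series) n) * u ^ n"
        using u by (simp add: norm_mult norm_power del: fps_deriv_nth)
      also have "\<dots> \<le> K * \<eta> * (pochhammer (\<eta> + 1) n / fact n) * u ^ n"
        using u by (intro mult_right_mono le) auto
      finally show "norm (fps_nth (fps_deriv series) n * of_real u ^ n) \<le>
          K * \<eta> * (pochhammer (\<eta> + 1) n / fact n * u ^ n)" by (simp only: mult.assoc)
    qed (use s sums_iff in auto)
    also have "\<dots> = K * \<eta> * (1 - u) powr (- (\<eta> + 1))" using s by (simp only: sums_iff)
    also have "- (\<eta> + 1) = - \<eta> - 1" by simp
    finally show ?thesis by (simp only: F'_def eval_fps_def)
  qed
  show thesis
  proof (rule that[of "K + K * \<eta>"])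
    show "K + K * \<eta> > 0" using K(1) \<eta>_pos by (simp add: add_pos_pos)
    fix u :: real assume u: "0 \<le> u" "u < 1"
    show "norm (F u) \<le> (K + K * \<eta>) * (1 - u) powr (- \<eta>)"
      by (rule order_trans[OF b0[OF u]]) (use K(1) \<eta>_pos in \<open>auto intro!: mult_right_mono\<close>)
    show "norm (F' u) \<le> (K + K * \<eta>) * (1 - u) powr (- \<eta> - 1)"
      by (rule order_trans[OF b1[OF u]]) (use K(1) \<eta>_pos in \<open>auto intro!: mult_right_mono\<close>)
  qed
qed

lemma F_0: "F 0 = 1"
  by (simp add: F_def eval_fps_at_0 coeff)

lemma has_vector_derivative_F:
  assumes "0 \<le> u" "u < 1"
  shows "(F has_vector_derivative F' u) (at u)"
    "(F' has_vector_derivative F'' u) (at u)"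
proof -
  show "(F has_vector_derivative F' u) (at u)"
    using has_vector_derivative_real_field[OF has_field_derivative_eval_fps[OF in_disc(1)[OF assms]]]
    by (simp add: F_def[abs_def] F'_def)
  show "(F' has_vector_derivative F'' u) (at u)"
    using has_vector_derivative_real_field[OF has_field_derivative_eval_fps[OF in_disc(2)[OF assms]]]
    by (simp add: F'_def[abs_def] F''_def)
qed

text \<open>
  As an identity of formal power series this is the two-term recurrence \<open>coeff_Suc\<close>.
\<close>

lemma hypergeometric_ode:
  assumes u: "0 \<le> u" "u < 1"
  shows "of_real (u * (1 - u)) * F'' u + (c - (a + b + 1) * of_real u) * F' u - a * b * F u = 0"
proof -
  let ?S = series
  let ?S' = "fps_deriv series"
  let ?S'' = "fps_deriv (fps_deriv series)"
  let ?z = "complex_of_real u"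
  have ode: "fps_X * ?S'' - fps_X * (fps_X * ?S'') + fps_const c * ?S'
      - fps_const (a + b + 1) * (fps_X * ?S') - fps_const (a * b) * ?S = 0"
    (is "?E = 0")
  proof (rule fps_ext)
    fix n
    have "fps_nth ?E n = of_nat (Suc n) * (c + of_nat n) * fps_nth series (Suc n)
        - (a + of_nat n) * (b + of_nat n) * fps_nth series n"
    proof (cases n)
      case 0
      then show ?thesis by simp
    next
      case (Suc m)
      then show ?thesis by (cases m) (simp_all add: algebra_simps)
    qed
    then show "fps_nth ?E n = fps_nth 0 n" using coeff_Suc[of n] by simp
  qed
  define in_D where "in_D f \<longleftrightarrow> ereal (norm ?z) < fps_conv_radius f" for f :: "complex fps"
  have D: "in_D (fps_const k)" "in_D fps_X" "in_D series" "in_D (fps_deriv series)" "in_D (fps_deriv (fps_deriv series))" for k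
    using in_disc[OF u] by (simp_all add: in_D_def)
  have D_mult: "in_D (f * g)" and D_add: "in_D (f + g)" and D_diff: "in_D (f - g)" if "in_D f" "in_D g" for f g
    using that less_le_trans[OF _ fps_conv_radius_mult[of f g]] less_le_trans[OF _ fps_conv_radius_add[of f g]]
      less_le_trans[OF _ fps_conv_radius_diff[of f g]] by (simp_all add: in_D_def)
  have ev: "eval_fps (f * g) ?z = eval_fps f ?z * eval_fps g ?z" "eval_fps (f + g) ?z = eval_fps f ?z + eval_fps g ?z"
    "eval_fps (f - g) ?z = eval_fps f ?z - eval_fps g ?z" if "in_D f" "in_D g" for f g
    using that eval_fps_mult[of ?z f g] eval_fps_add[of ?z f g] eval_fps_diff[of ?z f g] by (simp_all add: in_D_def)
  have "eval_fps ?E ?z = ?z * F'' u - ?z * (?z * F'' u) + c * F' u - (a + b + 1) * (?z * F' u) - a * b * F u"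
    unfolding F_def F'_def F''_def
    by (simp only: ev D D_mult D_add D_diff eval_fps_const eval_fps_X)
  then show ?thesis unfolding ode by (simp add: algebra_simps)
qed

end

section \<open>Euler integrals of the hypergeometric function\<close>

context gauss_hypergeometric
begin

text \<open>
  The image of the Saigo kernel times a power under \<open>u = 1 - x / t\<close>.
\<close>

definition kern :: "complex \<Rightarrow> real \<Rightarrow> complex" where
  "kern d u = of_real u powr (c - 1) * of_real (1 - u) powr (d - 1) * F u"

definition incomplete_euler :: "complex \<Rightarrow> real \<Rightarrow> complex" where
  "incomplete_euler d v = (LBINT u:{0<..<v}. kern d u)"

lemma continuous_on_F: "continuous_on {0<..<1} F" "continuous_on {0<..<1} F'"
  using has_vector_derivative_continuous[OF has_vector_derivative_F(1)]
    has_vector_derivative_continuous[OF has_vector_derivative_F(2)]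
  by (auto intro!: continuous_at_imp_continuous_on)

lemma continuous_on_kern: "continuous_on {0<..<1} (kern d)"
  unfolding kern_def by (intro continuous_intros continuous_on_F) auto

lemma norm_kern_le:
  obtains K where "K > 0"
    "\<And>d u. 0 < u \<Longrightarrow> u < 1 \<Longrightarrow> norm (kern d u) \<le> K * (u powr (Re c - 1) * (1 - u) powr (Re d - \<eta> - 1))"
proof -
  obtain K where K: "K > 0" "\<And>u. 0 \<le> u \<Longrightarrow> u < 1 \<Longrightarrow> norm (F u) \<le> K * (1 - u) powr (- \<eta>)"
    using F_bounds by metis
  show thesis
  proof (rule that[OF K(1)])
    fix d :: complex and u :: real assume u: "0 < u" "u < 1"
    have "norm (kern d u) = u powr (Re c - 1) * (1 - u) powr (Re d - 1) * norm (F u)"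
      using u by (simp only: kern_def norm_mult norm_of_real_powr) (simp add: norm_of_real_powr)
    also have "\<dots> \<le> u powr (Re c - 1) * (1 - u) powr (Re d - 1) * (K * (1 - u) powr (- \<eta>))"
      using u by (intro mult_left_mono K) auto
    also have "\<dots> = K * (u powr (Re c - 1) * ((1 - u) powr (Re d - 1) * (1 - u) powr (- \<eta>)))" by simp
    also have "\<dots> = K * (u powr (Re c - 1) * (1 - u) powr (Re d - \<eta> - 1))"
      by (simp flip: powr_add add: algebra_simps)
    finally show "norm (kern d u) \<le> K * (u powr (Re c - 1) * (1 - u) powr (Re d - \<eta> - 1))" .
  qed
qed

lemma set_integrable_Beta:
  assumes "p > 0" "q > (0::real)"
  shows "set_integrable lborel {0<..<1} (\<lambda>u. u powr (p - 1) * (1 - u) powr (q - 1))"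
  by (rule set_integrable_subset[OF integrable_Beta[OF assms]]) auto

lemma set_integrable_kern:
  assumes "Re d > \<eta>"
  shows "set_integrable lborel {0<..<1} (kern d)"
proof -
  obtain K where K: "K > 0"
    "\<And>d u. 0 < u \<Longrightarrow> u < 1 \<Longrightarrow> norm (kern d u) \<le> K * (u powr (Re c - 1) * (1 - u) powr (Re d - \<eta> - 1))"
    using norm_kern_le by blast
  show ?thesis
  proof (rule set_integrable_bound)
    show "set_integrable lborel {0<..<1} (\<lambda>u. K * (u powr (Re c - 1) * (1 - u) powr (Re d - \<eta> - 1)))"
      using c_pos assms by (intro set_integrable_mult_right set_integrable_Beta) auto
    show "set_borel_measurable lborel {0<..<1} (kern d)"
      unfolding set_borel_measurable_def
      using borel_measurable_continuous_on_indicator[OF _ continuous_on_kern] by simp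
    show "AE u in lborel. u \<in> {0<..<1} \<longrightarrow>
        norm (kern d u) \<le> norm (K * (u powr (Re c - 1) * (1 - u) powr (Re d - \<eta> - 1)))"
      using K by (intro AE_I2) (auto simp: abs_mult)
  qed
qed

lemma
  assumes d: "Re d > \<eta>"
  shows incomplete_euler_continuous: "continuous_on {0..1} (incomplete_euler d)"
    and incomplete_euler_0: "incomplete_euler d 0 = 0"
    and incomplete_euler_deriv: "\<And>v. 0 < v \<Longrightarrow> v < 1 \<Longrightarrow> (incomplete_euler d has_vector_derivative kern d v) (at v)"
proof -
  have eq: "incomplete_euler d v = integral {0..v} (kern d)" if "v \<in> {0..1}" for v
  proof -
    have "set_integrable lborel {0<..<v} (kern d)"
      by (rule set_integrable_subset[OF set_integrable_kern[OF d]]) (use that in auto)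
    then show ?thesis
      by (simp add: incomplete_euler_def integral_open_interval_real set_borel_integral_eq_integral(2))
  qed
  have int: "kern d integrable_on {0..1}"
    using set_borel_integral_eq_integral(1)[OF set_integrable_kern[OF d]]
    by (simp add: integrable_on_Icc_iff_Ioo)
  show "continuous_on {0..1} (incomplete_euler d)"
    using indefinite_integral_continuous_1[OF int] eq by (metis (no_types, lifting) continuous_on_cong)
  show "incomplete_euler d 0 = 0" using eq[of 0] by simp
  fix v :: real assume v: "0 < v" "v < 1"
  have "isCont (kern d) v"
    using continuous_on_kern v by (auto simp: continuous_on_eq_continuous_at)
  then have "((\<lambda>u. integral {0..u} (kern d)) has_vector_derivative kern d v) (at v within {0..1} - {})"
    using v by (intro integral_has_vector_derivative_continuous_at int) (auto intro: continuous_at_imp_continuous_within)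
  then have "((\<lambda>u. integral {0..u} (kern d)) has_vector_derivative kern d v) (at v)"
    using v by (simp add: at_within_Icc_at)
  then show "(incomplete_euler d has_vector_derivative kern d v) (at v)"
    by (rule has_vector_derivative_transform_within_open[of _ _ _ "{0<..<1}"]) (use v eq in auto)
qed

text \<open>
  With \<open>w = 1 - u\<close> and \<open>e = c + d - a - b\<close>, the function \<open>u powr c * w powr d * (w * F' u + e * F u)\<close>
  vanishes at both ends of the interval. By the hypergeometric differential equation its derivative is a
  combination of \<open>kern d\<close> and \<open>kern (d + 1)\<close> alone: \<open>e\<close> is the factor for which the terms with \<open>F'\<close>
  cancel.
\<close>

lemma euler_recurrence:
  assumes d: "Re d > \<eta>"
  shows "d * (c + d - a - b) * incomplete_euler d 1 = (c + d - a) * (c + d - b) * incomplete_euler (d + 1) 1"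
proof -
  define e where "e = c + d - a - b"
  define H where "H u = of_real u powr c * of_real (1 - u) powr (d + 1) * F' u
    + e * (of_real u powr c * of_real (1 - u) powr d * F u)" for u
  define h where "h u = (c + d - a) * (c + d - b) * kern (d + 1) u - d * e * kern d u" for u
  have dH: "(H has_vector_derivative h u) (at u)" if u: "0 < u" "u < 1" for u
  proof -
    define X where "X = complex_of_real u powr (c - 1)"
    define Y where "Y = complex_of_real (1 - u) powr (d - 1)"
    have X: "complex_of_real u powr c = of_real u * X" and Y: "complex_of_real (1 - u) powr d = of_real (1 - u) * Y"
      "complex_of_real (1 - u) powr (d + 1) = of_real (1 - u) * of_real (1 - u) * Y"
      using u by (simp_all add: X_def Y_def powr_diff powr_add)
    have ode: "of_real u * of_real (1 - u) * F'' u = a * b * F u - (c - (a + b + 1) * of_real u) * F' u"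
      using hypergeometric_ode[of u] u by (simp add: algebra_simps)
    have "(H has_vector_derivative
        (of_real u powr c * of_real (1 - u) powr (d + 1) * F'' u
         + (of_real u powr c * - ((d + 1) * of_real (1 - u) powr (d + 1 - 1))
            + c * of_real u powr (c - 1) * of_real (1 - u) powr (d + 1)) * F' u)
      + e * (of_real u powr c * of_real (1 - u) powr d * F' u
         + (of_real u powr c * - (d * of_real (1 - u) powr (d - 1))
            + c * of_real u powr (c - 1) * of_real (1 - u) powr d) * F u)) (at u)"
      (is "(_ has_vector_derivative ?D) _")
      unfolding H_def[abs_def]
      using u by (intro has_vector_derivative_add has_vector_derivative_mult has_vector_derivative_mult_right
          has_vector_derivative_of_real_powr has_vector_derivative_one_minus_powr has_vector_derivative_F) auto
    also have "?D = X * Y * of_real (1 - u) * (of_real u * of_real (1 - u) * F'' u)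
        + (- X * of_real u * (d + 1) * (of_real (1 - u) * Y) + c * X * (of_real (1 - u) * of_real (1 - u) * Y)) * F' u
        + e * (of_real u * X * (of_real (1 - u) * Y) * F' u
          + (- of_real u * X * d * Y + c * X * (of_real (1 - u) * Y)) * F u)"
      using X Y by (simp add: X_def[symmetric] Y_def[symmetric] del: of_real_diff) (simp add: algebra_simps)
    also have "\<dots> = h u"
      unfolding ode h_def kern_def X_def[symmetric] Y_def[symmetric] e_def
      using Y by simp (simp add: algebra_simps)
    finally show ?thesis .
  qed
  have int: "set_integrable lborel {0<..<1} (kern d)" "set_integrable lborel {0<..<1} (kern (d + 1))"
    using d by (auto intro!: set_integrable_kern)
  have "(LBINT u:{0<..<1}. h u) = 0 - 0"
  proof (rule set_lebesgue_integral_FTC_open)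
    show "continuous_on {0<..<1} h" unfolding h_def by (intro continuous_intros continuous_on_kern)
    show "set_integrable lborel {0<..<1} h" unfolding h_def
      by (intro set_integral_diff set_integrable_mult_right int)
    obtain K where K: "K > 0"
      "\<And>u. 0 \<le> u \<Longrightarrow> u < 1 \<Longrightarrow> norm (F u) \<le> K * (1 - u) powr (- \<eta>)"
      "\<And>u. 0 \<le> u \<Longrightarrow> u < 1 \<Longrightarrow> norm (F' u) \<le> K * (1 - u) powr (- \<eta> - 1)"
      using F_bounds by metis
    have H_le: "norm (H u) \<le> (1 + norm e) * K * (u powr Re c * (1 - u) powr (Re d - \<eta>))" if u: "0 < u" "u < 1" for u
    proof -
      have "norm (H u) \<le> u powr Re c * (1 - u) powr (Re d + 1) * norm (F' u)
          + norm e * (u powr Re c * (1 - u) powr Re d * norm (F u))"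
        unfolding H_def using u
        by (intro order_trans[OF norm_triangle_ineq]) (simp add: norm_mult norm_of_real_powr del: of_real_diff)
      also have "\<dots> \<le> u powr Re c * (1 - u) powr (Re d + 1) * (K * (1 - u) powr (- \<eta> - 1))
          + norm e * (u powr Re c * (1 - u) powr Re d * (K * (1 - u) powr (- \<eta>)))"
        using u K by (intro add_mono mult_left_mono) auto
      also have "\<dots> = K * (u powr Re c * ((1 - u) powr (Re d + 1) * (1 - u) powr (- \<eta> - 1)))
          + norm e * (K * (u powr Re c * ((1 - u) powr Re d * (1 - u) powr (- \<eta>))))"
        by simp
      also have "\<dots> = (1 + norm e) * K * (u powr Re c * (1 - u) powr (Re d - \<eta>))"
        by (simp flip: powr_add add: algebra_simps)
      finally show ?thesis .
    qed
    show "(H \<longlongrightarrow> 0) (at_right 0)"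
    proof (rule Lim_null_comparison)
      show "eventually (\<lambda>u. norm (H u) \<le> (1 + norm e) * K * (u powr Re c * (1 - u) powr (Re d - \<eta>))) (at_right 0)"
        using H_le eventually_at_right_real[of 0 1] by (auto elim!: eventually_mono)
      have "((\<lambda>u. u powr Re c) \<longlongrightarrow> 0 powr Re c) (at_right (0::real))"
        using c_pos by (intro tendsto_powr') (auto simp: eventually_at_filter)
      moreover have "((\<lambda>u. (1 - u) powr (Re d - \<eta>)) \<longlongrightarrow> (1 - 0) powr (Re d - \<eta>)) (at_right (0::real))"
        by (intro tendsto_intros) auto
      ultimately show "((\<lambda>u. (1 + norm e) * K * (u powr Re c * (1 - u) powr (Re d - \<eta>))) \<longlongrightarrow> 0) (at_right 0)"
        using tendsto_mult[OF tendsto_const[of "(1 + norm e) * K"] tendsto_mult] by fastforce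
    qed
    show "(H \<longlongrightarrow> 0) (at_left 1)"
    proof (rule Lim_null_comparison)
      show "eventually (\<lambda>u. norm (H u) \<le> (1 + norm e) * K * (u powr Re c * (1 - u) powr (Re d - \<eta>))) (at_left 1)"
        using H_le eventually_at_left_real[of 0 1] by (auto elim!: eventually_mono)
      have "((\<lambda>u. (1 - u) powr (Re d - \<eta>)) \<longlongrightarrow> (1 - 1) powr (Re d - \<eta>)) (at_left (1::real))"
        using d by (intro tendsto_powr' tendsto_intros) (auto simp: eventually_at_filter)
      moreover have "((\<lambda>u. u powr Re c) \<longlongrightarrow> 1 powr Re c) (at_left (1::real))"
        by (intro tendsto_intros) auto
      ultimately show "((\<lambda>u. (1 + norm e) * K * (u powr Re c * (1 - u) powr (Re d - \<eta>))) \<longlongrightarrow> 0) (at_left 1)"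
        using tendsto_mult[OF tendsto_const[of "(1 + norm e) * K"] tendsto_mult] by fastforce
    qed
  qed (use dH in auto)
  moreover have "(LBINT u:{0<..<1}. h u) = (c + d - a) * (c + d - b) * incomplete_euler (d + 1) 1 - d * e * incomplete_euler d 1"
    unfolding h_def incomplete_euler_def by (simp add: set_integral_diff set_integrable_mult_right int)
  ultimately show ?thesis by (simp add: e_def)
qed

text \<open>
  For large \<open>n\<close> the mass of \<open>(1 - u) powr (d + n - 1)\<close> sits at scale \<open>1 / n\<close>. After \<open>u = v / n\<close> the
  integrand tends to \<open>v powr (c - 1) * exp (- v)\<close>, whose integral is \<open>Gamma c\<close>.
\<close>

lemma euler_limit:
  assumes d: "Re d > \<eta>"
  shows "(\<lambda>n. of_nat n powr c * incomplete_euler (d + of_nat n) 1) \<longlonglongrightarrow> Gamma c"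
proof -
  obtain K where K: "K > 0"
    "\<And>d u. 0 < u \<Longrightarrow> u < 1 \<Longrightarrow> norm (kern d u) \<le> K * (u powr (Re c - 1) * (1 - u) powr (Re d - \<eta> - 1))"
    using norm_kern_le by blast
  define g where "g n x = (indicator {0<..<1} (x / real n) *\<^sub>R
      (of_nat n powr (c - 1) * kern (d + of_nat n) (x / real n)))" for n x
  define G where "G x = indicator {0<..} x *\<^sub>R (of_real x powr (c - 1) / of_real (exp x))" for x :: real
  define w where "w x = K * (indicator {0<..} x *\<^sub>R (x powr (Re c - 1) / exp (1 / 2 * x)))" for x :: real
  have lim: "(\<lambda>n. g n x) \<longlonglongrightarrow> G x" for x
  proof (cases "x > 0")
    case False
    then have "g n x = 0" for n
      by (auto simp: g_def indicator_def zero_less_divide_iff)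
    then show ?thesis using False by (simp add: G_def)
  next
    case True
    have small: "(\<lambda>n. x / real n) \<longlonglongrightarrow> 0"
      by (intro tendsto_divide_0[OF tendsto_const] filterlim_at_top_imp_at_infinity filterlim_real_sequentially)
    have "isCont F 0" by (intro has_vector_derivative_continuous[OF has_vector_derivative_F(1)]) auto
    then have F: "(\<lambda>n. F (x / real n)) \<longlonglongrightarrow> 1"
      using isCont_tendsto_compose[OF _ small] F_0 by fastforce
    have P: "(\<lambda>n. of_real (1 - x / real n) powr (d - 1)) \<longlonglongrightarrow> of_real (1 - 0) powr (d - 1)"
      by (intro tendsto_powr_complex tendsto_intros small) auto
    have "(\<lambda>n. (1 + (- x) / real n) ^ n) \<longlonglongrightarrow> exp (- x)"
      by (rule tendsto_exp_limit_sequentially)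
    then have E: "(\<lambda>n. complex_of_real ((1 - x / real n) ^ n)) \<longlonglongrightarrow> of_real (exp (- x))"
      by (intro tendsto_of_real) simp
    have "(\<lambda>n. of_real x powr (c - 1) * (of_real (1 - x / real n) powr (d - 1) *
        of_real ((1 - x / real n) ^ n)) * F (x / real n)) \<longlonglongrightarrow>
        of_real x powr (c - 1) * (of_real (1 - 0) powr (d - 1) * of_real (exp (- x))) * 1"
      by (intro tendsto_mult tendsto_const P E F)
    moreover have "eventually (\<lambda>n. of_real x powr (c - 1) * (of_real (1 - x / real n) powr (d - 1) *
        of_real ((1 - x / real n) ^ n)) * F (x / real n) = g n x) sequentially"
    proof -
      have "eventually (\<lambda>n. real n > x) sequentially"
        by (rule filterlim_at_top_dense[THEN iffD1, rule_format]) (rule filterlim_real_sequentially)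
      then show ?thesis
      proof eventually_elim
        case (elim n)
        then have n: "n > 0" and u: "0 < x / real n" "x / real n < 1" using True by (auto intro!: divide_pos_pos)
        have "of_nat n powr (c - 1) * of_real (x / real n) powr (c - 1) = of_real x powr (c - 1)"
        proof -
          have "complex_of_real (real n * (x / real n)) powr (c - 1)
              = of_real (real n) powr (c - 1) * of_real (x / real n) powr (c - 1)"
            unfolding of_real_mult using u by (intro powr_times_real) auto
          then show ?thesis using n by simp
        qed
        moreover have "complex_of_real (1 - x / real n) powr (d + of_nat n - 1) =
            of_real (1 - x / real n) powr (d - 1) * of_real ((1 - x / real n) ^ n)"
        proof -
          have "1 - x / real n \<noteq> 0" using u by linarith
          then have "complex_of_real (1 - x / real n) powr (of_nat n) = of_real ((1 - x / real n) ^ n)"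
            by (subst powr_nat') (auto simp del: of_real_diff)
          moreover have "d + of_nat n - 1 = (d - 1) + of_nat n" by simp
          ultimately show ?thesis by (simp only: powr_add)
        qed
        ultimately show ?case
          using u unfolding g_def kern_def by (simp add: mult_ac del: of_real_diff of_real_divide of_real_power)
      qed
    qed
    ultimately have "(\<lambda>n. g n x) \<longlonglongrightarrow> of_real x powr (c - 1) * (of_real (1 - 0) powr (d - 1) * of_real (exp (- x))) * 1"
      by (rule Lim_transform_eventually)
    then show ?thesis using True by (simp add: G_def exp_minus divide_inverse)
  qed
  have meas: "g n \<in> borel_measurable borel" for n
  proof -
    have 1: "(\<lambda>u. indicator {0<..<1} u *\<^sub>R kern (d + of_nat n) u) \<in> borel_measurable borel"
      by (intro borel_measurable_continuous_on_indicator continuous_on_kern) auto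
    have "(\<lambda>x. x / real n) \<in> borel_measurable borel" by measurable
    from measurable_compose[OF this 1] have
      "(\<lambda>x. of_nat n powr (c - 1) * (indicator {0<..<1} (x / real n) *\<^sub>R kern (d + of_nat n) (x / real n))) \<in> borel_measurable borel"
      by measurable
    then show ?thesis by (simp add: g_def[abs_def])
  qed
  have bound: "norm (g n x) \<le> w x" if n: "n \<ge> 2" for n x
  proof (cases "x / real n \<in> {0<..<1}")
    case False
    then show ?thesis using K(1) by (auto simp: g_def w_def)
  next
    case True
    then have u: "0 < x / real n" "x / real n < 1" by auto
    then have x: "x > 0" by (simp add: zero_less_divide_iff)
    define u where "u = x / real n"
    have "norm (g n x) = real n powr (Re c - 1) * norm (kern (d + of_nat n) u)"
      using True n by (simp add: g_def u_def norm_mult norm_powr_real_powr)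
    also have "\<dots> \<le> real n powr (Re c - 1) *
        (K * (u powr (Re c - 1) * (1 - u) powr (Re (d + of_nat n) - \<eta> - 1)))"
      using u unfolding u_def by (intro mult_left_mono K) auto
    also have "\<dots> = K * ((real n * u) powr (Re c - 1) * (1 - u) powr (Re d - \<eta> + (real n - 1)))"
    proof -
      have "0 \<le> u" using u by (simp add: u_def)
      then have "(real n * u) powr (Re c - 1) = real n powr (Re c - 1) * u powr (Re c - 1)"
        by (simp add: powr_mult)
      moreover have "Re (d + of_nat n) - \<eta> - 1 = Re d - \<eta> + (real n - 1)" by simp
      ultimately show ?thesis by (simp only: mult.left_commute mult.assoc)
    qed
    also have "real n * u = x" using n by (simp add: u_def)
    also have "K * (x powr (Re c - 1) * (1 - u) powr (Re d - \<eta> + (real n - 1))) \<le>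
        K * (x powr (Re c - 1) * exp (- (x / 2)))"
    proof (intro mult_left_mono)
      have "(1 - u) powr (Re d - \<eta> + (real n - 1)) \<le> (1 - u) powr (real n - 1)"
        using u d unfolding u_def by (intro powr_mono') auto
      also have "\<dots> \<le> exp (- u) powr (real n - 1)"
        using u n exp_ge_add_one_self[of "- u"] unfolding u_def by (intro powr_mono2) auto
      also have "\<dots> = exp (- (u * (real n - 1)))" by (simp add: powr_def)
      also have "\<dots> \<le> exp (- (x / 2))"
      proof -
        have "x / 2 = u * (real n / 2)" using n by (simp add: u_def)
        also have "\<dots> \<le> u * (real n - 1)" using n u by (intro mult_left_mono) (auto simp: u_def)
        finally show ?thesis by simp
      qed
      finally show "(1 - u) powr (Re d - \<eta> + (real n - 1)) \<le> exp (- (x / 2))" .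
    qed (use K(1) in auto)
    also have "\<dots> = w x" using x by (simp add: w_def exp_minus field_simps)
    finally show ?thesis .
  qed
  have w: "integrable lborel w"
  proof -
    have "set_integrable lebesgue {0<..} (\<lambda>t. complex_of_real t powr (of_real (Re c) - 1) / of_real (exp (1/2 * t)))"
      using absolutely_integrable_Gamma_integral[of "of_real (Re c)" "1/2"] c_pos by simp
    then have "integrable lebesgue (\<lambda>t. norm (indicator {0<..} t *\<^sub>R (complex_of_real t powr (of_real (Re c) - 1) / of_real (exp (1/2 * t)))))"
      unfolding set_integrable_def by (rule integrable_norm)
    also have "(\<lambda>t. norm (indicator {0<..} t *\<^sub>R (complex_of_real t powr (of_real (Re c) - 1) / of_real (exp (1/2 * t))))) =
        (\<lambda>t. indicator {0<..} t *\<^sub>R (t powr (Re c - 1) / exp (1 / 2 * t)))"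
      by (auto simp: fun_eq_iff indicator_def norm_divide norm_powr_real_powr)
    finally have "integrable lborel (\<lambda>t. indicator {0<..} t *\<^sub>R (t powr (Re c - 1) / exp (1 / 2 * t)))"
      by (subst (asm) integrable_completion) auto
    then show ?thesis unfolding w_def by (intro integrable_mult_right) auto
  qed
  have conv: "(\<lambda>n. \<integral>x. g (n + 2) x \<partial>lborel) \<longlonglongrightarrow> (\<integral>x. G x \<partial>lborel)" and G: "integrable lborel G"
  proof -
    have Gm: "G \<in> borel_measurable lborel"
      by (rule borel_measurable_LIMSEQ_metric[of g]) (use meas lim in auto)
    have l: "AE x in lborel. (\<lambda>n. g (n + 2) x) \<longlonglongrightarrow> G x"
      using lim by (intro AE_I2 LIMSEQ_ignore_initial_segment)
    have b: "AE x in lborel. norm (g (n + 2) x) \<le> w x" for n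
      using bound[of "n + 2"] by auto
    show "(\<lambda>n. \<integral>x. g (n + 2) x \<partial>lborel) \<longlonglongrightarrow> (\<integral>x. G x \<partial>lborel)"
      by (rule integral_dominated_convergence[OF Gm _ w l b]) (use meas in auto)
    show "integrable lborel G"
      by (rule integrable_dominated_convergence[OF Gm _ w l b]) (use meas in auto)
  qed
  have "(\<integral>x. G x \<partial>lborel) = Gamma c"
  proof -
    have "set_integrable lborel {0<..} (\<lambda>x. complex_of_real x powr (c - 1) / of_real (exp x))"
      using G by (simp add: set_integrable_def G_def[abs_def])
    from set_borel_integral_eq_integral(2)[OF this]
    have "(\<integral>x. G x \<partial>lborel) = integral {0<..} (\<lambda>x. complex_of_real x powr (c - 1) / of_real (exp x))"
      by (simp add: set_lebesgue_integral_def G_def[abs_def])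
    also have "\<dots> = Gamma c" using Gamma_integral_complex'[OF c_pos] by (rule integral_unique)
    finally show ?thesis .
  qed
  moreover have "(\<integral>x. g n x \<partial>lborel) = of_nat n powr c * incomplete_euler (d + of_nat n) 1" if n: "n > 0" for n
  proof -
    have "incomplete_euler (d + of_nat n) 1 = (1 / real n) *\<^sub>R (\<integral>x. indicator {0<..<1} (x / real n) *\<^sub>R kern (d + of_nat n) (x / real n) \<partial>lborel)"
      unfolding incomplete_euler_def set_lebesgue_integral_def
      using n by (subst lborel_integral_real_affine[where c = "1 / real n" and t = 0]) auto
    moreover have "(\<integral>x. g n x \<partial>lborel) = of_nat n powr (c - 1) *
        (\<integral>x. indicator {0<..<1} (x / real n) *\<^sub>R kern (d + of_nat n) (x / real n) \<partial>lborel)"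
    proof -
      have "g n = (\<lambda>x. of_nat n powr (c - 1) * (indicator {0<..<1} (x / real n) *\<^sub>R kern (d + of_nat n) (x / real n)))"
        by (simp add: g_def fun_eq_iff)
      then show ?thesis by (simp only: integral_mult_right_zero)
    qed
    ultimately show ?thesis using n by (simp add: powr_diff scaleR_conv_of_real)
  qed
  ultimately have "(\<lambda>n. of_nat (n + 2) powr c * incomplete_euler (d + of_nat (n + 2)) 1) \<longlonglongrightarrow> Gamma c"
    using conv by simp
  then show ?thesis by (rule LIMSEQ_offset)
qed

text \<open>
  Iterating the recurrence expresses the integral by Pochhammer quotients and the integral with
  \<open>d + n\<close>. The powers of \<open>n\<close> hidden in the Pochhammer symbols combine to \<open>n powr c\<close>, exactly the
  normalisation of \<open>euler_limit\<close>. For \<open>a = 0\<close> the formula is the complex Beta integral.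
\<close>

theorem euler_integral:
  assumes d: "Re d > \<eta>"
  shows "incomplete_euler d 1 = Gamma c * Gamma d * Gamma (c + d - a - b) * rGamma (c + d - a) * rGamma (c + d - b)"
proof -
  define e where "e = c + d - a - b"
  define p where "p = c + d - a"
  define q where "q = c + d - b"
  have Re: "Re d > 0" "Re e > 0" using d \<eta>_pos \<eta>_ge by (auto simp: e_def)
  then have nz: "d \<notin> \<int>\<^sub>\<le>\<^sub>0" "e \<notin> \<int>\<^sub>\<le>\<^sub>0" by (auto elim!: nonpos_Ints_cases)
  have iter: "pochhammer d n * pochhammer e n * incomplete_euler d 1 = pochhammer p n * pochhammer q n * incomplete_euler (d + of_nat n) 1" for n
  proof (induction n)
    case (Suc n)
    have "(d + of_nat n) * (e + of_nat n) * incomplete_euler (d + of_nat n) 1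
        = (p + of_nat n) * (q + of_nat n) * incomplete_euler (d + of_nat (Suc n)) 1"
      using euler_recurrence[of "d + of_nat n"] d by (simp add: e_def p_def q_def algebra_simps)
    note step = this
    have "pochhammer d (Suc n) * pochhammer e (Suc n) * incomplete_euler d 1
        = (d + of_nat n) * (e + of_nat n) * (pochhammer d n * pochhammer e n * incomplete_euler d 1)"
      by (simp add: pochhammer_Suc mult_ac)
    also have "\<dots> = pochhammer p n * pochhammer q n * ((d + of_nat n) * (e + of_nat n) * incomplete_euler (d + of_nat n) 1)"
      unfolding Suc.IH by (simp only: mult_ac)
    also have "\<dots> = pochhammer p (Suc n) * pochhammer q (Suc n) * incomplete_euler (d + of_nat (Suc n)) 1"
      unfolding step by (simp only: pochhammer_Suc mult_ac)
    finally show ?case .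
  qed simp
  have "rGamma_series d n * rGamma_series e n * incomplete_euler d 1 =
      rGamma_series p n * rGamma_series q n * (of_nat n powr c * incomplete_euler (d + 1 + of_nat n) 1)" if n: "n > 0" for n
  proof -
    have "exp (d * of_real (ln (real n))) * exp (e * of_real (ln (real n))) * of_nat n powr c =
        exp (p * of_real (ln (real n))) * exp (q * of_real (ln (real n)))"
    proof -
      define l where "l = complex_of_real (ln (real n))"
      have "complex_of_nat n powr c = exp (c * l)"
        using n Ln_of_real[of "real n"] by (simp add: powr_def l_def)
      moreover have "d * l + e * l + c * l = p * l + q * l"
        by (simp add: e_def p_def q_def algebra_simps)
      ultimately show ?thesis
        unfolding l_def[symmetric] by (simp only: exp_add[symmetric])
    qed
    note exps = this
    let ?E = "\<lambda>z. exp (z * complex_of_real (ln (real n)))" and ?N = "complex_of_nat n powr c"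
    have "rGamma_series d n * rGamma_series e n * incomplete_euler d 1 =
        pochhammer d (n + 1) * pochhammer e (n + 1) * incomplete_euler d 1 / (fact n * fact n * (?E d * ?E e))"
      by (simp add: rGamma_series_def)
    also have "\<dots> = pochhammer p (n + 1) * pochhammer q (n + 1) * incomplete_euler (d + of_nat (n + 1)) 1 * ?N
        / (fact n * fact n * (?E d * ?E e * ?N))"
      unfolding iter using n by (simp add: mult.assoc)
    also have "\<dots> = rGamma_series p n * rGamma_series q n * (?N * incomplete_euler (d + 1 + of_nat n) 1)"
    proof -
      have "P * Q * I * N / (f * f * (X * Y)) = P / (f * X) * (Q / (f * Y)) * (N * I)"
        for P Q I N f X Y :: complex
        by (simp add: mult_ac)
      moreover have "d + of_nat (n + 1) = d + 1 + of_nat n" by simp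
      ultimately show ?thesis unfolding exps rGamma_series_def by metis
    qed
    finally show ?thesis .
  qed
  then have "eventually (\<lambda>n. rGamma_series p n * rGamma_series q n * (of_nat n powr c * incomplete_euler (d + 1 + of_nat n) 1)
      = rGamma_series d n * rGamma_series e n * incomplete_euler d 1) sequentially"
    by (intro eventually_mono[OF eventually_gt_at_top[of 0]]) auto
  moreover have "(\<lambda>n. rGamma_series p n * rGamma_series q n * (of_nat n powr c * incomplete_euler (d + 1 + of_nat n) 1))
      \<longlonglongrightarrow> rGamma p * rGamma q * Gamma c"
    using d by (intro tendsto_intros euler_limit) auto
  ultimately have "(\<lambda>n. rGamma_series d n * rGamma_series e n * incomplete_euler d 1) \<longlonglongrightarrow> rGamma p * rGamma q * Gamma c"
    by (rule Lim_transform_eventually[rotated])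
  moreover have "(\<lambda>n. rGamma_series d n * rGamma_series e n * incomplete_euler d 1) \<longlonglongrightarrow> rGamma d * rGamma e * incomplete_euler d 1"
    by (intro tendsto_intros)
  ultimately have "rGamma d * rGamma e * incomplete_euler d 1 = rGamma p * rGamma q * Gamma c"
    by (blast intro: LIMSEQ_unique)
  note limits_eq = this
  have unit: "Gamma d * rGamma d = 1" "Gamma e * rGamma e = 1"
    using nz by (auto simp: Gamma_def rGamma_eq_zero_iff)
  have "incomplete_euler d 1 = (Gamma d * rGamma d) * (Gamma e * rGamma e) * incomplete_euler d 1"
    by (simp only: unit mult_1)
  also have "\<dots> = Gamma d * Gamma e * (rGamma d * rGamma e * incomplete_euler d 1)"
    by (simp only: mult_ac)
  also have "\<dots> = Gamma c * Gamma d * Gamma e * rGamma p * rGamma q"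
    unfolding limits_eq by (simp only: mult_ac)
  finally show ?thesis by (simp only: e_def p_def q_def)
qed

definition g :: "real \<Rightarrow> complex" where "g u = of_real u powr (c - 1) * F u"
definition g' :: "real \<Rightarrow> complex" where
  "g' u = (c - 1) * of_real u powr (c - 2) * F u + of_real u powr (c - 1) * F' u"

lemma kern_eq_g: "kern d u = of_real (1 - u) powr (d - 1) * g u"
  by (simp add: kern_def g_def)

lemma has_vector_derivative_g:
  assumes "0 < u" "u < 1"
  shows "(g has_vector_derivative g' u) (at u)"
proof -
  have "c - 1 - 1 = c - 2" by simp
  moreover have "(g has_vector_derivative (of_real u powr (c - 1) * F' u + (c - 1) * of_real u powr (c - 1 - 1) * F u)) (at u)"
    unfolding g_def[abs_def] using assms
    by (intro has_vector_derivative_mult has_vector_derivative_of_real_powr has_vector_derivative_F) auto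
  ultimately show ?thesis by (simp add: g'_def add.commute)
qed

lemma continuous_on_g: "continuous_on {0<..<1} g" "continuous_on {0<..<1} g'"
  unfolding g_def g'_def by (intro continuous_intros continuous_on_F; auto)+

lemma incomplete_euler_measurable:
  assumes D: "continuous_on UNIV D" and v: "v \<le> 1"
  shows "(\<lambda>y. incomplete_euler (D y) v) \<in> borel_measurable (borel :: real measure)"
proof -
  have "continuous_on (UNIV \<times> {0<..<v}) (\<lambda>p. kern (D (fst p)) (snd p))"
    unfolding kern_def using v
    by (intro continuous_intros continuous_on_compose2[OF D] continuous_on_compose2[OF continuous_on_F(1)]) auto
  then have "(\<lambda>p. indicator (UNIV \<times> {0<..<v}) p *\<^sub>R kern (D (fst p)) (snd p)) \<in> borel_measurable borel"
    by (intro borel_measurable_continuous_on_indicator) (auto intro!: borel_open open_Times)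
  also have "(\<lambda>p. indicator (UNIV \<times> {0<..<v}) p *\<^sub>R kern (D (fst p)) (snd p)) =
      (\<lambda>(y, u). indicator {0<..<v} u *\<^sub>R kern (D y) u)"
    by (auto simp: indicator_def fun_eq_iff)
  finally have "(\<lambda>(y, u). indicator {0<..<v} u *\<^sub>R kern (D y) u) \<in> borel_measurable (borel \<Otimes>\<^sub>M lborel)"
    by (simp add: borel_prod[symmetric] cong: measurable_cong_sets sets_pair_measure_cong)
  then show ?thesis
    unfolding incomplete_euler_def set_lebesgue_integral_def
    by (rule lborel.borel_measurable_lebesgue_integral)
qed

text \<open>
  Oscillation of \<open>(1 - u) powr (\<i> * Im d)\<close> makes the integral small. The part below
  \<open>\<epsilon> = \<sigma> / norm d\<close> is small because the interval is short; on the rest an integration by parts gains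
  \<open>1 / d\<close> at the price of the singular factor \<open>u powr (Re c - 2)\<close>. Both parts have the order
  \<open>norm d powr (- Re c)\<close> up to a logarithm; any \<open>r < Re c\<close> absorbs it. Uniformity in the end point
  \<open>v\<close> makes the bound usable for dominated convergence as \<open>v\<close> varies.
\<close>

lemma incomplete_euler_bound:
  assumes c1: "Re c \<le> 1" and \<sigma>: "\<eta> < \<sigma>" and r: "0 \<le> r" "r < Re c"
  obtains C where "C \<ge> 0" "\<And>d v. Re d = \<sigma> \<Longrightarrow> 0 \<le> v \<Longrightarrow> v < 1 \<Longrightarrow> norm (incomplete_euler d v) \<le> C * norm d powr (- r)"
proof -
  obtain K where K: "K > 0"
    "\<And>u. 0 \<le> u \<Longrightarrow> u < 1 \<Longrightarrow> norm (F u) \<le> K * (1 - u) powr (- \<eta>)"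
    "\<And>u. 0 \<le> u \<Longrightarrow> u < 1 \<Longrightarrow> norm (F' u) \<le> K * (1 - u) powr (- \<eta> - 1)"
    using F_bounds by metis
  obtain L where L: "L > 0"
    "\<And>d u. 0 < u \<Longrightarrow> u < 1 \<Longrightarrow> norm (kern d u) \<le> L * (u powr (Re c - 1) * (1 - u) powr (Re d - \<eta> - 1))"
    using norm_kern_le by blast
  define M where "M = (norm (c - 1) + 1) * K"
  have M: "M \<ge> 0" using K(1) by (simp add: M_def)
  define w where "w u = u powr (Re c - r - 1) * (1 - u) powr (\<sigma> - \<eta> - 1)" for u
  have w: "set_integrable lborel {0<..<1} w"
    unfolding w_def using r \<sigma> by (intro set_integrable_Beta) auto
  define B where "B = (LBINT u:{0<..<1}. w u)"
  have B: "B \<ge> 0" unfolding B_def set_lebesgue_integral_def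
    by (intro Bochner_Integration.integral_nonneg) (auto simp: w_def indicator_def)
  have \<sigma>0: "\<sigma> > 0" using \<sigma> \<eta>_pos by simp
  have g_le: "norm (of_real (1 - u) powr d * g u) \<le> K * u powr (Re c - 1)"
    if u: "0 < u" "u < 1" and d: "Re d = \<sigma>" for u d
  proof -
    have "norm (of_real (1 - u) powr d * g u) = (1 - u) powr \<sigma> * (u powr (Re c - 1) * norm (F u))"
      using u d by (simp add: g_def norm_mult norm_of_real_powr del: of_real_diff)
    also have "\<dots> \<le> (1 - u) powr \<sigma> * (u powr (Re c - 1) * (K * (1 - u) powr (- \<eta>)))"
      using u K by (intro mult_left_mono) auto
    also have "\<dots> = K * u powr (Re c - 1) * ((1 - u) powr \<sigma> * (1 - u) powr (- \<eta>))" by simp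
    also have "\<dots> = K * u powr (Re c - 1) * (1 - u) powr (\<sigma> - \<eta>)" by (simp flip: powr_add)
    also have "\<dots> \<le> K * u powr (Re c - 1) * 1"
      using u K(1) \<sigma> by (intro mult_left_mono powr_le1) auto
    finally show ?thesis by simp
  qed
  have g'_le: "norm (of_real (1 - u) powr d * g' u) \<le> M * (u powr (Re c - 2) * (1 - u) powr (\<sigma> - \<eta> - 1))"
    if u: "0 < u" "u < 1" and d: "Re d = \<sigma>" for u d
  proof -
    have a: "u powr (Re c - 1) \<le> u powr (Re c - 2)" using u by (intro powr_mono') auto
    have b: "(1 - u) powr (- \<eta>) \<le> (1 - u) powr (- \<eta> - 1)" using u by (intro powr_mono') auto
    have "norm (g' u) \<le> norm (c - 1) * u powr (Re c - 2) * norm (F u) + u powr (Re c - 1) * norm (F' u)"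
      unfolding g'_def using u
      by (intro order_trans[OF norm_triangle_ineq]) (simp add: norm_mult norm_of_real_powr)
    also have "\<dots> \<le> norm (c - 1) * u powr (Re c - 2) * (K * (1 - u) powr (- \<eta> - 1))
        + u powr (Re c - 2) * (K * (1 - u) powr (- \<eta> - 1))"
    proof (intro add_mono mult_left_mono mult_mono)
      show "norm (F u) \<le> K * (1 - u) powr (- \<eta> - 1)"
        by (rule order_trans[OF K(2)]) (use u b K(1) in auto)
      show "norm (F' u) \<le> K * (1 - u) powr (- \<eta> - 1)" using K(3) u by auto
    qed (use a in auto)
    also have "\<dots> = M * (u powr (Re c - 2) * (1 - u) powr (- \<eta> - 1))" by (simp add: M_def algebra_simps)
    finally have le: "norm (g' u) \<le> M * (u powr (Re c - 2) * (1 - u) powr (- \<eta> - 1))" .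
    have "norm (of_real (1 - u) powr d * g' u) = (1 - u) powr \<sigma> * norm (g' u)"
      using u d by (simp add: norm_mult norm_of_real_powr del: of_real_diff)
    also have "\<dots> \<le> (1 - u) powr \<sigma> * (M * (u powr (Re c - 2) * (1 - u) powr (- \<eta> - 1)))"
      by (intro mult_left_mono le) auto
    also have "\<dots> = M * (u powr (Re c - 2) * ((1 - u) powr \<sigma> * (1 - u) powr (- \<eta> - 1)))" by simp
    also have "(1 - u) powr \<sigma> * (1 - u) powr (- \<eta> - 1) = (1 - u) powr (\<sigma> - \<eta> - 1)"
      by (simp flip: powr_add add: algebra_simps)
    finally show ?thesis .
  qed
  have incomplete_euler_le: "norm (incomplete_euler d v) \<le> L * \<epsilon> powr r * B"
    if d: "Re d = \<sigma>" and v: "0 \<le> v" "v \<le> \<epsilon>" "v < 1" for d v \<epsilon>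
    unfolding incomplete_euler_def B_def
  proof (rule set_integral_norm_le)
    show "set_integrable lborel {0<..<v} (kern d)"
      by (rule set_integrable_subset[OF set_integrable_kern]) (use d \<sigma> v in auto)
    fix u assume u: "u \<in> {0<..<v}"
    have "norm (kern d u) \<le> L * (u powr (Re c - 1) * (1 - u) powr (\<sigma> - \<eta> - 1))"
      using L(2)[of u d] u v d by auto
    also have "u powr (Re c - 1) = u powr r * u powr (Re c - r - 1)"
      by (simp flip: powr_add)
    also have "L * (u powr r * u powr (Re c - r - 1) * (1 - u) powr (\<sigma> - \<eta> - 1)) = L * u powr r * w u"
      by (simp add: w_def)
    also have "\<dots> \<le> L * \<epsilon> powr r * w u"
      using u v L(1) r by (intro mult_right_mono mult_left_mono powr_mono2) (auto simp: w_def)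
    finally show "norm (kern d u) \<le> L * \<epsilon> powr r * w u" .
  qed (use w v L(1) in auto, auto simp: w_def)
  define C where "C = L * \<sigma> powr r * B + (2 * K + M * B) * \<sigma> powr (r - 1)"
  show thesis
  proof (rule that)
    show C: "C \<ge> 0" using L(1) B K(1) M by (simp add: C_def)
    fix d :: complex and v :: real assume d: "Re d = \<sigma>" and v: "0 \<le> v" "v < 1"
    have nd: "norm d \<ge> \<sigma>" using complex_Re_le_cmod[of d] d by simp
    then have nd0: "norm d > 0" using \<sigma>0 by (rule less_le_trans[rotated])
    define \<epsilon> where "\<epsilon> = \<sigma> / norm d"
    have \<epsilon>: "0 < \<epsilon>" "\<epsilon> \<le> 1" using nd \<sigma>0 nd0 by (auto simp: \<epsilon>_def)
    have \<epsilon>_r: "\<epsilon> powr r = \<sigma> powr r * norm d powr (- r)"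
      using \<sigma>0 nd0 by (simp add: \<epsilon>_def powr_divide powr_minus_divide)
    have \<epsilon>_r1: "\<epsilon> powr (r - 1) / norm d = \<sigma> powr (r - 1) * norm d powr (- r)"
      using \<sigma>0 nd0 by (simp add: \<epsilon>_def powr_divide powr_diff powr_minus_divide)
    show "norm (incomplete_euler d v) \<le> C * norm d powr (- r)"
    proof (cases "v \<le> \<epsilon>")
      case True
      have "norm (incomplete_euler d v) \<le> L * \<epsilon> powr r * B" using incomplete_euler_le[OF d v(1) True v(2)] .
      also have "\<dots> = L * \<sigma> powr r * B * norm d powr (- r)" by (simp add: \<epsilon>_r)
      also have "\<dots> \<le> C * norm d powr (- r)"
        using K(1) M B by (intro mult_right_mono) (auto simp: C_def)
      finally show ?thesis .
    next
      case False
      \<comment> \<open>integration by parts, written with the primitive: its derivative no longer carries the factor \<open>d\<close>\<close>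
      define Q where "Q u = d * incomplete_euler d u + of_real (1 - u) powr d * g u" for u
      define p where "p u = of_real (1 - u) powr d * g' u" for u
      have dQ: "(Q has_vector_derivative p u) (at u)" if u: "0 < u" "u < 1" for u
      proof -
        have "(Q has_vector_derivative (d * kern d u +
            (of_real (1 - u) powr d * g' u + - (d * of_real (1 - u) powr (d - 1)) * g u))) (at u)"
          unfolding Q_def[abs_def] using u d \<sigma>
          by (intro has_vector_derivative_add has_vector_derivative_mult has_vector_derivative_mult_right
              has_vector_derivative_one_minus_powr has_vector_derivative_g incomplete_euler_deriv) auto
        then show ?thesis by (simp add: p_def kern_eq_g)
      qed
      have contp: "continuous_on {0<..<1} p"
        unfolding p_def by (intro continuous_intros continuous_on_g) auto
      have contQ: "isCont Q u" if "0 < u" "u < 1" for u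
        using has_vector_derivative_continuous[OF dQ[OF that]] .
      have "continuous_on {\<epsilon>..v} p" by (rule continuous_on_subset[OF contp]) (use \<epsilon> v in auto)
      then have "set_integrable lborel {\<epsilon>..v} p" by (rule borel_integrable_atLeastAtMost')
      then have intp: "set_integrable lborel {\<epsilon><..<v} p"
        by (rule set_integrable_subset) auto
      have "(LBINT u:{\<epsilon><..<v}. p u) = Q v - Q \<epsilon>"
      proof (rule set_lebesgue_integral_FTC_open)
        show "(Q \<longlongrightarrow> Q \<epsilon>) (at_right \<epsilon>)" "(Q \<longlongrightarrow> Q v) (at_left v)"
          using contQ[of \<epsilon>] contQ[of v] \<epsilon> v False
          by (auto simp: isCont_def filterlim_at_split)
      qed (use False dQ \<epsilon> v intp in \<open>auto intro: continuous_on_subset[OF contp]\<close>)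
      then have eq: "d * incomplete_euler d v = d * incomplete_euler d \<epsilon> + of_real (1 - \<epsilon>) powr d * g \<epsilon>
          - of_real (1 - v) powr d * g v + (LBINT u:{\<epsilon><..<v}. p u)"
        by (simp add: Q_def algebra_simps)
      have small: "u powr (Re c - 1) \<le> \<epsilon> powr (r - 1)" if "\<epsilon> \<le> u" for u
      proof -
        have "u powr (Re c - 1) \<le> \<epsilon> powr (Re c - 1)"
          using that \<epsilon> c1 by (intro powr_mono2') auto
        also have "\<dots> \<le> \<epsilon> powr (r - 1)" using \<epsilon> r by (intro powr_mono') auto
        finally show ?thesis .
      qed
      have b1: "norm (of_real (1 - u) powr d * g u) \<le> K * \<epsilon> powr (r - 1)" if "\<epsilon> \<le> u" "u < 1" for u
        using g_le[of u d] that \<epsilon> d small[of u] K(1) by (auto intro: order_trans mult_left_mono)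
      have b2: "norm (LBINT u:{\<epsilon><..<v}. p u) \<le> M * \<epsilon> powr (r - 1) * B"
        unfolding B_def
      proof (rule set_integral_norm_le[OF intp w])
        fix u assume u: "u \<in> {\<epsilon><..<v}"
        then have u': "0 < u" "u < 1" using \<epsilon> v by auto
        have "norm (p u) \<le> M * (u powr (Re c - 2) * (1 - u) powr (\<sigma> - \<eta> - 1))"
          unfolding p_def using u' d by (intro g'_le)
        also have "u powr (Re c - 2) = u powr (r - 1) * u powr (Re c - r - 1)"
          by (simp flip: powr_add)
        also have "M * (u powr (r - 1) * u powr (Re c - r - 1) * (1 - u) powr (\<sigma> - \<eta> - 1)) = M * u powr (r - 1) * w u"
          by (simp add: w_def)
        also have "\<dots> \<le> M * \<epsilon> powr (r - 1) * w u"
          using u \<epsilon> M r c1 by (intro mult_right_mono mult_left_mono powr_mono2') (auto simp: w_def)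
        finally show "norm (p u) \<le> M * \<epsilon> powr (r - 1) * w u" .
      qed (use \<epsilon> v M in \<open>auto simp: w_def\<close>)
      have "\<epsilon> < 1" using False v by simp
      have "norm d * norm (incomplete_euler d v) \<le> norm d * (L * \<epsilon> powr r * B) + K * \<epsilon> powr (r - 1)
          + K * \<epsilon> powr (r - 1) + M * \<epsilon> powr (r - 1) * B"
      proof -
        have "norm d * norm (incomplete_euler d v) = norm (d * incomplete_euler d \<epsilon> + of_real (1 - \<epsilon>) powr d * g \<epsilon>
          - of_real (1 - v) powr d * g v + (LBINT u:{\<epsilon><..<v}. p u))"
          unfolding eq[symmetric] by (simp add: norm_mult)
        also have "\<dots> \<le> norm (d * incomplete_euler d \<epsilon>) + norm (of_real (1 - \<epsilon>) powr d * g \<epsilon>)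
          + norm (of_real (1 - v) powr d * g v) + norm (LBINT u:{\<epsilon><..<v}. p u)"
          by (intro order_trans[OF norm_triangle_ineq] add_right_mono order_trans[OF norm_triangle_ineq4]) auto
        also have "\<dots> \<le> norm d * (L * \<epsilon> powr r * B) + K * \<epsilon> powr (r - 1)
          + K * \<epsilon> powr (r - 1) + M * \<epsilon> powr (r - 1) * B"
          using \<epsilon> \<open>\<epsilon> < 1\<close> v False incomplete_euler_le[OF d, of \<epsilon> \<epsilon>]
          by (intro add_mono b1 b2) (auto simp: norm_mult intro: mult_left_mono)
        finally show ?thesis .
      qed
      then have "norm (incomplete_euler d v) \<le> (norm d * (L * \<epsilon> powr r * B) + K * \<epsilon> powr (r - 1)
          + K * \<epsilon> powr (r - 1) + M * \<epsilon> powr (r - 1) * B) / norm d"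
        using nd0 by (simp add: pos_le_divide_eq mult.commute)
      also have "\<dots> = L * \<epsilon> powr r * B + (2 * K + M * B) * (\<epsilon> powr (r - 1) / norm d)"
        using nd0 by (simp add: field_simps)
      also have "\<dots> = C * norm d powr (- r)"
        unfolding \<epsilon>_r \<epsilon>_r1 C_def by (simp add: algebra_simps)
      finally show ?thesis .
    qed
  qed
qed

end

section \<open>Growth of the Gamma function on vertical lines\<close>

definition vertical_bound :: "(real \<Rightarrow> complex) \<Rightarrow> real \<Rightarrow> real \<Rightarrow> bool" where
  "vertical_bound f p q \<longleftrightarrow>
     (\<exists>C\<ge>0. \<forall>y. norm (f y) \<le> C * ((1 + \<bar>y\<bar>) powr p * exp (q * \<bar>y\<bar>)))"

lemma vertical_boundI:
  assumes "\<And>y. norm (f y) \<le> C * ((1 + \<bar>y\<bar>) powr p * exp (q * \<bar>y\<bar>))"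
  shows "vertical_bound f p q"
proof -
  have "norm (f y) \<le> max 0 C * ((1 + \<bar>y\<bar>) powr p * exp (q * \<bar>y\<bar>))" for y
    by (rule order_trans[OF assms]) (intro mult_right_mono, auto)
  then show ?thesis unfolding vertical_bound_def by (intro exI[of _ "max 0 C"]) auto
qed

lemma vertical_bound_1: "vertical_bound (\<lambda>_. 1) 0 0"
  by (rule vertical_boundI[where C = 1]) simp

lemma vertical_bound_mono:
  assumes "vertical_bound f p q" "C \<ge> 0" "\<And>y. norm (h y) \<le> C * norm (f y)"
  shows "vertical_bound h p q"
proof -
  obtain C' where C': "C' \<ge> 0" "\<And>y. norm (f y) \<le> C' * ((1 + \<bar>y\<bar>) powr p * exp (q * \<bar>y\<bar>))"
    using assms(1) unfolding vertical_bound_def by blast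
  show ?thesis
  proof (rule vertical_boundI)
    fix y
    have "norm (h y) \<le> C * (C' * ((1 + \<bar>y\<bar>) powr p * exp (q * \<bar>y\<bar>)))"
      by (rule order_trans[OF assms(3)]) (intro mult_left_mono C' assms(2))
    then show "norm (h y) \<le> (C * C') * ((1 + \<bar>y\<bar>) powr p * exp (q * \<bar>y\<bar>))"
      by (simp only: mult.assoc)
  qed
qed

lemma vertical_bound_mult:
  assumes "vertical_bound f p q" "vertical_bound h p' q'"
  shows "vertical_bound (\<lambda>y. f y * h y) (p + p') (q + q')"
proof -
  obtain C where C: "C \<ge> 0" "\<And>y. norm (f y) \<le> C * ((1 + \<bar>y\<bar>) powr p * exp (q * \<bar>y\<bar>))"
    using assms(1) unfolding vertical_bound_def by blast
  obtain C' where C': "C' \<ge> 0" "\<And>y. norm (h y) \<le> C' * ((1 + \<bar>y\<bar>) powr p' * exp (q' * \<bar>y\<bar>))"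
    using assms(2) unfolding vertical_bound_def by blast
  show ?thesis
  proof (rule vertical_boundI)
    fix y
    have "norm (f y * h y) \<le> (C * ((1 + \<bar>y\<bar>) powr p * exp (q * \<bar>y\<bar>))) * (C' * ((1 + \<bar>y\<bar>) powr p' * exp (q' * \<bar>y\<bar>)))"
      unfolding norm_mult using C C' by (intro mult_mono) auto
    also have "\<dots> = (C * C') * ((1 + \<bar>y\<bar>) powr (p + p') * exp ((q + q') * \<bar>y\<bar>))"
      by (simp add: powr_add exp_add distrib_right)
    finally show "norm (f y * h y) \<le> (C * C') * ((1 + \<bar>y\<bar>) powr (p + p') * exp ((q + q') * \<bar>y\<bar>))" .
  qed
qed

lemma vertical_bound_powr:
  assumes "vertical_bound f p q" "\<kappa> \<ge> 0" "\<And>y. norm (h y) \<le> norm (f y) powr \<kappa>"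
  shows "vertical_bound h (\<kappa> * p) (\<kappa> * q)"
proof -
  obtain C where C: "C \<ge> 0" "\<And>y. norm (f y) \<le> C * ((1 + \<bar>y\<bar>) powr p * exp (q * \<bar>y\<bar>))"
    using assms(1) unfolding vertical_bound_def by blast
  show ?thesis
  proof (rule vertical_boundI)
    fix y
    have "norm (h y) \<le> norm (f y) powr \<kappa>" by fact
    also have "\<dots> \<le> (C * ((1 + \<bar>y\<bar>) powr p * exp (q * \<bar>y\<bar>))) powr \<kappa>"
      using C assms(2) by (intro powr_mono2) auto
    also have "\<dots> = C powr \<kappa> * ((1 + \<bar>y\<bar>) powr (\<kappa> * p) * exp (\<kappa> * q * \<bar>y\<bar>))"
      using C(1) by (simp add: powr_mult powr_powr exp_powr_real mult_ac)
    finally show "norm (h y) \<le> C powr \<kappa> * ((1 + \<bar>y\<bar>) powr (\<kappa> * p) * exp (\<kappa> * q * \<bar>y\<bar>))" .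
  qed
qed

text \<open>
  A shift of the argument changes neither the power nor the exponential rate; a dilation by \<open>D\<close> scales
  the rate by \<open>\<bar>D\<bar>\<close>.
\<close>

lemma vertical_bound_affine:
  assumes f: "vertical_bound f p q" and D: "D \<noteq> 0"
  shows "vertical_bound (\<lambda>y. f (\<tau> + D * y)) p (q * \<bar>D\<bar>)"
proof -
  obtain C where C: "C \<ge> 0" "\<And>y. norm (f y) \<le> C * ((1 + \<bar>y\<bar>) powr p * exp (q * \<bar>y\<bar>))"
    using f unfolding vertical_bound_def by blast
  define u where "u = 1 + \<bar>\<tau>\<bar> + \<bar>D\<bar>"
  define l where "l = (1 + \<bar>\<tau>\<bar> + \<bar>D\<bar>) / \<bar>D\<bar>"
  have u: "u > 0" and l: "l > 0" using D by (auto simp: u_def l_def intro!: divide_pos_pos)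
  have up: "1 + \<bar>\<tau> + D * y\<bar> \<le> u * (1 + \<bar>y\<bar>)" for y
  proof -
    have "\<bar>\<tau> + D * y\<bar> \<le> \<bar>\<tau>\<bar> + \<bar>D\<bar> * \<bar>y\<bar>" using abs_triangle_ineq[of \<tau> "D * y"] by (simp only: abs_mult)
    moreover have "u * (1 + \<bar>y\<bar>) = 1 + \<bar>\<tau>\<bar> + \<bar>D\<bar> * \<bar>y\<bar> + \<bar>D\<bar> + \<bar>y\<bar> + \<bar>\<tau>\<bar> * \<bar>y\<bar>" by (simp add: u_def algebra_simps)
    moreover have "0 \<le> \<bar>\<tau>\<bar> * \<bar>y\<bar>" by simp
    ultimately show ?thesis by linarith
  qed
  have lo: "1 + \<bar>y\<bar> \<le> l * (1 + \<bar>\<tau> + D * y\<bar>)" for y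
  proof -
    define z where "z = \<bar>\<tau> + D * y\<bar>"
    have "\<bar>D\<bar> * \<bar>y\<bar> \<le> \<bar>\<tau>\<bar> + z"
    proof -
      have "\<bar>D * y\<bar> \<le> \<bar>\<tau>\<bar> + \<bar>\<tau> + D * y\<bar>" by linarith
      then show ?thesis by (simp only: z_def abs_mult)
    qed
    moreover have "0 \<le> \<bar>\<tau>\<bar> * z" "0 \<le> \<bar>D\<bar> * z" by (auto simp: z_def)
    ultimately have "\<bar>D\<bar> * (1 + \<bar>y\<bar>) \<le> (1 + \<bar>\<tau>\<bar> + \<bar>D\<bar>) * (1 + z)"
      by (simp add: algebra_simps)
    then show ?thesis using D by (simp add: l_def z_def field_simps)
  qed
  have pw: "(1 + \<bar>\<tau> + D * y\<bar>) powr p \<le> max (u powr p) (l powr (- p)) * (1 + \<bar>y\<bar>) powr p" for y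
  proof (cases "p \<ge> 0")
    case True
    have "(1 + \<bar>\<tau> + D * y\<bar>) powr p \<le> (u * (1 + \<bar>y\<bar>)) powr p"
      using up[of y] True by (intro powr_mono2) auto
    also have "\<dots> = u powr p * (1 + \<bar>y\<bar>) powr p" using u by (simp add: powr_mult)
    also have "\<dots> \<le> max (u powr p) (l powr (- p)) * (1 + \<bar>y\<bar>) powr p" by (intro mult_right_mono) auto
    finally show ?thesis .
  next
    case False
    have "(1 + \<bar>\<tau> + D * y\<bar>) powr p = l powr (- p) * (l * (1 + \<bar>\<tau> + D * y\<bar>)) powr p"
      using l by (simp add: powr_mult powr_minus)
    also have "\<dots> \<le> l powr (- p) * (1 + \<bar>y\<bar>) powr p"
      using lo[of y] False by (intro mult_left_mono powr_mono2') auto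
    also have "\<dots> \<le> max (u powr p) (l powr (- p)) * (1 + \<bar>y\<bar>) powr p" by (intro mult_right_mono) auto
    finally show ?thesis .
  qed
  have ex: "exp (q * \<bar>\<tau> + D * y\<bar>) \<le> exp (\<bar>q\<bar> * \<bar>\<tau>\<bar>) * exp (q * \<bar>D\<bar> * \<bar>y\<bar>)" for y
  proof -
    have "\<bar>\<bar>\<tau> + D * y\<bar> - \<bar>D\<bar> * \<bar>y\<bar>\<bar> \<le> \<bar>\<tau>\<bar>"
    proof -
      have "\<bar>\<bar>\<tau> + D * y\<bar> - \<bar>D * y\<bar>\<bar> \<le> \<bar>\<tau>\<bar>" by linarith
      then show ?thesis by (simp only: abs_mult)
    qed
    then have "\<bar>q\<bar> * \<bar>\<bar>\<tau> + D * y\<bar> - \<bar>D\<bar> * \<bar>y\<bar>\<bar> \<le> \<bar>q\<bar> * \<bar>\<tau>\<bar>" by (intro mult_left_mono) auto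
    then have "q * (\<bar>\<tau> + D * y\<bar> - \<bar>D\<bar> * \<bar>y\<bar>) \<le> \<bar>q\<bar> * \<bar>\<tau>\<bar>"
      using abs_ge_self[of "q * (\<bar>\<tau> + D * y\<bar> - \<bar>D\<bar> * \<bar>y\<bar>)"] by (simp only: abs_mult)
    then show ?thesis by (simp flip: exp_add add: algebra_simps)
  qed
  show ?thesis
  proof (rule vertical_boundI)
    fix y
    have "norm (f (\<tau> + D * y)) \<le> C * ((1 + \<bar>\<tau> + D * y\<bar>) powr p * exp (q * \<bar>\<tau> + D * y\<bar>))" by (rule C)
    also have "\<dots> \<le> C * ((max (u powr p) (l powr (- p)) * (1 + \<bar>y\<bar>) powr p) * (exp (\<bar>q\<bar> * \<bar>\<tau>\<bar>) * exp (q * \<bar>D\<bar> * \<bar>y\<bar>)))"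
      using C(1) by (intro mult_left_mono mult_mono pw ex) (auto simp: le_max_iff_disj)
    also have "\<dots> = (C * max (u powr p) (l powr (- p)) * exp (\<bar>q\<bar> * \<bar>\<tau>\<bar>)) * ((1 + \<bar>y\<bar>) powr p * exp (q * \<bar>D\<bar> * \<bar>y\<bar>))"
      by (simp only: mult_ac)
    finally show "norm (f (\<tau> + D * y)) \<le> (C * max (u powr p) (l powr (- p)) * exp (\<bar>q\<bar> * \<bar>\<tau>\<bar>)) * ((1 + \<bar>y\<bar>) powr p * exp (q * \<bar>D\<bar> * \<bar>y\<bar>))" .
  qed
qed

lemma vertical_bound_Complex: "vertical_bound (\<lambda>y. Complex s y) 1 0"
proof (rule vertical_boundI)
  fix y
  have "norm (Complex s y) \<le> \<bar>s\<bar> + \<bar>y\<bar>"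
    using cmod_le[of "Complex s y"] by simp
  also have "\<dots> \<le> (1 + \<bar>s\<bar>) * (1 + \<bar>y\<bar>)" by (simp add: algebra_simps)
  finally show "norm (Complex s y) \<le> (1 + \<bar>s\<bar>) * ((1 + \<bar>y\<bar>) powr 1 * exp (0 * \<bar>y\<bar>))" by simp
qed

lemma norm_Complex_ge:
  assumes "s > 0" shows "norm (Complex s y) \<ge> min s 1 / 2 * (1 + \<bar>y\<bar>)"
proof -
  have "norm (Complex s y) \<ge> s" "norm (Complex s y) \<ge> \<bar>y\<bar>"
    using abs_Re_le_cmod[of "Complex s y"] abs_Im_le_cmod[of "Complex s y"] by auto
  moreover have "min s 1 * (1 + \<bar>y\<bar>) \<le> s + \<bar>y\<bar>"
  proof -
    have "min s 1 * \<bar>y\<bar> \<le> 1 * \<bar>y\<bar>" by (intro mult_right_mono) auto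
    then show ?thesis by (simp add: distrib_left)
  qed
  ultimately show ?thesis by linarith
qed

lemma vertical_bound_inverse_Complex:
  assumes s: "s > 0" and \<delta>: "\<delta> \<ge> 0"
  shows "vertical_bound (\<lambda>y. of_real (norm (Complex s y) powr (- \<delta>))) (- \<delta>) 0"
proof (rule vertical_boundI)
  fix y
  have m: "min s 1 / 2 > 0" using s by simp
  have "norm (Complex s y) powr (- \<delta>) \<le> (min s 1 / 2 * (1 + \<bar>y\<bar>)) powr (- \<delta>)"
    using m \<delta> by (intro powr_mono2' norm_Complex_ge s) auto
  also have "\<dots> = (min s 1 / 2) powr (- \<delta>) * (1 + \<bar>y\<bar>) powr (- \<delta>)"
    by (rule powr_mult)
  finally show "norm (complex_of_real (norm (Complex s y) powr (- \<delta>))) \<le>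
      (min s 1 / 2) powr (- \<delta>) * ((1 + \<bar>y\<bar>) powr (- \<delta>) * exp (0 * \<bar>y\<bar>))" by simp
qed

text \<open>
  This is \<open>ln (norm (Complex s y) / s)\<close>, the logarithm of one factor in the product for
  \<open>norm (rGamma (Complex s y)) / rGamma s\<close>.
\<close>

lemma convex_on_ln_ratio:
  "convex_on {0<..} (\<lambda>s. ln (s\<^sup>2 + y\<^sup>2) / 2 - ln s :: real)"
proof (rule f''_ge0_imp_convex)
  fix s :: real assume s: "s \<in> {0<..}"
  then have pos: "s\<^sup>2 + y\<^sup>2 > 0" by (simp add: add_pos_nonneg)
  show "((\<lambda>s. ln (s\<^sup>2 + y\<^sup>2) / 2 - ln s) has_real_derivative s / (s\<^sup>2 + y\<^sup>2) - 1 / s) (at s)"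
  proof -
    have "((\<lambda>s. ln (s\<^sup>2 + y\<^sup>2)) has_real_derivative 2 * s / (s\<^sup>2 + y\<^sup>2)) (at s)"
      using pos by (auto intro!: derivative_eq_intros)
    from DERIV_diff[OF DERIV_cdivide[OF this, of 2] DERIV_ln_divide[of s]] s
    have "((\<lambda>s. ln (s\<^sup>2 + y\<^sup>2) / 2 - ln s) has_real_derivative 2 * s / (s\<^sup>2 + y\<^sup>2) / 2 - 1 / s) (at s)"
      by (simp only: greaterThan_iff)
    moreover have "2 * s / X / 2 = s / X" for X :: real by simp
    ultimately show ?thesis by (simp only:)
  qed
  show "((\<lambda>s. s / (s\<^sup>2 + y\<^sup>2) - 1 / s) has_real_derivative (y\<^sup>2 - s\<^sup>2) / (s\<^sup>2 + y\<^sup>2)\<^sup>2 + 1 / s\<^sup>2) (at s)"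
    using s pos by (auto intro!: derivative_eq_intros simp: field_simps power2_eq_square)
  have "s\<^sup>2 * (s\<^sup>2 - y\<^sup>2) \<le> (s\<^sup>2 + y\<^sup>2)\<^sup>2"
  proof -
    have "(s\<^sup>2 + y\<^sup>2)\<^sup>2 - s\<^sup>2 * (s\<^sup>2 - y\<^sup>2) = (y\<^sup>2)\<^sup>2 + 3 * (s * y)\<^sup>2"
      by (simp add: power2_eq_square algebra_simps)
    also have "\<dots> \<ge> 0" by (intro add_nonneg_nonneg) auto
    finally show ?thesis by simp
  qed
  then show "(y\<^sup>2 - s\<^sup>2) / (s\<^sup>2 + y\<^sup>2)\<^sup>2 + 1 / s\<^sup>2 \<ge> 0"
    using s pos by (simp add: divide_simps algebra_simps)
qed auto

text \<open>
  By the limit formula, \<open>norm (rGamma (Complex s y)) / rGamma s\<close> is the limit of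
  \<open>exp (\<Sum>k\<le>n. \<psi> y (s + k))\<close> with \<open>\<psi> y\<close> convex. Convexity bounds the shifted sum by the original one plus
  \<open>\<delta>\<close> times a telescoping sum, whose upper end tends to 0. Thus the modulus is log-convex in
  the real part up to elementary factors, so interpolation between vertical lines loses only constants.
\<close>

lemma rGamma_vertical_shift:
  assumes s: "s > 0" and \<delta>: "0 \<le> \<delta>" "\<delta> \<le> 1"
  obtains C where "C > 0"
    "\<And>y. norm (rGamma (Complex (s + \<delta>) y)) \<le> C * norm (rGamma (Complex s y)) * norm (Complex s y) powr (- \<delta>)"
proof -
  define \<psi> where "\<psi> y s = ln (s\<^sup>2 + y\<^sup>2) / 2 - ln s" for y s :: real
  have \<psi>: "exp (\<psi> y s) = norm (Complex s y) / s" if "s > 0" for y s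
  proof -
    have pos: "s\<^sup>2 + y\<^sup>2 > 0" using that by (simp add: add_pos_nonneg)
    then have "ln (s\<^sup>2 + y\<^sup>2) / 2 = ln (sqrt (s\<^sup>2 + y\<^sup>2))" by (simp add: ln_sqrt)
    then show ?thesis using that pos by (simp add: \<psi>_def exp_diff cmod_def)
  qed
  have ratio: "norm (rGamma_series (Complex s y) n) = rGamma_series s n * exp (\<Sum>k=0..n. \<psi> y (s + real k))"
    if s: "s > 0" for s y n
  proof -
    have "norm (pochhammer (Complex s y) (Suc n)) = (\<Prod>k=0..n. (s + real k) * exp (\<psi> y (s + real k)))"
      unfolding pochhammer_Suc_prod prod_norm[symmetric]
    proof (intro prod.cong refl)
      fix k
      have "Complex s y + of_nat k = Complex (s + real k) y" by (simp add: complex_eq_iff)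
      then show "norm (Complex s y + of_nat k) = (s + real k) * exp (\<psi> y (s + real k))"
        using s by (simp add: \<psi> add_pos_nonneg)
    qed
    also have "\<dots> = pochhammer s (Suc n) * exp (\<Sum>k=0..n. \<psi> y (s + real k))"
      by (simp add: prod.distrib pochhammer_Suc_prod exp_sum)
    finally show ?thesis by (simp add: rGamma_series_def norm_divide norm_mult)
  qed
  have conv: "\<psi> y (s + \<delta>) \<le> \<psi> y s + \<delta> * (\<psi> y (s + 1) - \<psi> y s)" if "s > 0" for y s
  proof -
    have "\<psi> y ((1 - \<delta>) *\<^sub>R s + \<delta> *\<^sub>R (s + 1)) \<le> (1 - \<delta>) * \<psi> y s + \<delta> * \<psi> y (s + 1)"
      unfolding \<psi>_def using \<delta> that by (intro convex_onD[OF convex_on_ln_ratio]) auto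
    then show ?thesis by (simp add: algebra_simps)
  qed
  have sums: "(\<Sum>k=0..n. \<psi> y (s + \<delta> + real k)) \<le>
      (\<Sum>k=0..n. \<psi> y (s + real k)) + \<delta> * (\<psi> y (s + real (Suc n)) - \<psi> y s)" for y n
  proof -
    have "(\<Sum>k=0..n. \<psi> y (s + \<delta> + real k)) \<le>
        (\<Sum>k=0..n. \<psi> y (s + real k) + \<delta> * (\<psi> y (s + real (Suc k)) - \<psi> y (s + real k)))"
      using conv[of "s + real _" y] s by (intro sum_mono) (simp add: add_ac)
    also have "\<dots> = (\<Sum>k=0..n. \<psi> y (s + real k)) + \<delta> * (\<Sum>k=0..n. \<psi> y (s + real (Suc k)) - \<psi> y (s + real k))"
      by (simp add: sum.distrib sum_distrib_left)
    also have "(\<Sum>k=0..n. \<psi> y (s + real (Suc k)) - \<psi> y (s + real k)) = \<psi> y (s + real (Suc n)) - \<psi> y (s + real 0)"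
      by (induction n) auto
    finally show ?thesis by simp
  qed
  have pos: "rGamma s > 0" "rGamma (s + \<delta>) > 0"
    using s \<delta> Gamma_real_pos[of s] Gamma_real_pos[of "s + \<delta>"] by (auto simp: rGamma_inverse_Gamma)
  define C where "C = rGamma (s + \<delta>) / rGamma s * s powr \<delta>"
  show thesis
  proof (rule that[of C])
    show "C > 0" using pos s by (simp add: C_def)
    fix y
    define K where "K = (norm (Complex s y) / s) powr (- \<delta>)"
    have "norm (rGamma_series (Complex (s + \<delta>) y) n) * rGamma_series s n \<le>
        rGamma_series (s + \<delta>) n * (norm (rGamma_series (Complex s y) n) * (exp (\<delta> * \<psi> y (s + real (Suc n))) * K))" for n
    proof -
      have "exp (- \<delta> * \<psi> y s) = exp (\<psi> y s) powr (- \<delta>)"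
        by (simp add: powr_def)
      then have K: "exp (- \<delta> * \<psi> y s) = K" using \<psi>[OF s] by (simp add: K_def)
      have nonneg: "rGamma_series x n \<ge> 0" if "x > 0" for x :: real
        using that by (simp add: rGamma_series_def pochhammer_nonneg)
      have "norm (rGamma_series (Complex (s + \<delta>) y) n) * rGamma_series s n =
          rGamma_series (s + \<delta>) n * rGamma_series s n * exp (\<Sum>k=0..n. \<psi> y (s + \<delta> + real k))"
        using s \<delta> by (subst ratio) auto
      also have "\<dots> \<le> rGamma_series (s + \<delta>) n * rGamma_series s n *
          exp ((\<Sum>k=0..n. \<psi> y (s + real k)) + \<delta> * (\<psi> y (s + real (Suc n)) - \<psi> y s))"
        using s \<delta> nonneg sums by (intro mult_left_mono) auto
      also have "(\<Sum>k=0..n. \<psi> y (s + real k)) + \<delta> * (\<psi> y (s + real (Suc n)) - \<psi> y s) =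
          (\<Sum>k=0..n. \<psi> y (s + real k)) + (\<delta> * \<psi> y (s + real (Suc n)) + - \<delta> * \<psi> y s)"
        by (simp add: algebra_simps)
      also have "rGamma_series (s + \<delta>) n * rGamma_series s n * exp \<dots> =
          rGamma_series (s + \<delta>) n * (norm (rGamma_series (Complex s y) n) * (exp (\<delta> * \<psi> y (s + real (Suc n))) * K))"
        unfolding exp_add K ratio[OF s] by (simp only: mult_ac)
      finally show ?thesis .
    qed
    moreover have "(\<lambda>n. exp (\<delta> * \<psi> y (s + real (Suc n)))) \<longlonglongrightarrow> 1"
    proof -
      have lim: "(\<lambda>n. (\<bar>y\<bar> / (s + real (Suc n)))) \<longlonglongrightarrow> 0"
        by (intro tendsto_divide_0[OF tendsto_const] filterlim_at_top_imp_at_infinity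
            filterlim_tendsto_add_at_top[OF tendsto_const] filterlim_compose[OF filterlim_real_sequentially filterlim_Suc])
      have "(\<lambda>n. exp (\<psi> y (s + real (Suc n)))) \<longlonglongrightarrow> 1"
      proof (rule tendsto_sandwich)
        show "eventually (\<lambda>n. 1 \<le> exp (\<psi> y (s + real (Suc n)))) sequentially"
        proof (intro always_eventually allI)
          fix n
          show "1 \<le> exp (\<psi> y (s + real (Suc n)))"
            using \<psi>[of "s + real (Suc n)" y] s abs_Re_le_cmod[of "Complex (s + real (Suc n)) y"]
            by (simp add: le_divide_eq)
        qed
        show "eventually (\<lambda>n. exp (\<psi> y (s + real (Suc n))) \<le> 1 + \<bar>y\<bar> / (s + real (Suc n))) sequentially"
        proof (intro always_eventually allI)
          fix n
          have "norm (Complex (s + real (Suc n)) y) \<le> (s + real (Suc n)) + \<bar>y\<bar>"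
            using cmod_le[of "Complex (s + real (Suc n)) y"] s by simp
          then have "norm (Complex (s + real (Suc n)) y) / (s + real (Suc n)) \<le> ((s + real (Suc n)) + \<bar>y\<bar>) / (s + real (Suc n))"
            using s by (intro divide_right_mono) auto
          then show "exp (\<psi> y (s + real (Suc n))) \<le> 1 + \<bar>y\<bar> / (s + real (Suc n))"
            using \<psi>[of "s + real (Suc n)" y] s by (simp add: add_divide_distrib)
        qed
        show "(\<lambda>n. 1 + \<bar>y\<bar> / (s + real (Suc n))) \<longlonglongrightarrow> 1"
          using tendsto_add[OF tendsto_const[of 1] lim] by simp
      qed auto
      then have "(\<lambda>n. exp (\<psi> y (s + real (Suc n))) powr \<delta>) \<longlonglongrightarrow> 1 powr \<delta>"
        by (intro tendsto_powr tendsto_const) auto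
      then show ?thesis by (simp add: powr_def)
    qed
    ultimately have "norm (rGamma (Complex (s + \<delta>) y)) * rGamma s \<le>
        rGamma (s + \<delta>) * (norm (rGamma (Complex s y)) * (1 * K))"
      by (intro LIMSEQ_le[OF tendsto_mult[OF tendsto_norm[OF rGamma_series_LIMSEQ] rGamma_series_LIMSEQ]
          tendsto_mult[OF rGamma_series_LIMSEQ tendsto_mult[OF tendsto_norm[OF rGamma_series_LIMSEQ]
            tendsto_mult[OF _ tendsto_const]]]]) auto
    then have "norm (rGamma (Complex (s + \<delta>) y)) \<le>
        rGamma (s + \<delta>) * (norm (rGamma (Complex s y)) * K) / rGamma s"
      using pos by (simp add: pos_le_divide_eq)
    also have "K = norm (Complex s y) powr (- \<delta>) * s powr \<delta>"
      using s by (simp add: K_def powr_divide powr_minus_divide)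
    also have "rGamma (s + \<delta>) * (norm (rGamma (Complex s y)) * (norm (Complex s y) powr (- \<delta>) * s powr \<delta>)) / rGamma s =
        C * norm (rGamma (Complex s y)) * norm (Complex s y) powr (- \<delta>)"
    proof -
      have "A * (N * (M * t)) / B = A / B * t * N * M" for A B M N t :: real by simp
      then show ?thesis by (simp only: C_def)
    qed
    finally show "norm (rGamma (Complex (s + \<delta>) y)) \<le>
        C * norm (rGamma (Complex s y)) * norm (Complex s y) powr (- \<delta>)" .
  qed
qed

lemma vertical_bound_cong:
  "vertical_bound f p q \<Longrightarrow> (\<And>y. norm (f y) = norm (h y)) \<Longrightarrow> p = p' \<Longrightarrow> q = q' \<Longrightarrow> vertical_bound h p' q'"
  by (simp add: vertical_bound_def)

text \<open>
  The reflection formula evaluates the modulus exactly here because conjugation and reflection agree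
  on the line with real part 1/2.
\<close>

lemma norm_Gamma_half:
  "(norm (Gamma (Complex (1/2) y)))\<^sup>2 = pi / cosh (pi * y)"
proof -
  let ?z = "Complex (1/2) y"
  have "of_real ((norm (Gamma ?z))\<^sup>2) = Gamma ?z * Gamma (cnj ?z)"
    by (simp only: complex_norm_square cnj_Gamma)
  also have "cnj ?z = 1 - ?z" by (simp add: complex_eq_iff)
  also have "Gamma ?z * Gamma (1 - ?z) = of_real pi / sin (of_real pi * ?z)"
    by (rule Gamma_reflection_complex)
  also have "of_real pi * ?z = of_real (pi / 2) + \<i> * of_real (pi * y)" by (simp add: complex_eq_iff)
  also have "sin (of_real (pi / 2) + \<i> * of_real (pi * y)) = of_real (cosh (pi * y))"
  proof -
    have "cos (\<i> * complex_of_real x) = of_real (cosh x)" for x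
      unfolding cosh_conv_cos[symmetric] cosh_field_def by (simp add: exp_of_real exp_minus)
    then show ?thesis by (simp only: sin_add sin_of_real cos_of_real) simp
  qed
  finally have "complex_of_real ((norm (Gamma ?z))\<^sup>2) = of_real (pi / cosh (pi * y))" by simp
  then show ?thesis by (simp only: of_real_eq_iff)
qed

lemma vertical_bound_Gamma_half: "vertical_bound (\<lambda>y. Gamma (Complex (1/2) y)) 0 (- pi / 2)"
proof (rule vertical_boundI)
  fix y
  have "exp (pi * \<bar>y\<bar>) / 2 \<le> cosh (pi * \<bar>y\<bar>)" by (simp add: cosh_def)
  also have "cosh (pi * \<bar>y\<bar>) = cosh (pi * y)" by (simp add: abs_if)
  finally have "pi / cosh (pi * y) \<le> pi / (exp (pi * \<bar>y\<bar>) / 2)"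
    by (intro divide_left_mono) auto
  also have "\<dots> = (sqrt (2 * pi) * exp (- pi / 2 * \<bar>y\<bar>))\<^sup>2"
  proof -
    have "(exp (- pi / 2 * \<bar>y\<bar>))\<^sup>2 = exp (2 * (- pi / 2 * \<bar>y\<bar>))" by (rule exp_double[symmetric])
    also have "2 * (- pi / 2 * \<bar>y\<bar>) = - (pi * \<bar>y\<bar>)" by simp
    finally show ?thesis by (simp only: power_mult_distrib exp_minus) (simp add: field_simps)
  qed
  finally have "(norm (Gamma (Complex (1/2) y)))\<^sup>2 \<le> (sqrt (2 * pi) * exp (- pi / 2 * \<bar>y\<bar>))\<^sup>2"
    unfolding norm_Gamma_half .
  then have "norm (Gamma (Complex (1/2) y)) \<le> sqrt (2 * pi) * exp (- pi / 2 * \<bar>y\<bar>)"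
    by (rule power2_le_imp_le) simp
  then show "norm (Gamma (Complex (1/2) y)) \<le> sqrt (2 * pi) * ((1 + \<bar>y\<bar>) powr 0 * exp (- pi / 2 * \<bar>y\<bar>))"
    by simp
qed

lemma vertical_bound_rGamma_half: "vertical_bound (\<lambda>y. rGamma (Complex (1/2) y)) 0 (pi / 2)"
proof (rule vertical_boundI)
  fix y
  have "cosh (pi * y) = cosh (pi * \<bar>y\<bar>)" by (simp add: abs_if)
  also have "\<dots> \<le> exp (pi * \<bar>y\<bar>)" by (simp add: cosh_def)
  finally have "cosh (pi * y) / pi \<le> exp (pi * \<bar>y\<bar>) / pi" by (intro divide_right_mono) auto
  moreover have "(norm (rGamma (Complex (1/2) y)))\<^sup>2 = cosh (pi * y) / pi"
    using norm_Gamma_half[of y] by (simp add: rGamma_inverse_Gamma norm_inverse power_inverse)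
  moreover have "exp (pi * \<bar>y\<bar>) / pi = ((1 / sqrt pi) * exp (pi / 2 * \<bar>y\<bar>))\<^sup>2"
  proof -
    have "(exp (pi / 2 * \<bar>y\<bar>))\<^sup>2 = exp (2 * (pi / 2 * \<bar>y\<bar>))" by (rule exp_double[symmetric])
    also have "2 * (pi / 2 * \<bar>y\<bar>) = pi * \<bar>y\<bar>" by simp
    finally show ?thesis by (simp only: power_mult_distrib) (simp add: power_divide)
  qed
  ultimately have "(norm (rGamma (Complex (1/2) y)))\<^sup>2 \<le> ((1 / sqrt pi) * exp (pi / 2 * \<bar>y\<bar>))\<^sup>2"
    by simp
  then have "norm (rGamma (Complex (1/2) y)) \<le> (1 / sqrt pi) * exp (pi / 2 * \<bar>y\<bar>)"
    by (rule power2_le_imp_le) simp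
  then show "norm (rGamma (Complex (1/2) y)) \<le> (1 / sqrt pi) * ((1 + \<bar>y\<bar>) powr 0 * exp (pi / 2 * \<bar>y\<bar>))"
    by simp
qed

lemma Complex_nonpole: "s > 0 \<Longrightarrow> Complex s y \<notin> \<int>\<^sub>\<le>\<^sub>0"
  by (auto elim!: nonpos_Ints_cases simp: complex_eq_iff)

text \<open>
  The functional equation carries the exact value from real part 1/2 to \<open>1/2 + k\<close>. An upper bound in
  between comes from the half-integral line to the right, since a shift by \<open>\<delta>\<close> multiplies the modulus
  by at least a constant times \<open>norm (Complex s y) powr \<delta>\<close>.
\<close>

lemma vertical_bound_Gamma_Complex:
  assumes s: "s > 0"
  shows "vertical_bound (\<lambda>y. Gamma (Complex s y)) (s - 1/2) (- pi / 2)"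
proof -
  have half: "vertical_bound (\<lambda>y. Gamma (Complex (1/2 + real k) y)) (real k) (- pi / 2)" for k
  proof (induction k)
    case 0
    then show ?case using vertical_bound_Gamma_half by simp
  next
    case (Suc k)
    have eq: "Gamma (Complex (1/2 + real (Suc k)) y) = Complex (1/2 + real k) y * Gamma (Complex (1/2 + real k) y)" for y
    proof -
      have e: "Complex (1/2 + real (Suc k)) y = Complex (1/2 + real k) y + 1" by (simp add: complex_eq_iff)
      show ?thesis unfolding e by (intro Gamma_plus1 Complex_nonpole) simp
    qed
    show ?case
    proof (rule vertical_bound_cong[OF vertical_bound_mult[OF vertical_bound_Complex[of "1/2 + real k"] Suc.IH]])
      show "norm (Complex (1/2 + real k) y * Gamma (Complex (1/2 + real k) y)) = norm (Gamma (Complex (1/2 + real (Suc k)) y))" for y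
        by (simp only: eq)
    qed simp_all
  qed
  define k where "k = nat \<lceil>s - 1/2\<rceil>"
  define \<delta> where "\<delta> = 1/2 + real k - s"
  have \<delta>: "0 \<le> \<delta>" "\<delta> \<le> 1" using s unfolding \<delta>_def k_def by linarith+
  obtain C where C: "C > 0" "\<And>y. norm (rGamma (Complex (s + \<delta>) y)) \<le> C * norm (rGamma (Complex s y)) * norm (Complex s y) powr (- \<delta>)"
    using rGamma_vertical_shift[OF s \<delta>] by blast
  have le: "norm (Gamma (Complex s y)) \<le> C * norm (Gamma (Complex (1/2 + real k) y) * of_real (norm (Complex s y) powr (- \<delta>)))" for y
  proof -
    have pos: "norm (rGamma (Complex s y)) > 0" "norm (rGamma (Complex (s + \<delta>) y)) > 0"
      using Complex_nonpole s \<delta> by (auto simp: rGamma_eq_zero_iff add_pos_nonneg)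
    have "norm (Gamma (Complex s y)) \<le> C * (norm (Gamma (Complex (s + \<delta>) y)) * norm (Complex s y) powr (- \<delta>))"
    proof -
      have "inverse a \<le> C * (inverse b * n)" if "b \<le> C * a * n" "a > 0" "b > 0" for a b n
        using that by (simp add: field_simps)
      from this[OF C(2)] pos show ?thesis unfolding Gamma_def norm_inverse by blast
    qed
    moreover have "s + \<delta> = 1/2 + real k" by (simp add: \<delta>_def)
    ultimately show ?thesis by (simp only: norm_mult norm_of_real abs_of_nonneg[OF powr_ge_zero])
  qed
  have "vertical_bound (\<lambda>y. Gamma (Complex (1/2 + real k) y) * of_real (norm (Complex s y) powr (- \<delta>))) (s - 1/2) (- pi / 2)"
    by (rule vertical_bound_cong[OF vertical_bound_mult[OF half[of k] vertical_bound_inverse_Complex[OF s \<delta>(1)]]])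
       (simp_all add: \<delta>_def)
  from vertical_bound_mono[OF this less_imp_le[OF C(1)] le] show ?thesis .
qed

text \<open>
  Here the half-integral line to the left serves as the starting point. Real parts below 1/2 are
  reached by the functional equation \<open>rGamma z = z * rGamma (z + 1)\<close>, which is harmless at the poles of
  the Gamma function.
\<close>

lemma vertical_bound_rGamma_Complex:
  "vertical_bound (\<lambda>y. rGamma (Complex s y)) (1/2 - s) (pi / 2)"
proof -
  have half: "vertical_bound (\<lambda>y. rGamma (Complex (1/2 + real k) y)) (- real k) (pi / 2)" for k
  proof (induction k)
    case 0
    then show ?case using vertical_bound_rGamma_half by simp
  next
    case (Suc k)
    have eq: "norm (rGamma (Complex (1/2 + real (Suc k)) y)) =
        norm (rGamma (Complex (1/2 + real k) y) * of_real (norm (Complex (1/2 + real k) y) powr (- 1)))" for y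
    proof -
      have "Complex (1/2 + real (Suc k)) y = Complex (1/2 + real k) y + 1" by (simp add: complex_eq_iff)
      then have "Complex (1/2 + real k) y * rGamma (Complex (1/2 + real (Suc k)) y) = rGamma (Complex (1/2 + real k) y)"
        by (simp only: rGamma_plus1)
      from arg_cong[OF this, of norm]
      have "norm (Complex (1/2 + real k) y) * norm (rGamma (Complex (1/2 + real (Suc k)) y)) = norm (rGamma (Complex (1/2 + real k) y))"
        by (simp only: norm_mult)
      moreover have "norm (Complex (1/2 + real k) y) > 0"
        using complex_Re_le_cmod[of "Complex (1/2 + real k) y"] by (simp only: complex.sel)
      moreover have "n > 0 \<Longrightarrow> n * R = r \<Longrightarrow> R = r * inverse n" for n r R :: real
        by auto
      ultimately have "norm (rGamma (Complex (1/2 + real (Suc k)) y)) =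
          norm (rGamma (Complex (1/2 + real k) y)) * inverse (norm (Complex (1/2 + real k) y))"
        by blast
      moreover have "norm (complex_of_real (x powr (- 1))) = inverse x" if "x \<ge> 0" for x
        using that by (simp add: powr_minus norm_inverse)
      ultimately show ?thesis by (simp only: norm_mult norm_ge_zero)
    qed
    show ?case
    proof (rule vertical_bound_cong[OF vertical_bound_mult[OF Suc.IH vertical_bound_inverse_Complex[of "1/2 + real k" 1]]])
      show "norm (rGamma (Complex (1/2 + real k) y) * of_real (norm (Complex (1/2 + real k) y) powr (- 1))) =
          norm (rGamma (Complex (1/2 + real (Suc k)) y))" for y
        by (rule eq[symmetric])
    qed simp_all
  qed
  have large: "vertical_bound (\<lambda>y. rGamma (Complex s y)) (1/2 - s) (pi / 2)" if "s \<ge> 1/2" for s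
  proof -
    define k where "k = nat \<lfloor>s - 1/2\<rfloor>"
    define \<delta> where "\<delta> = s - 1/2 - real k"
    have \<delta>: "0 \<le> \<delta>" "\<delta> \<le> 1" using that unfolding \<delta>_def k_def by linarith+
    have s0: "1/2 + real k > 0" by simp
    obtain C where C: "C > 0" "\<And>y. norm (rGamma (Complex (1/2 + real k + \<delta>) y)) \<le>
        C * norm (rGamma (Complex (1/2 + real k) y)) * norm (Complex (1/2 + real k) y) powr (- \<delta>)"
      using rGamma_vertical_shift[OF s0 \<delta>] by blast
    have le: "norm (rGamma (Complex s y)) \<le> C * norm (rGamma (Complex (1/2 + real k) y) * of_real (norm (Complex (1/2 + real k) y) powr (- \<delta>)))" for y
    proof -
      have "1/2 + real k + \<delta> = s" by (simp add: \<delta>_def)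
      then show ?thesis
        using C(2)[of y] by (simp only: norm_mult norm_of_real abs_of_nonneg[OF powr_ge_zero] mult.assoc)
    qed
    have "vertical_bound (\<lambda>y. rGamma (Complex (1/2 + real k) y) * of_real (norm (Complex (1/2 + real k) y) powr (- \<delta>))) (1/2 - s) (pi / 2)"
      by (rule vertical_bound_cong[OF vertical_bound_mult[OF half[of k] vertical_bound_inverse_Complex[OF s0 \<delta>(1)]]])
         (simp_all add: \<delta>_def)
    from vertical_bound_mono[OF this less_imp_le[OF C(1)] le] show ?thesis .
  qed
  have down: "vertical_bound (\<lambda>y. rGamma (Complex (s' - real k) y)) (1/2 - (s' - real k)) (pi / 2)" if "s' \<ge> 1/2" for s' k
  proof (induction k)
    case 0
    then show ?case using large[OF that] by simp
  next
    case (Suc k)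
    have eq: "rGamma (Complex (s' - real (Suc k)) y) = Complex (s' - real (Suc k)) y * rGamma (Complex (s' - real k) y)" for y
    proof -
      have "Complex (s' - real k) y = Complex (s' - real (Suc k)) y + 1" by (simp add: complex_eq_iff)
      then show ?thesis by (simp only: rGamma_plus1)
    qed
    show ?case
      by (rule vertical_bound_cong[OF vertical_bound_mult[OF vertical_bound_Complex[of "s' - real (Suc k)"] Suc.IH]])
         (simp_all add: eq del: of_nat_Suc)
  qed
  define k where "k = nat \<lceil>1/2 - s\<rceil>"
  have "s + real k \<ge> 1/2" unfolding k_def by linarith
  from down[OF this, of k] show ?thesis by simp
qed

lemma affine_eq_Complex: "c + of_real D * (\<i> * of_real y) = Complex (Re c) (Im c + D * y)"
  by (simp add: complex_eq_iff)

lemma vertical_bound_Gamma: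
  assumes "Re c > 0" "D \<noteq> 0"
  shows "vertical_bound (\<lambda>y. Gamma (c + of_real D * (\<i> * of_real y))) (Re c - 1/2) (- (pi / 2) * \<bar>D\<bar>)"
  unfolding affine_eq_Complex
  using vertical_bound_affine[OF vertical_bound_Gamma_Complex[OF assms(1)] assms(2), of "Im c"] by simp

lemma vertical_bound_rGamma:
  assumes "D \<noteq> 0"
  shows "vertical_bound (\<lambda>y. rGamma (c + of_real D * (\<i> * of_real y))) (1/2 - Re c) (pi / 2 * \<bar>D\<bar>)"
  unfolding affine_eq_Complex
  using vertical_bound_affine[OF vertical_bound_rGamma_Complex[of "Re c"] assms, of "Im c"] by simp

section \<open>The integrand of the I-function on its contour\<close>

lemma norm_Gamma_pow:
  assumes L: "is_gamma_branch L" and s: "Re s = 0"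
  shows "norm (Gamma_pow L (c, D, \<kappa>) s) = norm (Gamma (c + of_real D * s)) powr \<kappa>"
proof (cases "c + of_real D * s \<in> \<int>\<^sub>\<le>\<^sub>0")
  case True
  then have "Gamma (c + of_real D * s) = 0" by (simp add: Gamma_def rGamma_eq_zero_iff)
  then show ?thesis using True by (simp add: Gamma_pow_def)
next
  case False
  then have "exp (L (c, D, \<kappa>) s) = Gamma (c + of_real D * s)"
    using L s unfolding is_gamma_branch_def Let_def by blast
  then have "norm (Gamma (c + of_real D * s)) = exp (Re (L (c, D, \<kappa>) s))"
    by (metis norm_exp_eq_Re)
  then show ?thesis using False by (simp add: Gamma_pow_def powr_def)
qed

lemma norm_inverse_Gamma_pow:
  assumes L: "is_gamma_branch L" and s: "Re s = 0"
  shows "norm (inverse (Gamma_pow L (c, D, \<kappa>) s)) = norm (rGamma (c + of_real D * s)) powr \<kappa>"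
  by (simp only: norm_inverse norm_Gamma_pow[OF L s] rGamma_inverse_Gamma inverse_powr)

lemma Gamma_pow_1:
  assumes L: "is_gamma_branch L" and s: "Re s = 0"
  shows "Gamma_pow L (c, D, 1) s = Gamma (c + of_real D * s)"
proof (cases "c + of_real D * s \<in> \<int>\<^sub>\<le>\<^sub>0")
  case True
  then have "Gamma (c + of_real D * s) = 0" by (simp add: Gamma_def rGamma_eq_zero_iff)
  then show ?thesis using True by (simp add: Gamma_pow_def)
next
  case False
  then show ?thesis
    using L s unfolding is_gamma_branch_def Let_def by (simp add: Gamma_pow_def)
qed

lemma vertical_bound_Gamma_pow:
  assumes "is_gamma_branch L" "Re c > 0" "D \<noteq> 0" "\<kappa> \<ge> 0"
  shows "vertical_bound (\<lambda>y. Gamma_pow L (c, D, \<kappa>) (\<i> * of_real y)) (\<kappa> * (Re c - 1/2)) (\<kappa> * (- (pi / 2) * \<bar>D\<bar>))"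
  using vertical_bound_powr[OF vertical_bound_Gamma[OF assms(2,3)] assms(4)] norm_Gamma_pow[OF assms(1)] by simp

lemma vertical_bound_inverse_Gamma_pow:
  assumes "is_gamma_branch L" "D \<noteq> 0" "\<kappa> \<ge> 0"
  shows "vertical_bound (\<lambda>y. inverse (Gamma_pow L (c, D, \<kappa>) (\<i> * of_real y))) (\<kappa> * (1/2 - Re c)) (\<kappa> * (pi / 2 * \<bar>D\<bar>))"
  by (rule vertical_bound_powr[OF vertical_bound_rGamma[OF assms(2)] assms(3)])
     (simp only: norm_inverse_Gamma_pow[OF assms(1)] Re_i_times Im_complex_of_real minus_zero order_refl)

lemma vertical_bound_prod_list:
  assumes "\<And>x. x \<in> set xs \<Longrightarrow> vertical_bound (f x) (p x) (q x)"
  shows "vertical_bound (\<lambda>y. \<Prod>x\<leftarrow>xs. f x y) (\<Sum>x\<leftarrow>xs. p x) (\<Sum>x\<leftarrow>xs. q x)"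
  using assms
proof (induction xs)
  case (Cons x xs)
  then show ?case using vertical_bound_mult[of "f x" "p x" "q x"] by simp
qed (simp add: vertical_bound_1)

lemma inverse_prod_list: "inverse (\<Prod>x\<leftarrow>xs. f x) = (\<Prod>x\<leftarrow>xs. inverse (f x :: complex))"
  by (induction xs) auto

text \<open>
  Separation is stated for all poles; the pole of each family that is nearest to the contour carries
  the information.
\<close>

lemma I_separated_Re:
  assumes "I_params m n us ls" "I_separated m n us ls"
  shows "(b, B, \<beta>) \<in> set (take m ls) \<Longrightarrow> Re b > 0"
    and "(a, A, \<alpha>) \<in> set (take n us) \<Longrightarrow> Re a < 1"
proof -
  assume x: "(b, B, \<beta>) \<in> set (take m ls)"
  then have B: "B > 0" using assms(1) in_set_takeD[OF x] unfolding I_params_def by blast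
  have "b + of_real B * (- b / of_real B) \<in> \<int>\<^sub>\<le>\<^sub>0" using B by simp
  then have "Re (- b / of_real B) < 0" using assms(2) x unfolding I_separated_def by blast
  then show "Re b > 0" using B by (simp add: zero_less_divide_iff)
next
  assume x: "(a, A, \<alpha>) \<in> set (take n us)"
  then have A: "A > 0" using assms(1) in_set_takeD[OF x] unfolding I_params_def by blast
  have "1 - a - of_real A * ((1 - a) / of_real A) \<in> \<int>\<^sub>\<le>\<^sub>0" using A by simp
  then have "Re ((1 - a) / of_real A) > 0" using assms(2) x unfolding I_separated_def by blast
  then show "Re a < 1" using A by (simp add: zero_less_divide_iff)
qed

lemma sum_list_take_drop: "(\<Sum>x\<leftarrow>take n xs. f x) + (\<Sum>x\<leftarrow>drop n xs. f x) = (\<Sum>x\<leftarrow>xs. f x :: real)"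
  by (simp flip: sum_list_append map_append)

text \<open>
  Numerator factors have no pole on the contour, by separation, and are bounded through \<open>Gamma\<close>;
  denominator factors may meet poles and are bounded through \<open>rGamma\<close>. The exponents add up to \<open>\<Omega>\<close>, and
  the exponential rates to \<open>- \<pi> \<Delta> / 2\<close>.
\<close>

theorem vertical_bound_I_chi:
  assumes L: "is_gamma_branch L" and par: "I_params m n us ls" and sep: "I_separated m n us ls"
  shows "vertical_bound (\<lambda>y. I_chi L m n us ls (\<i> * of_real y)) (I_Omega us ls) (- (pi / 2) * I_Delta m n us ls)"
proof -
  have pos_l: "B > 0 \<and> \<beta> > 0" if "(b, B, \<beta>) \<in> set (take m ls) \<or> (b, B, \<beta>) \<in> set (drop m ls)" for b B \<beta>
  proof -
    have "\<forall>(b, B, \<beta>)\<in>set ls. B > 0 \<and> \<beta> > 0" using par unfolding I_params_def by blast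
    moreover have "(b, B, \<beta>) \<in> set ls" using that by (auto dest: in_set_takeD in_set_dropD)
    ultimately show ?thesis by blast
  qed
  have pos_u: "A > 0 \<and> \<alpha> > 0" if "(a, A, \<alpha>) \<in> set (take n us) \<or> (a, A, \<alpha>) \<in> set (drop n us)" for a A \<alpha>
  proof -
    have "\<forall>(a, A, \<alpha>)\<in>set us. A > 0 \<and> \<alpha> > 0" using par unfolding I_params_def by blast
    moreover have "(a, A, \<alpha>) \<in> set us" using that by (auto dest: in_set_takeD in_set_dropD)
    ultimately show ?thesis by blast
  qed
  let ?s = "\<lambda>y. \<i> * complex_of_real y"
  have 1: "vertical_bound (\<lambda>y. \<Prod>x\<leftarrow>take m ls. (\<lambda>(b, B, \<beta>). Gamma_pow L (b, B, \<beta>) (?s y)) x)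
      (\<Sum>x\<leftarrow>take m ls. (\<lambda>(b, B, \<beta>). \<beta> * (Re b - 1/2)) x) (\<Sum>x\<leftarrow>take m ls. (\<lambda>(b, B, \<beta>). - (pi / 2) * (\<beta> * B)) x)"
  proof (rule vertical_bound_prod_list, clarify)
    fix b B \<beta> assume x: "(b, B, \<beta>) \<in> set (take m ls)"
    then show "vertical_bound (\<lambda>y. Gamma_pow L (b, B, \<beta>) (?s y)) (\<beta> * (Re b - 1/2)) (- (pi / 2) * (\<beta> * B))"
      using vertical_bound_Gamma_pow[OF L I_separated_Re(1)[OF par sep x], of B \<beta>] pos_l[of b B \<beta>]
      by (simp add: mult_ac)
  qed
  have 2: "vertical_bound (\<lambda>y. \<Prod>x\<leftarrow>take n us. (\<lambda>(a, A, \<alpha>). Gamma_pow L (1 - a, - A, \<alpha>) (?s y)) x)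
      (\<Sum>x\<leftarrow>take n us. (\<lambda>(a, A, \<alpha>). (1/2 - Re a) * \<alpha>) x) (\<Sum>x\<leftarrow>take n us. (\<lambda>(a, A, \<alpha>). - (pi / 2) * (\<alpha> * A)) x)"
  proof (rule vertical_bound_prod_list, clarify)
    fix a A \<alpha> assume x: "(a, A, \<alpha>) \<in> set (take n us)"
    then show "vertical_bound (\<lambda>y. Gamma_pow L (1 - a, - A, \<alpha>) (?s y)) ((1/2 - Re a) * \<alpha>) (- (pi / 2) * (\<alpha> * A))"
      using vertical_bound_Gamma_pow[OF L, of "1 - a" "- A" \<alpha>] I_separated_Re(2)[OF par sep x] pos_u[of a A \<alpha>]
      by (simp add: mult_ac)
  qed
  have 3: "vertical_bound (\<lambda>y. \<Prod>x\<leftarrow>drop m ls. (\<lambda>(b, B, \<beta>). inverse (Gamma_pow L (1 - b, - B, \<beta>) (?s y))) x)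
      (\<Sum>x\<leftarrow>drop m ls. (\<lambda>(b, B, \<beta>). \<beta> * (Re b - 1/2)) x) (\<Sum>x\<leftarrow>drop m ls. (\<lambda>(b, B, \<beta>). (pi / 2) * (\<beta> * B)) x)"
  proof (rule vertical_bound_prod_list, clarify)
    fix b B \<beta> assume x: "(b, B, \<beta>) \<in> set (drop m ls)"
    then show "vertical_bound (\<lambda>y. inverse (Gamma_pow L (1 - b, - B, \<beta>) (?s y))) (\<beta> * (Re b - 1/2)) ((pi / 2) * (\<beta> * B))"
      using vertical_bound_inverse_Gamma_pow[OF L, of "- B" \<beta> "1 - b"] pos_l[of b B \<beta>]
      by (simp add: mult_ac)
  qed
  have 4: "vertical_bound (\<lambda>y. \<Prod>x\<leftarrow>drop n us. (\<lambda>(a, A, \<alpha>). inverse (Gamma_pow L (a, A, \<alpha>) (?s y))) x)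
      (\<Sum>x\<leftarrow>drop n us. (\<lambda>(a, A, \<alpha>). (1/2 - Re a) * \<alpha>) x) (\<Sum>x\<leftarrow>drop n us. (\<lambda>(a, A, \<alpha>). (pi / 2) * (\<alpha> * A)) x)"
  proof (rule vertical_bound_prod_list, clarify)
    fix a A \<alpha> assume x: "(a, A, \<alpha>) \<in> set (drop n us)"
    then show "vertical_bound (\<lambda>y. inverse (Gamma_pow L (a, A, \<alpha>) (?s y))) ((1/2 - Re a) * \<alpha>) ((pi / 2) * (\<alpha> * A))"
      using vertical_bound_inverse_Gamma_pow[OF L, of A \<alpha> a] pos_u[of a A \<alpha>]
      by (simp add: mult_ac)
  qed
  show ?thesis
  proof (rule vertical_bound_cong[OF vertical_bound_mult[OF vertical_bound_mult[OF 1 2] vertical_bound_mult[OF 3 4]]])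
    show "(\<Sum>x\<leftarrow>take m ls. (\<lambda>(b, B, \<beta>). \<beta> * (Re b - 1/2)) x) + (\<Sum>x\<leftarrow>take n us. (\<lambda>(a, A, \<alpha>). (1/2 - Re a) * \<alpha>) x) +
        ((\<Sum>x\<leftarrow>drop m ls. (\<lambda>(b, B, \<beta>). \<beta> * (Re b - 1/2)) x) + (\<Sum>x\<leftarrow>drop n us. (\<lambda>(a, A, \<alpha>). (1/2 - Re a) * \<alpha>) x))
        = I_Omega us ls"
    proof -
      have "(\<Sum>x\<leftarrow>ls. (\<lambda>(b, B, \<beta>). \<beta> * (Re b - 1/2)) x) = - (\<Sum>x\<leftarrow>ls. (\<lambda>(b, B, \<beta>). (1/2 - Re b) * \<beta>) x)"
        by (induction ls) (auto simp: algebra_simps)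
      then show ?thesis
        using sum_list_take_drop[where n = m and xs = ls and f = "\<lambda>(b, B, \<beta>). \<beta> * (Re b - 1/2)"]
          sum_list_take_drop[where n = n and xs = us and f = "\<lambda>(a, A, \<alpha>). (1/2 - Re a) * \<alpha>"]
        unfolding I_Omega_def by linarith
    qed
    have neg: "(\<Sum>x\<leftarrow>xs. (\<lambda>(b, B, \<beta>). - (pi / 2) * (\<beta> * B)) x) = - (pi / 2) * (\<Sum>x\<leftarrow>xs. (\<lambda>(b, B, \<beta>). \<beta> * B) x)"
      and plus: "(\<Sum>x\<leftarrow>xs. (\<lambda>(b, B, \<beta>). (pi / 2) * (\<beta> * B)) x) = (pi / 2) * (\<Sum>x\<leftarrow>xs. (\<lambda>(b, B, \<beta>). \<beta> * B) x)"
      for xs :: "triple list"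
      by (induction xs) (auto simp: algebra_simps)
    show "(\<Sum>x\<leftarrow>take m ls. (\<lambda>(b, B, \<beta>). - (pi / 2) * (\<beta> * B)) x) + (\<Sum>x\<leftarrow>take n us. (\<lambda>(a, A, \<alpha>). - (pi / 2) * (\<alpha> * A)) x) +
        ((\<Sum>x\<leftarrow>drop m ls. (\<lambda>(b, B, \<beta>). (pi / 2) * (\<beta> * B)) x) + (\<Sum>x\<leftarrow>drop n us. (\<lambda>(a, A, \<alpha>). (pi / 2) * (\<alpha> * A)) x))
        = - (pi / 2) * I_Delta m n us ls"
      unfolding neg plus I_Delta_def by (simp add: algebra_simps)
  qed (simp add: I_chi_def inverse_prod_list[symmetric] case_prod_beta' divide_inverse)
qed

text \<open>
  The branch \<open>L\<close> is continuous away from the poles; these form a closed set, on which the power is 0.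
\<close>

lemma Gamma_pow_measurable:
  assumes L: "is_gamma_branch L"
  shows "(\<lambda>y. Gamma_pow L t (\<i> * of_real y)) \<in> borel_measurable borel"
proof -
  obtain c D \<kappa> where t: "t = (c, D, \<kappa>)" by (cases t)
  define S where "S = {y::real. c + of_real D * (\<i> * of_real y) \<notin> \<int>\<^sub>\<le>\<^sub>0}"
  have "S = (\<lambda>y. c + of_real D * (\<i> * of_real y)) -` (- \<int>\<^sub>\<le>\<^sub>0)" by (auto simp: S_def)
  moreover have "open ((\<lambda>y. c + of_real D * (\<i> * of_real y)) -` (- \<int>\<^sub>\<le>\<^sub>0))"
    by (intro continuous_open_vimage continuous_intros open_Compl) auto
  ultimately have S: "S \<in> sets borel" by simp
  have "continuous_on S (\<lambda>y. exp (of_real \<kappa> * L (c, D, \<kappa>) (\<i> * of_real y)))"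
  proof (intro continuous_intros)
    have "continuous_on {s. Re s = 0 \<and> c + of_real D * s \<notin> \<int>\<^sub>\<le>\<^sub>0} (L (c, D, \<kappa>))"
      using L unfolding is_gamma_branch_def Let_def by blast
    then show "continuous_on S (\<lambda>y. L (c, D, \<kappa>) (\<i> * of_real y))"
      by (rule continuous_on_compose2) (auto simp: S_def intro!: continuous_intros)
  qed
  from borel_measurable_continuous_on_indicator[OF S this]
  have "(\<lambda>y. indicator S y *\<^sub>R exp (of_real \<kappa> * L (c, D, \<kappa>) (\<i> * of_real y))) \<in> borel_measurable borel" .
  also have "(\<lambda>y. indicator S y *\<^sub>R exp (of_real \<kappa> * L (c, D, \<kappa>) (\<i> * of_real y))) = (\<lambda>y. Gamma_pow L t (\<i> * of_real y))"
    by (auto simp: fun_eq_iff S_def t Gamma_pow_def indicator_def)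
  finally show ?thesis .
qed

lemma prod_list_measurable:
  fixes f :: "'a \<Rightarrow> real \<Rightarrow> complex"
  assumes "\<And>x. f x \<in> borel_measurable M"
  shows "(\<lambda>y. \<Prod>x\<leftarrow>xs. f x y) \<in> borel_measurable M"
  using assms by (induction xs) auto

lemma I_chi_measurable:
  assumes L: "is_gamma_branch L"
  shows "(\<lambda>y. I_chi L m n us ls (\<i> * of_real y)) \<in> borel_measurable borel"
  unfolding I_chi_def split_beta
  by (intro borel_measurable_times borel_measurable_divide prod_list_measurable Gamma_pow_measurable L)

lemma I_chi_insert:
  assumes "m \<le> length ls"
  shows "I_chi L m (n + 1) ((a, A, \<alpha>) # us) (ls @ [(b, B, \<beta>)]) s =
    I_chi L m n us ls s * (Gamma_pow L (1 - a, - A, \<alpha>) s / Gamma_pow L (1 - b, - B, \<beta>) s)"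
  using assms by (simp add: I_chi_def mult_ac)

lemma integrable_one_plus_abs_powr:
  assumes s: "s < (-1 :: real)"
  shows "integrable lborel (\<lambda>y. (1 + \<bar>y\<bar>) powr s)"
proof -
  define h where "h y = (1 + y) powr s * indicator {0..} y" for y :: real
  have h0: "h y \<ge> 0" for y by (simp add: h_def)
  have "(\<integral>\<^sup>+y. ennreal ((1 + y) powr s) * indicator {0..} y \<partial>lborel) = ennreal (0 - (1 + 0) powr (s + 1) / (s + 1))"
  proof (rule nn_integral_FTC_atLeast)
    show "((\<lambda>y. (1 + y) powr (s + 1) / (s + 1)) has_real_derivative (1 + y) powr s) (at y)" if "0 \<le> y" for y
    proof -
      have "((\<lambda>y. 1 + y) has_real_derivative 1) (at y)" by (auto intro!: derivative_eq_intros)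
      from DERIV_cdivide[OF DERIV_fun_powr[OF this, of "s + 1"], of "s + 1"] that s show ?thesis by simp
    qed
    have "((\<lambda>y. (1 + y) powr (s + 1)) \<longlongrightarrow> 0) at_top"
      using s by (intro tendsto_neg_powr filterlim_tendsto_add_at_top[OF tendsto_const filterlim_ident]) auto
    from tendsto_divide[OF this tendsto_const[of "s + 1"]] s
    show "((\<lambda>y. (1 + y) powr (s + 1) / (s + 1)) \<longlongrightarrow> 0) at_top" by simp
  qed auto
  moreover have "(\<integral>\<^sup>+y. ennreal ((1 + y) powr s) * indicator {0..} y \<partial>lborel) = (\<integral>\<^sup>+y. ennreal (h y) \<partial>lborel)"
    by (intro nn_integral_cong) (auto simp: h_def indicator_def)
  ultimately have "(\<integral>\<^sup>+y. ennreal (h y) \<partial>lborel) < \<infinity>" by simp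
  moreover have "h \<in> borel_measurable lborel" unfolding h_def by measurable
  ultimately have h: "integrable lborel h"
    using h0 by (intro integrableI_nonneg) auto
  have "integrable lborel (\<lambda>y. h (0 + (-1) * y))"
    by (rule lborel_integrable_real_affine[OF h]) simp
  then have "integrable lborel (\<lambda>y. h y + h (- y))" using h by simp
  then show ?thesis
  proof (rule Bochner_Integration.integrable_bound)
    show "AE y in lborel. norm ((1 + \<bar>y\<bar>) powr s) \<le> norm (h y + h (- y))"
      by (intro AE_I2) (auto simp: h_def indicator_def)
  qed simp
qed

lemma powr_exp_decay_bounded:
  assumes q: "q < (0 :: real)"
  obtains C where "C > 0" "\<And>y. (1 + \<bar>y\<bar>) powr p * exp (q * \<bar>y\<bar>) \<le> C * (1 + \<bar>y\<bar>) powr (-2)"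
proof -
  \<comment> \<open>the elementary inequality \<open>(x / k)^k \<le> exp x\<close> beats the power \<open>p + 2\<close>\<close>
  define k where "k = nat \<lceil>p + 2\<rceil> + 1"
  have k: "k > 0" "p + 2 \<le> real k" unfolding k_def by (auto, linarith)
  define C where "C = (real k / (- q)) ^ k * exp (- q)"
  have "C > 0" unfolding C_def using q k by (intro mult_pos_pos zero_less_power divide_pos_pos) auto
  moreover have "(1 + \<bar>y\<bar>) powr p * exp (q * \<bar>y\<bar>) \<le> C * (1 + \<bar>y\<bar>) powr (-2)" for y
  proof -
    define z where "z = 1 + \<bar>y\<bar>"
    have z: "z \<ge> 1" by (simp add: z_def)
    have "- q * z / real k \<ge> 0"
      using q z k by (intro divide_nonneg_pos mult_nonneg_nonneg) auto
    then have "(- q * z / real k) ^ k \<le> exp (- q * z / real k) ^ k"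
      using exp_ge_add_one_self[of "- q * z / real k"] by (intro power_mono) linarith+
    also have "\<dots> = exp (- q * z)" using k by (simp flip: exp_of_nat_mult)
    finally have le: "(- q * z / real k) ^ k \<le> exp (- q * z)" .
    have "z ^ k = (real k / (- q)) ^ k * (- q * z / real k) ^ k"
      using q k by (simp flip: power_mult_distrib)
    also have "\<dots> \<le> (real k / (- q)) ^ k * exp (- q * z)"
      using q by (intro mult_left_mono le zero_le_power divide_nonneg_pos) auto
    finally have zk: "z ^ k \<le> (real k / (- q)) ^ k * exp (- q * z)" .
    have "z powr p = z powr (p + 2) * z powr (-2)" by (simp flip: powr_add)
    also have "z powr (p + 2) \<le> z powr real k" using z k by (intro powr_mono) auto
    also have "z powr real k = z ^ k" using z by (simp add: powr_realpow)
    finally have "z powr p \<le> z ^ k * z powr (-2)" by (simp add: mult_right_mono)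
    also have "\<dots> \<le> (real k / (- q)) ^ k * exp (- q * z) * z powr (-2)"
      by (intro mult_right_mono zk) auto
    finally have "z powr p * exp (q * \<bar>y\<bar>) \<le> (real k / (- q)) ^ k * exp (- q * z) * z powr (-2) * exp (q * \<bar>y\<bar>)"
      by (intro mult_right_mono) auto
    also have "\<dots> = (real k / (- q)) ^ k * (exp (- q * z) * exp (q * \<bar>y\<bar>)) * z powr (-2)"
      by (simp only: mult_ac)
    also have "exp (- q * z) * exp (q * \<bar>y\<bar>) = exp (- q)"
      by (simp add: z_def algebra_simps flip: exp_add)
    finally show ?thesis by (simp only: C_def z_def)
  qed
  ultimately show thesis using that by blast
qed

lemma integrable_vertical_bound:
  assumes W: "vertical_bound W p q" "W \<in> borel_measurable borel"
    and decay: "q < 0 \<or> q = 0 \<and> p + \<kappa> < -1"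
  shows "integrable lborel (\<lambda>y. norm (W y) * (1 + \<bar>y\<bar>) powr \<kappa>)"
proof -
  obtain C where C: "C \<ge> 0" "\<And>y. norm (W y) \<le> C * ((1 + \<bar>y\<bar>) powr p * exp (q * \<bar>y\<bar>))"
    using W(1) unfolding vertical_bound_def by blast
  have le: "norm (W y) * (1 + \<bar>y\<bar>) powr \<kappa> \<le> C * ((1 + \<bar>y\<bar>) powr (p + \<kappa>) * exp (q * \<bar>y\<bar>))" for y
  proof -
    have "norm (W y) * (1 + \<bar>y\<bar>) powr \<kappa> \<le> C * ((1 + \<bar>y\<bar>) powr p * exp (q * \<bar>y\<bar>)) * (1 + \<bar>y\<bar>) powr \<kappa>"
      by (intro mult_right_mono C) auto
    then show ?thesis by (simp only: powr_add mult_ac)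
  qed
  obtain C' s where s: "s < -1" "C' \<ge> 0" "\<And>y. (1 + \<bar>y\<bar>) powr (p + \<kappa>) * exp (q * \<bar>y\<bar>) \<le> C' * (1 + \<bar>y\<bar>) powr s"
  proof (cases "q < 0")
    case True
    obtain C' where C': "C' > 0" "\<And>y. (1 + \<bar>y\<bar>) powr (p + \<kappa>) * exp (q * \<bar>y\<bar>) \<le> C' * (1 + \<bar>y\<bar>) powr (-2)"
      using powr_exp_decay_bounded[OF True, of "p + \<kappa>"] by blast
    then show thesis by (intro that[of "-2" C']) auto
  next
    case False
    then show thesis using decay by (intro that[of "p + \<kappa>" 1]) auto
  qed
  show ?thesis
  proof (rule Bochner_Integration.integrable_bound)
    show "integrable lborel (\<lambda>y. (C * C') * (1 + \<bar>y\<bar>) powr s)"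
      by (intro integrable_mult_right integrable_one_plus_abs_powr s)
    show "AE y in lborel. norm (norm (W y) * (1 + \<bar>y\<bar>) powr \<kappa>) \<le> norm ((C * C') * (1 + \<bar>y\<bar>) powr s)"
    proof (intro AE_I2)
      fix y
      have "norm (W y) * (1 + \<bar>y\<bar>) powr \<kappa> \<le> C * (C' * (1 + \<bar>y\<bar>) powr s)"
        by (rule order_trans[OF le mult_left_mono[OF s(3) C(1)]])
      then show "norm (norm (W y) * (1 + \<bar>y\<bar>) powr \<kappa>) \<le> norm ((C * C') * (1 + \<bar>y\<bar>) powr s)"
        using C(1) s(2) by (simp add: mult.assoc)
    qed
  qed (use W(2) in simp)
qed

definition mb_weight ::
  "(triple \<Rightarrow> complex \<Rightarrow> complex) \<Rightarrow> nat \<Rightarrow> nat \<Rightarrow> triple list \<Rightarrow> triple list \<Rightarrow> complex \<Rightarrow> real \<Rightarrow> real \<Rightarrow> complex" where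
  "mb_weight L m n us ls a \<theta> y = I_chi L m n us ls (\<i> * of_real y) *
     exp (- (\<i> * of_real y) * (of_real (ln (norm a)) + \<i> * of_real \<theta>)) / of_real (2 * pi)"

text \<open>
  Since \<open>a\<close> is multiplied by a positive number, only \<open>ln (norm a)\<close> is shifted and the chosen argument
  \<open>\<theta>\<close> stays: each contour point contributes a pure power of \<open>t\<close>.
\<close>

lemma powr_times_I_fun:
  assumes a: "a \<noteq> 0" and t: "t > 0"
  shows "of_real t powr (- \<rho>) * I_fun L m n us ls (a * of_real (t powr (- \<mu>))) \<theta> =
    (\<integral>y. mb_weight L m n us ls a \<theta> y * of_real t powr (- (\<rho> - \<i> * of_real (\<mu> * y))) \<partial>lborel)"
proof -
  let ?l = "complex_of_real (ln t)" and ?s = "\<lambda>y. \<i> * complex_of_real y"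
  let ?A = "complex_of_real (ln (norm a)) + \<i> * of_real \<theta>"
  have powr_exp: "complex_of_real t powr z = exp (z * ?l)" for z
    using t Ln_of_real[of t] by (simp add: powr_def)
  have ln: "ln (norm (a * complex_of_real (t powr (- \<mu>)))) = ln (norm a) - \<mu> * ln t"
    using a t by (simp add: norm_mult ln_mult ln_powr)
  have "of_real t powr (- \<rho>) * (1 / (2 * of_real pi * \<i>)) *
      (I_chi L m n us ls (?s y) * exp (- ?s y * (of_real (ln (norm a) - \<mu> * ln t) + \<i> * of_real \<theta>)) * \<i>) =
      mb_weight L m n us ls a \<theta> y * of_real t powr (- (\<rho> - \<i> * of_real (\<mu> * y)))" for y
  proof -
    have "- ?s y * (of_real (ln (norm a) - \<mu> * ln t) + \<i> * of_real \<theta>) + - \<rho> * ?l =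
        - ?s y * ?A + - (\<rho> - \<i> * of_real (\<mu> * y)) * ?l"
      by (simp add: algebra_simps)
    then have "exp (- ?s y * (of_real (ln (norm a) - \<mu> * ln t) + \<i> * of_real \<theta>)) * exp (- \<rho> * ?l) =
        exp (- ?s y * ?A) * exp (- (\<rho> - \<i> * of_real (\<mu> * y)) * ?l)"
      by (simp only: exp_add[symmetric])
    moreover have "R * (1 / (2 * of_real pi * \<i>)) * (X * E * \<i>) = X * (E * R) / of_real (2 * pi)" for R X E :: complex
      by simp
    moreover have "X * (E * R) / of_real (2 * pi) = X * E / of_real (2 * pi) * R" for R X E :: complex
      by simp
    ultimately show ?thesis unfolding mb_weight_def powr_exp by metis
  qed
  then have "(\<integral>y. of_real t powr (- \<rho>) * (1 / (2 * of_real pi * \<i>)) *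
      (I_chi L m n us ls (?s y) * exp (- ?s y * (of_real (ln (norm a) - \<mu> * ln t) + \<i> * of_real \<theta>)) * \<i>) \<partial>lborel) =
      (\<integral>y. mb_weight L m n us ls a \<theta> y * of_real t powr (- (\<rho> - \<i> * of_real (\<mu> * y))) \<partial>lborel)"
    by (simp only:)
  then show ?thesis unfolding I_fun_def ln Let_def integral_mult_right_zero mult.assoc .
qed

lemma vertical_bound_mb_weight:
  assumes "is_gamma_branch L" "I_params m n us ls" "I_separated m n us ls"
  shows "vertical_bound (mb_weight L m n us ls a \<theta>) (I_Omega us ls) (\<bar>\<theta>\<bar> - pi / 2 * I_Delta m n us ls)"
proof -
  have "vertical_bound (\<lambda>y. exp (- (\<i> * of_real y) * (of_real (ln (norm a)) + \<i> * of_real \<theta>)) / of_real (2 * pi)) 0 \<bar>\<theta>\<bar>"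
  proof (rule vertical_boundI[where C = "1 / (2 * pi)"])
    fix y
    have "\<theta> * y \<le> \<bar>\<theta>\<bar> * \<bar>y\<bar>" using abs_ge_self[of "\<theta> * y"] by (simp only: abs_mult)
    then show "norm (exp (- (\<i> * of_real y) * (of_real (ln (norm a)) + \<i> * of_real \<theta>)) / of_real (2 * pi))
        \<le> 1 / (2 * pi) * ((1 + \<bar>y\<bar>) powr 0 * exp (\<bar>\<theta>\<bar> * \<bar>y\<bar>))"
      by (simp add: norm_divide divide_right_mono mult.commute)
  qed
  from vertical_bound_mult[OF vertical_bound_I_chi[OF assms] this]
  show ?thesis by (rule vertical_bound_cong) (simp_all add: mb_weight_def)
qed

lemma mb_weight_measurable:
  assumes "is_gamma_branch L"
  shows "mb_weight L m n us ls a \<theta> \<in> borel_measurable borel"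
  unfolding mb_weight_def[abs_def]
  by (intro borel_measurable_divide borel_measurable_times I_chi_measurable assms
      borel_measurable_continuous_onI continuous_intros)

section \<open>Superpositions of powers\<close>

locale power_superposition =
  fixes W :: "real \<Rightarrow> complex" and \<rho> :: complex and \<mu> :: real
  assumes W_measurable: "W \<in> borel_measurable borel" and \<rho>_pos: "Re \<rho> > 0" and \<mu>_pos: "\<mu> > 0"
begin

definition d :: "real \<Rightarrow> complex" where "d y = \<rho> - \<i> * of_real (\<mu> * y)"

text \<open>
  The \<open>j\<close>-th derivative of \<open>t powr (- d y)\<close>.
\<close>

definition power_deriv :: "nat \<Rightarrow> real \<Rightarrow> real \<Rightarrow> complex" where
  "power_deriv j y t = (-1) ^ j * pochhammer (d y) j * of_real t powr (- d y - of_nat j)"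

definition superposition :: "nat \<Rightarrow> real \<Rightarrow> complex" where
  "superposition j t = (\<integral>y. W y * power_deriv j y t \<partial>lborel)"

text \<open>
  Each derivative of a power costs a factor of size \<open>1 + \<bar>y\<bar>\<close>, so this measures how often \<open>W\<close> may be
  differentiated under the integral sign; \<open>\<kappa>\<close> need not be an integer.
\<close>

definition integrable_weight :: "real \<Rightarrow> bool" where
  "integrable_weight \<kappa> \<longleftrightarrow> integrable lborel (\<lambda>y. norm (W y) * (1 + \<bar>y\<bar>) powr \<kappa>)"

definition growth :: "nat \<Rightarrow> real" where "growth j = norm \<rho> + \<mu> + real j"

lemma growth_pos: "growth j > 0" using \<mu>_pos by (simp add: growth_def add_pos_nonneg add_nonneg_pos)

lemma Re_d: "Re (d y) = Re \<rho>" by (simp add: d_def)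

lemma continuous_on_d: "continuous_on UNIV d"
  unfolding d_def by (intro continuous_intros)

lemma integrable_weight_bound:
  assumes "integrable_weight \<kappa>" "f \<in> borel_measurable borel" "\<And>y. norm (f y) \<le> C * (1 + \<bar>y\<bar>) powr \<kappa>"
  shows "integrable lborel (\<lambda>y. W y * f y)"
proof (rule Bochner_Integration.integrable_bound)
  show "integrable lborel (\<lambda>y. C * (norm (W y) * (1 + \<bar>y\<bar>) powr \<kappa>))"
    using assms(1) unfolding integrable_weight_def by (rule integrable_mult_right)
  show "(\<lambda>y. W y * f y) \<in> borel_measurable lborel"
    using W_measurable assms(2) by simp
  show "AE y in lborel. norm (W y * f y) \<le> norm (C * (norm (W y) * (1 + \<bar>y\<bar>) powr \<kappa>))"
  proof (intro AE_I2)
    fix y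
    have "norm (W y * f y) \<le> norm (W y) * (C * (1 + \<bar>y\<bar>) powr \<kappa>)"
      unfolding norm_mult by (intro mult_left_mono assms(3)) auto
    also have "\<dots> = C * (norm (W y) * (1 + \<bar>y\<bar>) powr \<kappa>)" by (simp only: mult.left_commute)
    finally show "norm (W y * f y) \<le> norm (C * (norm (W y) * (1 + \<bar>y\<bar>) powr \<kappa>))"
      unfolding real_norm_def by linarith
  qed
qed

lemma pochhammer_le: "norm (pochhammer (d y) j) \<le> (growth j * (1 + \<bar>y\<bar>)) ^ j"
proof -
  have "norm (pochhammer (d y) j) = (\<Prod>i<j. norm (d y + of_nat i))"
    by (simp add: pochhammer_prod prod_norm atLeast0LessThan)
  also have "\<dots> \<le> (\<Prod>i<j. growth j * (1 + \<bar>y\<bar>))"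
  proof (intro prod_mono conjI)
    fix i assume i: "i \<in> {..<j}"
    have "norm (d y + of_nat i) \<le> norm \<rho> + norm (\<i> * of_real (\<mu> * y)) + real i"
      unfolding d_def by (intro order_trans[OF norm_triangle_ineq] add_mono norm_triangle_ineq4) auto
    also have "norm (\<i> * complex_of_real (\<mu> * y)) = \<mu> * \<bar>y\<bar>"
      using \<mu>_pos by (simp add: norm_mult abs_mult)
    also have "norm \<rho> + \<mu> * \<bar>y\<bar> + real i \<le> growth j + \<mu> * \<bar>y\<bar>"
      using i \<mu>_pos by (simp add: growth_def)
    also have "\<dots> \<le> growth j + growth j * \<bar>y\<bar>"
      by (intro add_left_mono mult_right_mono) (auto simp: growth_def)
    finally show "norm (d y + of_nat i) \<le> growth j * (1 + \<bar>y\<bar>)" by (simp only: distrib_left mult_1_right)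
  qed simp
  also have "\<dots> = (growth j * (1 + \<bar>y\<bar>)) ^ j" by simp
  finally show ?thesis .
qed

lemma norm_e_le:
  assumes "t > 0"
  shows "norm (power_deriv j y t) \<le> growth j ^ j * t powr (- Re \<rho> - real j) * (1 + \<bar>y\<bar>) powr real j"
proof -
  have "norm (power_deriv j y t) = norm (pochhammer (d y) j) * t powr (- Re \<rho> - real j)"
    using assms by (simp add: power_deriv_def norm_mult norm_power norm_of_real_powr Re_d)
  also have "\<dots> \<le> (growth j * (1 + \<bar>y\<bar>)) ^ j * t powr (- Re \<rho> - real j)"
    by (intro mult_right_mono pochhammer_le) auto
  also have "(growth j * (1 + \<bar>y\<bar>)) ^ j = growth j ^ j * (1 + \<bar>y\<bar>) powr real j"
    by (simp add: power_mult_distrib powr_realpow)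
  finally show ?thesis by (simp only: mult_ac)
qed

lemma power_deriv_measurable: "t > 0 \<Longrightarrow> (\<lambda>y. power_deriv j y t) \<in> borel_measurable borel"
  unfolding power_deriv_def pochhammer_prod
  by (intro borel_measurable_continuous_onI continuous_intros continuous_on_compose2[OF continuous_on_d]) auto

lemma integrable_weight_mono: "integrable_weight \<kappa> \<Longrightarrow> \<kappa>' \<le> \<kappa> \<Longrightarrow> integrable_weight \<kappa>'"
  unfolding integrable_weight_def
  by (rule Bochner_Integration.integrable_bound[where f = "\<lambda>y. norm (W y) * (1 + \<bar>y\<bar>) powr \<kappa>"])
     (use W_measurable in \<open>auto intro!: AE_I2 mult_left_mono powr_mono\<close>)

lemma integrable_e:
  assumes "integrable_weight \<kappa>" "real j \<le> \<kappa>" "t > 0"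
  shows "integrable lborel (\<lambda>y. W y * power_deriv j y t)"
  by (rule integrable_weight_bound[OF integrable_weight_mono[OF assms(1,2)] power_deriv_measurable[OF assms(3)] norm_e_le[OF assms(3)]])

lemma has_vector_derivative_e:
  assumes t: "t > 0"
  shows "(power_deriv j y has_vector_derivative power_deriv (Suc j) y t) (at t)"
proof -
  have "(power_deriv j y has_vector_derivative ((-1) ^ j * pochhammer (d y) j) *
      ((- d y - of_nat j) * of_real t powr (- d y - of_nat j - 1))) (at t)"
    unfolding power_deriv_def[abs_def] by (intro has_vector_derivative_mult_right has_vector_derivative_of_real_powr t)
  also have "((-1) ^ j * pochhammer (d y) j) * ((- d y - of_nat j) * of_real t powr (- d y - of_nat j - 1)) = power_deriv (Suc j) y t"
  proof -
    have "- d y - of_nat j - 1 = - d y - of_nat (Suc j)" by simp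
    moreover have "- d y - of_nat j = - (d y + of_nat j)" by simp
    ultimately show ?thesis unfolding power_deriv_def pochhammer_Suc by (simp only: power_Suc mult_minus_left mult_minus_right mult_1_left mult.assoc)
  qed
  finally show ?thesis .
qed

lemma powr_decreasing:
  assumes "0 < l" "l \<le> t" shows "t powr (- Re \<rho> - real j) \<le> l powr (- Re \<rho> - real j)"
  using assms \<rho>_pos by (intro powr_mono2') auto

lemma superposition_deriv:
  assumes integrable_weight: "integrable_weight \<kappa>" and j: "real (Suc j) \<le> \<kappa>" and t: "t > 0"
  shows "(superposition j has_vector_derivative superposition (Suc j) t) (at t)"
  unfolding superposition_def[abs_def]
proof (rule has_vector_derivative_lebesgue_integral[where l = "t / 2" and u = "t + 1"
      and B = "\<lambda>y. norm (W y) * (growth (Suc j) ^ Suc j * (t / 2) powr (- Re \<rho> - real (Suc j)) * (1 + \<bar>y\<bar>) powr real (Suc j))"])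
  show "integrable lborel (\<lambda>y. W y * power_deriv j y s)" if "t / 2 < s" for s
    using that t j by (intro integrable_e[OF integrable_weight]) auto
  show "((\<lambda>t. W y * power_deriv j y t) has_vector_derivative W y * power_deriv (Suc j) y s) (at s)" if "t / 2 < s" for s y
    using that t by (intro has_vector_derivative_mult_right has_vector_derivative_e) auto
  show "(\<lambda>y. W y * power_deriv (Suc j) y t) \<in> borel_measurable lborel"
    using W_measurable power_deriv_measurable[OF t] by simp
  show "integrable lborel (\<lambda>y. norm (W y) * (growth (Suc j) ^ Suc j * (t / 2) powr (- Re \<rho> - real (Suc j)) * (1 + \<bar>y\<bar>) powr real (Suc j)))"
    using integrable_mult_right[OF integrable_weight_mono[OF integrable_weight j, unfolded integrable_weight_def], of "growth (Suc j) ^ Suc j * (t / 2) powr (- Re \<rho> - real (Suc j))"]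
    by (simp only: mult_ac)
  show "norm (W y * power_deriv (Suc j) y s) \<le> norm (W y) * (growth (Suc j) ^ Suc j * (t / 2) powr (- Re \<rho> - real (Suc j)) * (1 + \<bar>y\<bar>) powr real (Suc j))"
    if s: "t / 2 < s" for y s
    unfolding norm_mult
  proof (intro mult_left_mono)
    have "norm (power_deriv (Suc j) y s) \<le> growth (Suc j) ^ Suc j * s powr (- Re \<rho> - real (Suc j)) * (1 + \<bar>y\<bar>) powr real (Suc j)"
      using s t by (intro norm_e_le) auto
    also have "\<dots> \<le> growth (Suc j) ^ Suc j * (t / 2) powr (- Re \<rho> - real (Suc j)) * (1 + \<bar>y\<bar>) powr real (Suc j)"
      using s t growth_pos[of "Suc j"] by (intro mult_right_mono mult_left_mono powr_decreasing) auto
    finally show "norm (power_deriv (Suc j) y s) \<le> growth (Suc j) ^ Suc j * (t / 2) powr (- Re \<rho> - real (Suc j)) * (1 + \<bar>y\<bar>) powr real (Suc j)" .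
  qed simp
qed (use t in auto)

lemma nth_deriv_Suc: "nth_deriv (Suc k) f t = vector_derivative (nth_deriv k f) (at t)"
  by (simp add: nth_deriv_def)

lemma nth_deriv_eq_superposition:
  assumes integrable_weight: "integrable_weight \<kappa>" and f: "\<And>t. t > 0 \<Longrightarrow> f t = superposition 0 t"
  shows "real j \<le> \<kappa> \<Longrightarrow> t > 0 \<Longrightarrow> nth_deriv j f t = superposition j t"
proof (induction j arbitrary: t)
  case 0
  then show ?case using f by (simp add: nth_deriv_def)
next
  case (Suc j)
  have "(nth_deriv j f has_vector_derivative superposition (Suc j) t) (at t)"
    by (rule has_vector_derivative_transform_within_open[OF superposition_deriv[OF integrable_weight Suc.prems], of "{0<..}"])
       (use Suc in auto)
  then show ?case unfolding nth_deriv_Suc by (rule vector_derivative_at)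
qed

lemma differentiable_nth_deriv:
  assumes integrable_weight: "integrable_weight \<kappa>" and f: "\<And>t. t > 0 \<Longrightarrow> f t = superposition 0 t" and j: "real (Suc j) \<le> \<kappa>" and t: "t > 0"
  shows "nth_deriv j f differentiable (at t)"
proof -
  have "(nth_deriv j f has_vector_derivative superposition (Suc j) t) (at t)"
    by (rule has_vector_derivative_transform_within_open[OF superposition_deriv[OF integrable_weight j t], of "{0<..}"])
       (use t j nth_deriv_eq_superposition[OF integrable_weight f, of j] in auto)
  then show ?thesis by (rule differentiableI_vector)
qed

end

section \<open>The Saigo integral of a superposition of powers\<close>

text \<open>
  The equation for \<open>c\<close> holds for the parameters \<open>a = - \<alpha>\<close> and \<open>c = N - \<alpha>\<close> of the Caputo derivative; it
  turns the power of \<open>t\<close> in the kernel into the integer power \<open>N - 1\<close>.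
\<close>

locale saigo_kernel = power_superposition W \<rho> \<mu> + gauss_hypergeometric a b c \<eta>
  for W \<rho> \<mu> a b c \<eta> +
  fixes N :: nat and x :: real
  assumes N_pos: "N > 0" and c_eq: "c = of_nat N + a" and c_le: "Re c \<le> 1" and \<eta>_less: "\<eta> < Re \<rho>" and x_pos: "x > 0"
begin

text \<open>
  The Saigo kernel: \<open>(t - x) powr (c - 1) * t powr (- a)\<close> times the hypergeometric factor, written as a
  function of \<open>1 - x / t\<close>.
\<close>

definition G :: "real \<Rightarrow> complex" where "G t = of_real t ^ (N - 1) * g (1 - x / t)"

definition G' :: "real \<Rightarrow> complex" where
  "G' t = of_real t ^ (N - 1) * (of_real (x / t\<^sup>2) * g' (1 - x / t))
     + of_nat (N - 1) * of_real t ^ (N - 2) * g (1 - x / t)"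

text \<open>
  As a function of \<open>t\<close>, with \<open>v = 1 - x / t\<close>, this is the primitive of \<open>G t * power_deriv N y t\<close> that
  vanishes at \<open>t = x\<close>.
\<close>

definition Q :: "real \<Rightarrow> real \<Rightarrow> complex" where
  "Q y v = (-1) ^ N * pochhammer (d y) N * of_real x powr (- d y) * incomplete_euler (d y) v"

lemma ratio_unit: "t > x \<Longrightarrow> 0 < 1 - x / t \<and> 1 - x / t < 1"
  using x_pos by (simp add: field_simps)

lemma has_vector_derivative_ratio:
  assumes "t > x" shows "((\<lambda>t. 1 - x / t) has_vector_derivative x / t\<^sup>2) (at t)"
proof -
  have "((\<lambda>t. 1 - x / t) has_real_derivative x / t\<^sup>2) (at t)"
    using assms x_pos by (auto intro!: derivative_eq_intros simp: power2_eq_square)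
  then show ?thesis by (simp add: has_real_derivative_iff_has_vector_derivative)
qed

lemma has_vector_derivative_G:
  assumes t: "t > x" shows "(G has_vector_derivative G' t) (at t)"
proof -
  have 1: "((\<lambda>t. g (1 - x / t)) has_vector_derivative of_real (x / t\<^sup>2) * g' (1 - x / t)) (at t)"
    using vector_diff_chain_at[OF has_vector_derivative_ratio[OF t] has_vector_derivative_g] ratio_unit[OF t]
    by (simp add: comp_def scaleR_conv_of_real)
  have 2: "((\<lambda>t. complex_of_real t ^ (N - 1)) has_vector_derivative of_nat (N - 1) * of_real t ^ (N - 2)) (at t)"
    by (rule has_vector_derivative_real_field) (auto intro!: derivative_eq_intros simp: diff_diff_add numeral_2_eq_2)
  show ?thesis
    using has_vector_derivative_mult[OF 2 1] by (simp add: G_def[abs_def] G'_def)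
qed

lemma continuous_on_G': "continuous_on {x<..} G'"
  unfolding G'_def using x_pos ratio_unit
  by (intro continuous_intros continuous_on_compose2[OF continuous_on_g(1)] continuous_on_compose2[OF continuous_on_g(2)]) auto

lemma has_vector_derivative_Q:
  assumes t: "t > x"
  shows "((\<lambda>t. Q y (1 - x / t)) has_vector_derivative G t * power_deriv N y t) (at t)"
proof -
  let ?u = "1 - x / t"
  have t0: "t > 0" using t x_pos by simp
  have "((\<lambda>t. incomplete_euler (d y) (1 - x / t)) has_vector_derivative of_real (x / t\<^sup>2) * kern (d y) ?u) (at t)"
    using vector_diff_chain_at[OF has_vector_derivative_ratio[OF t] incomplete_euler_deriv] ratio_unit[OF t] \<eta>_less
    by (simp add: comp_def scaleR_conv_of_real Re_d)
  then have "((\<lambda>t. Q y (1 - x / t)) has_vector_derivative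
      (-1) ^ N * pochhammer (d y) N * of_real x powr (- d y) * (of_real (x / t\<^sup>2) * kern (d y) ?u)) (at t)"
    unfolding Q_def by (rule has_vector_derivative_mult_right)
  also have "(-1) ^ N * pochhammer (d y) N * of_real x powr (- d y) * (of_real (x / t\<^sup>2) * kern (d y) ?u)
      = G t * power_deriv N y t"
  proof -
    have x1: "complex_of_real x powr (- d y) * (of_real (x / t\<^sup>2) * of_real (1 - ?u) powr (d y - 1)) = of_real t powr (- d y - 1)"
    proof -
      have powr_exp: "complex_of_real u powr z = exp (z * of_real (ln u))" if "u > 0" for u z
        using that Ln_of_real[of u] by (simp add: powr_def)
      have "1 - ?u = x / t" by simp
      moreover have "ln (x / t) = ln x - ln t" using x_pos t0 by (simp add: ln_div)
      moreover have "x / t > 0" using x_pos t0 by simp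
      ultimately have 1: "complex_of_real (1 - ?u) powr (d y - 1) = exp ((d y - 1) * of_real (ln x - ln t))"
        by (simp only: powr_exp)
      have "x / t\<^sup>2 = exp (ln x - 2 * ln t)"
        using x_pos t0 by (simp add: exp_diff exp_double)
      then have 2: "complex_of_real (x / t\<^sup>2) = exp (of_real (ln x - 2 * ln t))"
        by (simp only: exp_of_real)
      have "- d y * of_real (ln x) + (of_real (ln x - 2 * ln t) + (d y - 1) * of_real (ln x - ln t))
          = (- d y - 1) * complex_of_real (ln t)"
        by (simp add: algebra_simps)
      then show ?thesis
        unfolding 1 2 powr_exp[OF x_pos] powr_exp[OF t0] exp_add[symmetric] by (rule arg_cong)
    qed
    have t1: "complex_of_real t ^ (N - 1) * of_real t powr (- d y - of_nat N) = of_real t powr (- d y - 1)"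
    proof -
      have "complex_of_real t ^ (N - 1) = of_real t powr (of_nat (N - 1))" using t0 by (simp add: powr_nat')
      then have "complex_of_real t ^ (N - 1) * of_real t powr (- d y - of_nat N) = of_real t powr (of_nat (N - 1) + (- d y - of_nat N))"
        by (simp only: powr_add)
      also have "of_nat (N - 1) + (- d y - of_nat N) = - d y - 1" using N_pos by (simp add: of_nat_diff)
      finally show ?thesis .
    qed
    have "(-1) ^ N * pochhammer (d y) N * of_real x powr (- d y) * (of_real (x / t\<^sup>2) * kern (d y) ?u)
        = (-1) ^ N * pochhammer (d y) N * g ?u * (of_real x powr (- d y) * (of_real (x / t\<^sup>2) * of_real (1 - ?u) powr (d y - 1)))"
      unfolding kern_eq_g by (simp only: mult_ac)
    also have "\<dots> = (-1) ^ N * pochhammer (d y) N * g ?u * (of_real t ^ (N - 1) * of_real t powr (- d y - of_nat N))"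
      unfolding x1 t1 ..
    also have "\<dots> = G t * power_deriv N y t" unfolding G_def power_deriv_def by (simp only: mult_ac)
    finally show ?thesis .
  qed
  finally show ?thesis .
qed

lemma Q_measurable: "v \<le> 1 \<Longrightarrow> (\<lambda>y. Q y v) \<in> borel_measurable borel"
  unfolding Q_def pochhammer_prod using x_pos
  by (intro borel_measurable_times incomplete_euler_measurable continuous_on_d borel_measurable_continuous_onI
      continuous_intros continuous_on_compose2[OF continuous_on_d]) auto

text \<open>
  The Pochhammer symbol grows like the power \<open>N\<close> of \<open>\<bar>y\<bar>\<close>, and the incomplete Euler integral wins back
  \<open>r = N - \<kappa>\<close>.
\<close>

lemma Q_bound:
  assumes \<kappa>: "real N - Re c < \<kappa>" "\<kappa> \<le> real N"
  obtains C where "\<And>y v. 0 \<le> v \<Longrightarrow> v < 1 \<Longrightarrow> norm (Q y v) \<le> C * (1 + \<bar>y\<bar>) powr \<kappa>"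
proof -
  define r where "r = real N - \<kappa>"
  have r: "0 \<le> r" "r < Re c" using \<kappa> by (auto simp: r_def)
  obtain C1 where C1: "C1 \<ge> 0" "\<And>d v. Re d = Re \<rho> \<Longrightarrow> 0 \<le> v \<Longrightarrow> v < 1 \<Longrightarrow> norm (incomplete_euler d v) \<le> C1 * norm d powr (- r)"
    using incomplete_euler_bound[OF c_le \<eta>_less r] by blast
  have "vertical_bound (\<lambda>y. of_real (norm (Complex (Re \<rho>) (Im \<rho> + (- \<mu>) * y)) powr (- r))) (- r) (0 * \<bar>- \<mu>\<bar>)"
    by (rule vertical_bound_affine[OF vertical_bound_inverse_Complex[OF \<rho>_pos r(1)]]) (use \<mu>_pos in auto)
  moreover have "Complex (Re \<rho>) (Im \<rho> + (- \<mu>) * y) = d y" for y by (simp add: d_def complex_eq_iff)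
  ultimately obtain C2 where C2: "C2 \<ge> 0" "\<And>y. norm (d y) powr (- r) \<le> C2 * (1 + \<bar>y\<bar>) powr (- r)"
    unfolding vertical_bound_def by auto
  show thesis
  proof (rule that)
    fix y v :: real assume v: "0 \<le> v" "v < 1"
    have "norm (Q y v) = norm (pochhammer (d y) N) * x powr (- Re \<rho>) * norm (incomplete_euler (d y) v)"
      using x_pos by (simp add: Q_def norm_mult norm_power norm_of_real_powr Re_d)
    also have "\<dots> \<le> (growth N * (1 + \<bar>y\<bar>)) ^ N * x powr (- Re \<rho>) * (C1 * (C2 * (1 + \<bar>y\<bar>) powr (- r)))"
    proof (intro mult_mono pochhammer_le)
      show "norm (incomplete_euler (d y) v) \<le> C1 * (C2 * (1 + \<bar>y\<bar>) powr (- r))"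
        by (rule order_trans[OF C1(2)[OF Re_d v] mult_left_mono[OF C2(2) C1(1)]])
    qed (use growth_pos[of N] in \<open>auto intro!: mult_nonneg_nonneg zero_le_power\<close>)
    also have "\<dots> = (growth N ^ N * x powr (- Re \<rho>) * C1 * C2) * ((1 + \<bar>y\<bar>) ^ N * (1 + \<bar>y\<bar>) powr (- r))"
      by (simp add: power_mult_distrib)
    also have "(1 + \<bar>y\<bar>) ^ N * (1 + \<bar>y\<bar>) powr (- r) = (1 + \<bar>y\<bar>) powr \<kappa>"
    proof -
      have "(1 + \<bar>y\<bar>) ^ N = (1 + \<bar>y\<bar>) powr real N" by (simp add: powr_realpow)
      then show ?thesis by (simp add: r_def flip: powr_add)
    qed
    finally show "norm (Q y v) \<le> (growth N ^ N * x powr (- Re \<rho>) * C1 * C2) * (1 + \<bar>y\<bar>) powr \<kappa>" .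
  qed
qed

text \<open>
  The primitive is \<open>P t = \<integral> W y * Q y (1 - x / t) dy\<close>. Differentiating it under the integral sign would
  need \<open>N\<close> moments of \<open>W\<close>. In \<open>Q y (1 - x / t) - G t * power_deriv (N - 1) y t\<close> the terms of order \<open>N\<close>
  cancel on differentiation and only \<open>- G' t * power_deriv (N - 1) y t\<close> is left. The product
  \<open>G t * h t\<close> that has been subtracted is differentiated with the derivative of \<open>h\<close> that exists by
  assumption. Both limits of \<open>P\<close> follow by dominated convergence from \<open>Q_bound\<close>.
\<close>

theorem has_integral_kernel:
  assumes \<kappa>: "real N - Re c < \<kappa>" "\<kappa> \<le> real N" and integrable_weight: "integrable_weight \<kappa>"
    and h: "\<And>t. t > 0 \<Longrightarrow> h t = superposition (N - 1) t"
    and h': "\<And>t. t > x \<Longrightarrow> (h has_vector_derivative h' t) (at t)"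
  shows "((\<lambda>t. G t * h' t) has_integral (\<integral>y. W y * Q y 1 \<partial>lborel)) {x<..}"
proof -
  define P where "P t = (\<integral>y. W y * Q y (1 - x / t) \<partial>lborel)" for t
  obtain C where C: "\<And>y v. 0 \<le> v \<Longrightarrow> v < 1 \<Longrightarrow> norm (Q y v) \<le> C * (1 + \<bar>y\<bar>) powr \<kappa>"
    using Q_bound[OF \<kappa>] by blast
  have N1: "real (N - 1) \<le> \<kappa>" using \<kappa> c_le N_pos by (simp add: of_nat_diff)
  have SN: "Suc (N - 1) = N" using N_pos by simp
  have intQ: "integrable lborel (\<lambda>y. W y * Q y (1 - x / t))" if "t > x" for t
    using ratio_unit[OF that] by (intro integrable_weight_bound[OF integrable_weight Q_measurable C]) auto
  have inte: "integrable lborel (\<lambda>y. W y * power_deriv (N - 1) y t)" if "t > x" for t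
    using that x_pos by (intro integrable_e[OF integrable_weight N1]) auto
  have P_deriv: "(P has_vector_derivative G t0 * h' t0) (at t0)" if t0: "t0 > x" for t0
  proof -
    define l where "l = (x + t0) / 2"
    have l: "x < l" "l < t0" "0 < l" using t0 x_pos by (auto simp: l_def)
    have "compact (G' ` {l..t0 + 1})"
      by (intro compact_continuous_image continuous_on_subset[OF continuous_on_G']) (use l in auto)
    from compact_imp_bounded[OF this] obtain B where "\<forall>z\<in>G' ` {l..t0 + 1}. norm z \<le> B"
      unfolding bounded_iff by (elim exE)
    then have B: "\<And>t. t \<in> {l..t0 + 1} \<Longrightarrow> norm (G' t) \<le> B" by (simp only: ball_simps)
    let ?E = "growth (N - 1) ^ (N - 1) * l powr (- Re \<rho> - real (N - 1))"
    have "((\<lambda>t. \<integral>y. W y * (Q y (1 - x / t) - G t * power_deriv (N - 1) y t) \<partial>lborel) has_vector_derivative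
        (\<integral>y. W y * (- (G' t0 * power_deriv (N - 1) y t0)) \<partial>lborel)) (at t0)"
    proof (rule has_vector_derivative_lebesgue_integral[where l = l and u = "t0 + 1" 
          and B = "\<lambda>y. B * ?E * (norm (W y) * (1 + \<bar>y\<bar>) powr real (N - 1))"
          and f' = "\<lambda>y t. W y * (- (G' t * power_deriv (N - 1) y t))"])
      show "integrable lborel (\<lambda>y. W y * (Q y (1 - x / t) - G t * power_deriv (N - 1) y t))" if "l < t" for t
      proof -
        have "t > x" using that l by simp
        from Bochner_Integration.integrable_diff[OF intQ[OF this] integrable_mult_right[OF inte[OF this], of "G t"]]
        show ?thesis by (simp only: right_diff_distrib mult.left_commute)
      qed
      show "((\<lambda>t. W y * (Q y (1 - x / t) - G t * power_deriv (N - 1) y t)) has_vector_derivative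
          W y * (- (G' t * power_deriv (N - 1) y t))) (at t)" if "l < t" for y t
      proof -
        have t: "t > x" "t > 0" using that l by auto
        have "((\<lambda>t. W y * (Q y (1 - x / t) - G t * power_deriv (N - 1) y t)) has_vector_derivative
          W y * (G t * power_deriv N y t - (G t * power_deriv (Suc (N - 1)) y t + G' t * power_deriv (N - 1) y t))) (at t)"
          by (intro has_vector_derivative_mult_right has_vector_derivative_diff has_vector_derivative_Q
              has_vector_derivative_mult has_vector_derivative_G has_vector_derivative_e t)
        moreover have "G t * power_deriv N y t - (G t * power_deriv (Suc (N - 1)) y t + G' t * power_deriv (N - 1) y t) = - (G' t * power_deriv (N - 1) y t)"
          unfolding SN by simp
        ultimately show ?thesis by (simp only:)
      qed
      show "(\<lambda>y. W y * (- (G' t0 * power_deriv (N - 1) y t0))) \<in> borel_measurable lborel"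
        using W_measurable power_deriv_measurable[of t0 "N - 1"] l by simp
      show "integrable lborel (\<lambda>y. B * ?E * (norm (W y) * (1 + \<bar>y\<bar>) powr real (N - 1)))"
        using integrable_weight_mono[OF integrable_weight N1] unfolding integrable_weight_def by (rule integrable_mult_right)
      show "norm (W y * (- (G' t * power_deriv (N - 1) y t))) \<le> B * ?E * (norm (W y) * (1 + \<bar>y\<bar>) powr real (N - 1))"
        if t: "l < t" "t < t0 + 1" for y t
      proof -
        have e1: "norm (power_deriv (N - 1) y t) \<le> ?E * (1 + \<bar>y\<bar>) powr real (N - 1)"
        proof -
          have "norm (power_deriv (N - 1) y t) \<le> growth (N - 1) ^ (N - 1) * t powr (- Re \<rho> - real (N - 1)) * (1 + \<bar>y\<bar>) powr real (N - 1)"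
            using t l by (intro norm_e_le) auto
          also have "\<dots> \<le> ?E * (1 + \<bar>y\<bar>) powr real (N - 1)"
            using t l growth_pos[of "N - 1"] by (intro mult_right_mono mult_left_mono powr_decreasing) auto
          finally show ?thesis .
        qed
        have "norm (W y * (- (G' t * power_deriv (N - 1) y t))) = norm (W y) * (norm (G' t) * norm (power_deriv (N - 1) y t))"
          by (simp add: norm_mult)
        also have "\<dots> \<le> norm (W y) * (B * (?E * (1 + \<bar>y\<bar>) powr real (N - 1)))"
          using t order_trans[OF norm_ge_zero B[of t]] by (intro mult_left_mono mult_mono B e1) auto
        finally show ?thesis by (simp only: mult_ac)
      qed
    qed (use l in auto)
    also have "(\<integral>y. W y * (- (G' t0 * power_deriv (N - 1) y t0)) \<partial>lborel) = - (G' t0 * h t0)"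
    proof -
      have "(\<lambda>y. W y * (- (G' t0 * power_deriv (N - 1) y t0))) = (\<lambda>y. (- G' t0) * (W y * power_deriv (N - 1) y t0))"
        by (simp add: fun_eq_iff)
      then have "(\<integral>y. W y * (- (G' t0 * power_deriv (N - 1) y t0)) \<partial>lborel) = (- G' t0) * superposition (N - 1) t0"
        by (simp only: integral_mult_right_zero superposition_def)
      then show ?thesis using h[of t0] l by simp
    qed
    finally have "((\<lambda>t. (\<integral>y. W y * (Q y (1 - x / t) - G t * power_deriv (N - 1) y t) \<partial>lborel) + G t * h t) has_vector_derivative
        - (G' t0 * h t0) + (G t0 * h' t0 + G' t0 * h t0)) (at t0)"
      by (intro has_vector_derivative_add has_vector_derivative_mult has_vector_derivative_G h' t0)
    then have "((\<lambda>t. (\<integral>y. W y * (Q y (1 - x / t) - G t * power_deriv (N - 1) y t) \<partial>lborel) + G t * h t) has_vector_derivative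
        G t0 * h' t0) (at t0)" by simp
    then show ?thesis
    proof (rule has_vector_derivative_transform_within_open[of _ _ _ "{x<..}"])
      fix t assume "t \<in> {x<..}"
      then have t: "t > x" "t > 0" using x_pos by auto
      have "(\<lambda>y. W y * (Q y (1 - x / t) - G t * power_deriv (N - 1) y t)) =
          (\<lambda>y. W y * Q y (1 - x / t) - G t * (W y * power_deriv (N - 1) y t))"
        by (simp add: fun_eq_iff right_diff_distrib mult.left_commute)
      then have "(\<integral>y. W y * (Q y (1 - x / t) - G t * power_deriv (N - 1) y t) \<partial>lborel) = P t - G t * superposition (N - 1) t"
        using intQ[OF t(1)] inte[OF t(1)] by (simp add: P_def superposition_def)
      then show "(\<integral>y. W y * (Q y (1 - x / t) - G t * power_deriv (N - 1) y t) \<partial>lborel) + G t * h t = P t"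
        using h[OF t(2)] by simp
    qed (use t0 in auto)
  qed
  have contQ: "continuous_on {0..1} (Q y)" for y
    unfolding Q_def using \<eta>_less by (intro continuous_intros incomplete_euler_continuous) (simp add: Re_d)
  let ?w = "\<lambda>y. \<bar>C\<bar> * (norm (W y) * (1 + \<bar>y\<bar>) powr \<kappa>)"
  have w: "integrable lborel ?w" using integrable_weight unfolding integrable_weight_def by (rule integrable_mult_right)
  have le_w: "norm (W y * Q y (1 - x / t)) \<le> ?w y" if "t > x" for y t
  proof -
    have "norm (Q y (1 - x / t)) \<le> C * (1 + \<bar>y\<bar>) powr \<kappa>" using ratio_unit[OF that] by (intro C) auto
    also have "\<dots> \<le> \<bar>C\<bar> * (1 + \<bar>y\<bar>) powr \<kappa>" by (intro mult_right_mono) auto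
    finally have "norm (W y) * norm (Q y (1 - x / t)) \<le> norm (W y) * (\<bar>C\<bar> * (1 + \<bar>y\<bar>) powr \<kappa>)"
      by (intro mult_left_mono) auto
    then show ?thesis by (simp only: norm_mult mult.left_commute)
  qed
  have meas: "(\<lambda>y. W y * Q y v) \<in> borel_measurable lborel" if "v \<le> 1" for v
    using W_measurable Q_measurable[OF that] by simp
  have lim_top: "(P \<longlongrightarrow> (\<integral>y. W y * Q y 1 \<partial>lborel)) at_top"
  proof (rule Lim_transform_eventually)
    \<comment> \<open>keeps the end point \<open>1 - x / T t\<close> inside the unit interval for all \<open>t\<close>, not only for large ones\<close>
    define T where "T t = max t (x + 1)" for t
    have T: "T t > x" for t by (simp add: T_def)
    show "((\<lambda>t. \<integral>y. W y * Q y (1 - x / T t) \<partial>lborel) \<longlongrightarrow> (\<integral>y. W y * Q y 1 \<partial>lborel)) at_top"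
    proof (rule integral_dominated_convergence_at_top[where w = ?w])
      show "(\<lambda>y. W y * Q y 1) \<in> borel_measurable lborel" by (intro meas) simp
      show "(\<lambda>y. W y * Q y (1 - x / T t)) \<in> borel_measurable lborel" for t
        using ratio_unit[OF T[of t]] by (intro meas) simp
      show "integrable lborel ?w" by (rule w)
      show "\<forall>\<^sub>F t in at_top. AE y in lborel. norm (W y * Q y (1 - x / T t)) \<le> ?w y"
        by (intro always_eventually allI AE_I2 le_w T)
      show "AE y in lborel. ((\<lambda>t. W y * Q y (1 - x / T t)) \<longlongrightarrow> W y * Q y 1) at_top"
      proof (intro AE_I2 tendsto_mult tendsto_const)
        fix y
        have "filterlim T at_top at_top"
          by (rule filterlim_at_top_mono[OF filterlim_ident]) (auto simp: T_def)
        then have "((\<lambda>t. 1 - x / T t) \<longlongrightarrow> 1 - 0) at_top"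
          by (intro tendsto_diff tendsto_const tendsto_divide_0[OF tendsto_const] filterlim_at_top_imp_at_infinity)
        moreover have "1 - x / T t \<in> {0..1}" for t
          using ratio_unit[OF T[of t]] by simp
        then have "\<forall>\<^sub>F t in at_top. 1 - x / T t \<in> {0..1}"
          by (intro always_eventually allI)
        ultimately show "((\<lambda>t. Q y (1 - x / T t)) \<longlongrightarrow> Q y 1) at_top"
          using continuous_on_tendsto_compose[OF contQ[of y], of "\<lambda>t. 1 - x / T t" 1 at_top] by simp
      qed
    qed
    show "\<forall>\<^sub>F t in at_top. (\<integral>y. W y * Q y (1 - x / T t) \<partial>lborel) = P t"
      using eventually_ge_at_top[of "x + 1"] by eventually_elim (simp add: T_def P_def)
  qed
  have lim_x: "(P \<longlongrightarrow> 0) (at_right x)"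
    unfolding tendsto_at_iff_sequentially
  proof (intro allI impI)
    fix X :: "nat \<Rightarrow> real" assume X: "\<forall>i. X i \<in> {x<..} - {x}" "X \<longlonglongrightarrow> x"
    then have X1: "X i > x" for i by auto
    have "(\<lambda>i. \<integral>y. W y * Q y (1 - x / X i) \<partial>lborel) \<longlonglongrightarrow> (\<integral>y. W y * Q y 0 \<partial>lborel)"
    proof (rule integral_dominated_convergence[where w = ?w])
      show "AE y in lborel. (\<lambda>i. W y * Q y (1 - x / X i)) \<longlonglongrightarrow> W y * Q y 0"
      proof (intro AE_I2 tendsto_mult tendsto_const)
        fix y
        have "(\<lambda>i. 1 - x / X i) \<longlonglongrightarrow> 1 - x / x"
          using X(2) x_pos by (intro tendsto_intros) auto
        moreover have "1 - x / X i \<in> {0..1}" for i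
          using ratio_unit[OF X1[of i]] by simp
        then have "\<forall>\<^sub>F i in sequentially. 1 - x / X i \<in> {0..1}"
          by (intro always_eventually allI)
        ultimately show "(\<lambda>i. Q y (1 - x / X i)) \<longlonglongrightarrow> Q y 0"
          using continuous_on_tendsto_compose[OF contQ[of y], of "\<lambda>i. 1 - x / X i" 0 sequentially] x_pos by simp
      qed
      show "(\<lambda>y. W y * Q y (1 - x / X i)) \<in> borel_measurable lborel" for i
        using ratio_unit[OF X1[of i]] by (intro meas) simp
      show "(\<lambda>y. W y * Q y 0) \<in> borel_measurable lborel" by (intro meas) simp
    qed (use w le_w X1 in auto)
    moreover have "Q y 0 = 0" for y using \<eta>_less by (simp add: Q_def incomplete_euler_0 Re_d)
    ultimately show "(P \<circ> X) \<longlonglongrightarrow> 0" by (simp add: P_def comp_def)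
  qed
  show ?thesis using P_deriv lim_x lim_top by (rule has_integral_greaterThan_FTC)
qed

text \<open>
  The factor \<open>pochhammer (d y) N\<close> from the \<open>N\<close>-th derivative cancels
  \<open>Gamma (d y) / Gamma (d y + N)\<close> from the Euler integral.
\<close>

lemma Q_1:
  "Q y 1 = (-1) ^ N * Gamma c * (Gamma (of_nat N + d y - b) * rGamma (c + d y - b)) * of_real x powr (- d y)"
proof -
  have "Re (d y) > 0" by (simp add: Re_d \<rho>_pos)
  then have nonpole: "d y \<notin> \<int>\<^sub>\<le>\<^sub>0" "d y + of_nat N \<notin> \<int>\<^sub>\<le>\<^sub>0" by (auto elim!: nonpos_Ints_cases simp: complex_eq_iff)
  have inc1: "incomplete_euler (d y) 1 = Gamma c * Gamma (d y) * Gamma (of_nat N + d y - b) * rGamma (d y + of_nat N) * rGamma (c + d y - b)"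
  proof -
    have "c + d y - a - b = of_nat N + d y - b" "c + d y - a = d y + of_nat N" by (simp_all add: c_eq)
    then show ?thesis using euler_integral[of "d y"] \<eta>_less by (simp only: Re_d)
  qed
  have "pochhammer (d y) N * Gamma (d y) * rGamma (d y + of_nat N) = 1"
    using nonpole by (simp add: pochhammer_Gamma Gamma_def rGamma_eq_zero_iff)
  moreover have "P * D * R = 1 \<Longrightarrow> S * P * X * (C * D * E * R * F) = S * C * (E * F) * X"
    for P D R S X C E F :: complex
  proof -
    assume 1: "P * D * R = 1"
    have "S * P * X * (C * D * E * R * F) = S * C * (E * F) * X * (P * D * R)" by (simp only: mult_ac)
    then show ?thesis by (simp only: 1 mult_1_right)
  qed
  ultimately show ?thesis unfolding Q_def inc1 by blast
qed

end

lemma saigo_integrand_eq: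
  assumes S: "saigo_kernel W \<rho> \<mu> (- \<alpha>) (- \<alpha> - \<gamma>) c \<eta> N x" and c: "c = of_nat N - \<alpha>" and t: "t > x"
  shows "saigo_integrand (- \<alpha> + of_nat N) (- 0 - of_nat N) (\<alpha> + \<gamma>) h x t =
    saigo_kernel.G (- \<alpha>) (- \<alpha> - \<gamma>) c N x t * h t"
proof -
  interpret saigo_kernel W \<rho> \<mu> "- \<alpha>" "- \<alpha> - \<gamma>" c \<eta> N x by (rule S)
  have t0: "t > 0" and u: "0 < 1 - x / t" using t x_pos ratio_unit[OF t] by auto
  have "t - x = t * (1 - x / t)" using t0 by (simp add: field_simps)
  then have "complex_of_real (t - x) powr (c - 1) = of_real t powr (c - 1) * of_real (1 - x / t) powr (c - 1)"
    using t0 u by (simp only: of_real_mult powr_times_real) (simp add: powr_times_real)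
  moreover have "complex_of_real t powr (c - 1) * of_real t powr \<alpha> = of_real t ^ (N - 1)"
  proof -
    have "complex_of_real t powr (c - 1) * of_real t powr \<alpha> = of_real t powr (c - 1 + \<alpha>)" by (rule powr_add[symmetric])
    also have "c - 1 + \<alpha> = of_nat (N - 1)" using N_pos by (simp add: c of_nat_diff)
    finally show ?thesis using t0 by (simp add: powr_nat')
  qed
  moreover have "P = T * U \<Longrightarrow> T * V = M \<Longrightarrow> P * V * F0 * H = M * (U * F0) * H" for P T U V M F0 H :: complex
    by simp
  moreover have "- \<alpha> + of_nat N = c" "- 0 - of_nat N + c = - \<alpha>" "- c - (- 0 - of_nat N) = \<alpha>" "- (\<alpha> + \<gamma>) = - \<alpha> - \<gamma>"
    "c + (- 0 - of_nat N) = - \<alpha>"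
    by (simp_all add: c)
  ultimately show ?thesis
    unfolding saigo_integrand_def G_def g_def F_eq_F21 by presburger
qed

section \<open>The Erdelyi-Kober derivative of the I-function\<close>

theorem corollary5p4:
  fixes \<alpha> \<gamma> \<rho> a :: complex and \<theta> \<mu> :: real and m n N :: nat
    and us ls us' ls' :: "triple list"
    and L :: "triple \<Rightarrow> complex \<Rightarrow> complex"
    and f :: "real \<Rightarrow> complex"
  defines "N \<equiv> caputo_order \<alpha>"
    and "us' \<equiv> (1 - \<alpha> - \<gamma> - \<rho> - of_nat N, \<mu>, 1) # us"
    and "ls' \<equiv> ls @ [(1 - \<gamma> - \<rho> - of_nat N, \<mu>, 1)]"
    and "f \<equiv> (\<lambda>t. of_real t powr (- \<rho>) * I_fun L m n us ls (a * of_real (t powr (- \<mu>))) \<theta>)"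
  assumes alpha: "Re \<alpha> > 0"
    and a_nz: "a \<noteq> 0"
    and arg_a: "a = of_real (norm a) * cis \<theta>"
    and mu: "\<mu> > 0"
    and rho: "Re \<rho> + real N > max (real N) (Re (- \<alpha> - \<gamma>))"
    and branch: "is_gamma_branch L"
    and params: "I_params m n us ls"
    and separated: "I_separated m n us ls"
    and conv: "I_abs_conv m n us ls \<theta>"
    and conv': "I_abs_conv m (n + 1) us' ls' \<theta>"
    and domain: "\<bar>\<theta>\<bar> = pi / 2 * I_Delta m n us ls \<Longrightarrow> times_differentiable_pos N f"
  shows "\<forall>x>0. caputo_EK_defined \<gamma> \<alpha> f x \<and>
           caputo_EK \<gamma> \<alpha> f x =
             of_real x powr (- \<rho>) * I_fun L m (n + 1) us' ls' (a * of_real (x powr (- \<mu>))) \<theta>"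
proof (intro allI impI)
  fix x :: real assume x: "x > 0"
  define W where "W = mb_weight L m n us ls a \<theta>"
  define c where "c = of_nat N - \<alpha>"
  \<comment> \<open>midway between the growth exponent of the hypergeometric factor at 1 and the decay \<open>Re \<rho>\<close>; the condition on \<open>\<rho>\<close> puts them in this order\<close>
  define \<eta> where "\<eta> = (max 0 (- Re (\<alpha> + \<gamma>) - real N) + Re \<rho>) / 2"
  have N: "N > 0" "real N - 1 \<le> Re \<alpha>" "Re \<alpha> < real N"
    using alpha unfolding N_def caputo_order_def by (simp, linarith, linarith)
  have ml: "m \<le> length ls" using params by (simp add: I_params_def)
  interpret P: power_superposition W \<rho> \<mu>
    by unfold_locales (use rho mu mb_weight_measurable[OF branch] in \<open>auto simp: W_def\<close>)
  interpret K: saigo_kernel W \<rho> \<mu> "- \<alpha>" "- \<alpha> - \<gamma>" c \<eta> N x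
    by unfold_locales (use rho N x in \<open>auto simp: c_def \<eta>_def max_def\<close>)

  have f_eq: "f t = P.superposition 0 t" if "t > 0" for t
    unfolding f_def powr_times_I_fun[OF a_nz that] W_def[symmetric] P.superposition_def P.power_deriv_def P.d_def by simp
  have Delta': "I_Delta m (n + 1) us' ls' = I_Delta m n us ls"
    using ml by (simp add: I_Delta_def us'_def ls'_def)
  have Omega': "I_Omega us' ls' = I_Omega us ls + Re \<alpha>"
    by (simp add: I_Omega_def us'_def ls'_def algebra_simps)
  let ?q = "\<bar>\<theta>\<bar> - pi / 2 * I_Delta m n us ls"
  have integrable_weight: "P.integrable_weight \<kappa>" if "?q < 0 \<or> ?q = 0 \<and> I_Omega us ls + \<kappa> < -1" for \<kappa>
    unfolding P.integrable_weight_def unfolding W_def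
    by (rule integrable_vertical_bound[OF vertical_bound_mb_weight[OF branch params separated] mb_weight_measurable[OF branch] that])
  have diff: "times_differentiable_pos N f"
  proof (cases "?q = 0")
    case True
    then show ?thesis using domain by simp
  next
    case False
    then have "?q < 0" using conv unfolding I_abs_conv_def Let_def by auto
    then have "P.integrable_weight (real N)" by (intro integrable_weight) simp
    then show ?thesis unfolding times_differentiable_pos_def
      using P.differentiable_nth_deriv[OF _ f_eq] by auto
  qed
  \<comment> \<open>in the borderline case the room above \<open>Re \<alpha>\<close> comes from \<open>\<Omega> + Re \<alpha> < -1\<close>, the convergence condition of the new I-function\<close>
  obtain \<kappa> where \<kappa>: "Re \<alpha> < \<kappa>" "\<kappa> \<le> real N" "P.integrable_weight \<kappa>"
  proof (cases "?q < 0")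
    case True
    then show thesis using N by (intro that[of "real N"] integrable_weight) auto
  next
    case False
    then have q: "?q = 0" using conv unfolding I_abs_conv_def Let_def by auto
    then have "I_Omega us ls + Re \<alpha> < -1"
      using conv' unfolding I_abs_conv_def Let_def Delta' Omega' by auto
    then have "Re \<alpha> < min (real N) (-1 - I_Omega us ls)" using N by simp
    then obtain \<kappa> where "Re \<alpha> < \<kappa>" "\<kappa> < min (real N) (-1 - I_Omega us ls)" using dense by blast
    then show thesis using q by (intro that[of \<kappa>] integrable_weight) auto
  qed

  have SN: "Suc (N - 1) = N" using N by simp
  have "((\<lambda>t. K.G t * nth_deriv N f t) has_integral (\<integral>y. W y * K.Q y 1 \<partial>lborel)) {x<..}"
  proof (rule K.has_integral_kernel[OF _ \<kappa>(2,3), where h = "nth_deriv (N - 1) f"])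
    show "real N - Re c < \<kappa>" using \<kappa> by (simp add: c_def)
    show "nth_deriv (N - 1) f t = P.superposition (N - 1) t" if "t > 0" for t
      using \<kappa> N that by (intro P.nth_deriv_eq_superposition[OF \<kappa>(3) f_eq]) (auto simp: of_nat_diff)
    show "(nth_deriv (N - 1) f has_vector_derivative nth_deriv N f t) (at t)" if "t > x" for t
    proof -
      have "nth_deriv (N - 1) f differentiable (at t)"
        using diff that x N unfolding times_differentiable_pos_def by auto
      then show ?thesis
        using P.nth_deriv_Suc[of "N - 1" f t] unfolding SN by (simp add: vector_derivative_works)
    qed
  qed
  then have int: "(saigo_integrand (- \<alpha> + of_nat N) (- 0 - of_nat N) (\<alpha> + \<gamma>) (nth_deriv N f) x
      has_integral (\<integral>y. W y * K.Q y 1 \<partial>lborel)) {x<..}"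
    by (rule has_integral_eq[rotated], intro saigo_integrand_eq[OF K.saigo_kernel_axioms c_def, symmetric]) simp
  have value_eq: "(\<integral>y. W y * K.Q y 1 \<partial>lborel) =
      (-1) ^ N * Gamma c * (of_real x powr (- \<rho>) * I_fun L m (n + 1) us' ls' (a * of_real (x powr (- \<mu>))) \<theta>)"
  proof -
    have "W y * K.Q y 1 = (-1) ^ N * Gamma c *
        (mb_weight L m (n + 1) us' ls' a \<theta> y * of_real x powr (- (\<rho> - \<i> * of_real (\<mu> * y))))" for y
    proof -
      have "I_chi L m (n + 1) us' ls' (\<i> * of_real y) = I_chi L m n us ls (\<i> * of_real y) *
          (Gamma (of_nat N + P.d y - (- \<alpha> - \<gamma>)) * rGamma (c + P.d y - (- \<alpha> - \<gamma>)))"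
      proof -
        have "1 - (1 - \<alpha> - \<gamma> - \<rho> - of_nat N) + of_real (- \<mu>) * (\<i> * of_real y) = of_nat N + P.d y - (- \<alpha> - \<gamma>)"
          "1 - (1 - \<gamma> - \<rho> - of_nat N) + of_real (- \<mu>) * (\<i> * of_real y) = c + P.d y - (- \<alpha> - \<gamma>)"
          by (simp_all add: P.d_def c_def algebra_simps)
        then show ?thesis
          unfolding us'_def ls'_def I_chi_insert[OF ml]
          by (simp only: Gamma_pow_1[OF branch] Re_i_times Im_complex_of_real minus_zero rGamma_inverse_Gamma divide_inverse)
      qed
      then show ?thesis unfolding K.Q_1 W_def mb_weight_def P.d_def by (simp add: mult_ac)
    qed
    then have "(\<integral>y. W y * K.Q y 1 \<partial>lborel) = (-1) ^ N * Gamma c *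
        (\<integral>y. mb_weight L m (n + 1) us' ls' a \<theta> y * of_real x powr (- (\<rho> - \<i> * of_real (\<mu> * y))) \<partial>lborel)"
      by (simp only: integral_mult_right_zero)
    then show ?thesis by (simp only: powr_times_I_fun[OF a_nz x])
  qed
  have "Gamma c \<noteq> 0" using K.c_nonpole by (simp add: Gamma_eq_zero_iff)
  moreover have "- \<alpha> + of_nat N = c" by (simp add: c_def)
  moreover have "(-1) ^ N * (-1) ^ N = (1 :: complex)" by (simp flip: power_mult_distrib)
  ultimately have "caputo_EK \<gamma> \<alpha> f x =
      of_real x powr (- \<rho>) * I_fun L m (n + 1) us' ls' (a * of_real (x powr (- \<mu>))) \<theta>"
    unfolding caputo_EK_def caputo_right_def saigo_right_def Let_def N_def[symmetric]
      integral_unique[OF int] value_eq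
    by (simp add: field_simps)
  moreover have "caputo_EK_defined \<gamma> \<alpha> f x"
    unfolding caputo_EK_defined_def caputo_right_defined_def Let_def N_def[symmetric]
    using diff has_integral_integrable[OF int] by blast
  ultimately show "caputo_EK_defined \<gamma> \<alpha> f x \<and> caputo_EK \<gamma> \<alpha> f x =
      of_real x powr (- \<rho>) * I_fun L m (n + 1) us' ls' (a * of_real (x powr (- \<mu>))) \<theta>" by blast
qed

end
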